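(* Let $\varepsilon\in\mathbb{C}\setminus\{1,-1\}$ and $a=\frac{1-\varepsilon}{1+\varepsilon}$. On $M=\mathbb{C}^{1|4}(x|\xi_1,\xi_2,\xi_3,\xi_4)$ with the contact form $\sigma=dx+\sum_{i=1}^4\xi_i\,d\xi_i$, consider the system $\mathcal{E}$ of linear differential equations on a function $f=f(x,\xi_1,\dots,\xi_4)$: $$(\varepsilon\,\partial_x^2+\partial_{\xi_1}\partial_{\xi_2}\partial_{\xi_3}\partial_{\xi_4})(f)=0,\qquad \xi_i(\varepsilon\,\partial_x\partial_{\xi_i}+\partial_{\xi_i^\vee})(f)=0\ \ (\text{no summation over } i),\qquad \partial_x\partial_{\xi_i}\partial_{\xi_j}(f)=0.$$ Then the Lie superalgebra $D(2,1;a)$ is the symmetry subalgebra of the (infinitely prolonged) differential system $\mathcal{E}^\infty$ within the algebra of lifted contact vector fields $\mathfrak{cont}^{(\infty)}(M)\subset\mathfrak{vect}(J^\infty M)$.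
   Context: $x$ is even, $\xi_i$ are odd, and the indices $i,j$ run over $1,\dots,4$. Put $\nu=\xi_1\xi_2\xi_3\xi_4$ and $\xi_i^\vee=\partial_{\xi_i}\nu$; if $\xi_i^\vee=\xi_j\xi_k\xi_l$ then $\partial_{\xi_i^\vee}=\partial_{\xi_j}\partial_{\xi_k}\partial_{\xi_l}$. With $D_{\xi_i}=\partial_{\xi_i}+\xi_i\partial_x$, contact vector fields on $M$ (those preserving the distribution $\ker\sigma=\langle D_{\xi_i}\rangle$) are $X_f=f\partial_x+(-1)^{|f|}\tfrac12\sum_{j=1}^4(D_{\xi_j}f)D_{\xi_j}$ for functions $f$ on $M$; they form the Lie superalgebra $\mathfrak{cont}(M)$. $J^0M=M\times\mathbb{C}$ has coordinates $(x,\xi_i,h)$ with $h$ even (dependent variable), and $J^kM$, $J^\infty M$ are the jet spaces of functions $h=h(x,\xi)$ on $M$. A contact field is lifted to $J^0M$ by $X_f\mapsto X_f^{(0)}=X_f+f_x\,h\,\partial_h$ (a Lie superalgebra homomorphism), where $f_x=\partial_xf$, and then prolonged in the standard way to $J^kM$ for all $k\le\infty$; $\mathfrak{cont}^{(\infty)}(M)$ is the resulting algebra. The system $\mathcal{E}$ (with unknown function $h=f(x,\xi)$) is viewed with all its prolongations as a submanifold $\mathcal{E}^\infty\subset J^\infty M$; a symmetry is a vector field whose prolongation preserves the ideal of the system, and it then maps solutions of $\mathcal{E}$ to solutions. $D(2,1;a)=\Gamma(-1-a,1,a)$ for $a\ne0,-1$, where for $s_1+s_2+s_3=0$, $\Gamma(s_1,s_2,s_3)$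 is the Lie superalgebra with even part $\mathfrak{sl}_2^{\oplus3}$ ($i$-th copy with standard basis $X_i,H_i,Y_i$), odd part $\mathbb{C}^2\boxtimes\mathbb{C}^2\boxtimes\mathbb{C}^2$ (each $\mathbb{C}^2=\langle x,y\rangle$ standard: $X=x\partial_y$, $H=x\partial_x-y\partial_y$, $Y=y\partial_x$), and odd-odd bracket $[v_1v_2v_3,w_1w_2w_3]=s_1\varphi_1(v_1w_1)\eta_2(v_2,w_2)\eta_3(v_3,w_3)+s_2\eta_1(v_1,w_1)\varphi_2(v_2w_2)\eta_3(v_3,w_3)+s_3\eta_1(v_1,w_1)\eta_2(v_2,w_2)\varphi_3(v_3w_3)$, with $\eta_i$ skew, $\eta_i(x,y)=1$, $\varphi_i:x^2\mapsto X_i,\ -2xy\mapsto H_i,\ -y^2\mapsto Y_i$. (In this last paragraph $x,y$ are basis vectors of $\mathbb{C}^2$, unrelated to the coordinate $x$.)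
   Formalization: The formal theorem also assumes ε ≠ 0; at ε = 0 (a = 1) the claim is false, since every contact field X_g with g = g(x) is then a symmetry and the symmetry algebra is infinite-dimensional. *)

theory Defs
  imports "HOL-Analysis.Analysis" "HOL-Library.Function_Algebras"
begin

section \<open>Superfunctions\<close>

datatype idx = I1 | I2 | I3 | I4

fun num :: "idx \<Rightarrow> nat" where
  "num I1 = 1" | "num I2 = 2" | "num I3 = 3" | "num I4 = 4"

text \<open>
  Coordinates of \<open>J\<^sup>\<infinity>M\<close>, \<open>M = \<complex>\<^sup>1\<^sup>|\<^sup>4\<close>: the base coordinates \<open>x\<close> and \<open>\<xi>\<^sub>i\<close>, and the jet coordinates
  \<open>Ch m I\<close>, which stand for \<open>\<partial>\<^sub>x\<^sup>m \<partial>\<^bsub>\<xi>i1\<^esub> \<dots> \<partial>\<^bsub>\<xi>ir\<^esub> h\<close> where \<open>I = {i1 < \<dots> < ir}\<close>; \<open>Ch 0 {}\<close> is \<open>h\<close> itself.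
\<close>

datatype coord = Cx | Cxi idx | Ch nat "idx set"

fun odd_coord :: "coord \<Rightarrow> bool" where
  "odd_coord Cx = False"
| "odd_coord (Cxi i) = True"
| "odd_coord (Ch m I) = odd (card I)"

text \<open>An injective numbering of the coordinates; it only fixes the order in which odd coordinates
  are written in a monomial.\<close>

fun rank :: "coord \<Rightarrow> nat" where
  "rank Cx = 0"
| "rank (Cxi i) = num i"
| "rank (Ch m I) = 5 + 16 * m + (\<Sum>i\<in>I. 2 ^ (num i - 1))"

text \<open>
  \<open>F S p\<close> is the value at \<open>p\<close> of the coefficient of the monomial \<open>\<theta>\<^sub>1 \<dots> \<theta>\<^sub>r\<close>, where \<open>\<theta>\<^sub>1, \<dots>, \<theta>\<^sub>r\<close> are the odd
  coordinates in \<open>S\<close> by increasing rank and \<open>p\<close> assigns values to the even coordinates (the values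
  of \<open>p\<close> at odd coordinates are irrelevant). Addition is the pointwise one; the product is
  \<open>sprod\<close>, not the pointwise product of functions.
\<close>

type_synonym superfun = "coord set \<Rightarrow> (coord \<Rightarrow> complex) \<Rightarrow> complex"

definition even_pd :: "coord \<Rightarrow> ((coord \<Rightarrow> complex) \<Rightarrow> complex) \<Rightarrow> (coord \<Rightarrow> complex) \<Rightarrow> complex" where
  "even_pd u g = (\<lambda>p. deriv (\<lambda>z. g (p(u := z))) (p u))"

text \<open>Entire functions of the coordinates in \<open>V\<close>: all iterated complex partial derivatives exist
  and are continuous.\<close>

definition entire_in :: "coord set \<Rightarrow> ((coord \<Rightarrow> complex) \<Rightarrow> complex) \<Rightarrow> bool" where
  "entire_in V g \<longleftrightarrow>
     (\<forall>p q. (\<forall>u\<in>V. p u = q u) \<longrightarrow> g p = g q) \<and>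
     (\<forall>us. continuous_on UNIV (fold even_pd us g) \<and>
           (\<forall>p u. (\<lambda>z. fold even_pd us g (p(u := z))) field_differentiable at (p u)))"

definition superfuns :: "coord set \<Rightarrow> superfun set" where
  "superfuns V = {F. (\<forall>S. \<not> S \<subseteq> {u \<in> V. odd_coord u} \<longrightarrow> F S = 0) \<and>
                     (\<forall>S. entire_in {u \<in> V. \<not> odd_coord u} (F S))}"

definition base_coords :: "coord set" where
  "base_coords = insert Cx (range Cxi)"

definition jet_coords :: "nat \<Rightarrow> coord set" where
  "jet_coords k = base_coords \<union> {Ch m I | m I. m + card I \<le> k}"

definition functions_M :: "superfun set" where
  "functions_M = superfuns base_coords"

definition functions_J :: "superfun set" where
  "functions_J = (\<Union>k. superfuns (jet_coords k))"

definition inversions :: "coord set \<Rightarrow> coord set \<Rightarrow> nat" where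
  "inversions A B = card {(a, b). a \<in> A \<and> b \<in> B \<and> rank b < rank a}"

definition sprod :: "superfun \<Rightarrow> superfun \<Rightarrow> superfun" (infixl "\<odot>" 70) where
  "F \<odot> G = (\<lambda>S p. \<Sum>A\<in>Pow S. (-1) ^ inversions A (S - A) * F A p * G (S - A) p)"

definition const :: "complex \<Rightarrow> superfun" where
  "const c = (\<lambda>S p. if S = {} then c else 0)"

definition crd :: "coord \<Rightarrow> superfun" where
  "crd u = (if odd_coord u then (\<lambda>S p. if S = {u} then 1 else 0)
            else (\<lambda>S p. if S = {} then p u else 0))"

text \<open>Partial (for odd coordinates: left) derivatives.\<close>

definition pd :: "coord \<Rightarrow> superfun \<Rightarrow> superfun" where
  "pd u F = (if odd_coord u
     then (\<lambda>S p. if u \<in> S then 0 else (-1) ^ card {s \<in> S. rank s < rank u} * F (insert u S) p)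
     else (\<lambda>S. even_pd u (F S)))"

text \<open>The grading involution \<open>F \<mapsto> (-1)\<^bsup>|F|\<^esup> F\<close>, linearly extended to inhomogeneous \<open>F\<close>.\<close>

definition invol :: "superfun \<Rightarrow> superfun" where
  "invol F = (\<lambda>S p. (-1) ^ card S * F S p)"

section \<open>Vector fields\<close>

text \<open>\<open>V\<close> stands for \<open>\<Sum>u. V u \<cdot> \<partial>\<^sub>u\<close>. The sum defining its action is finite on functions that involve
  finitely many coordinates, in particular on \<open>functions_J\<close>.\<close>

type_synonym vfield = "coord \<Rightarrow> superfun"

definition vapply :: "vfield \<Rightarrow> superfun \<Rightarrow> superfun" where
  "vapply V F = (\<Sum>u | pd u F \<noteq> 0. V u \<odot> pd u F)"

definition dd :: "coord \<Rightarrow> vfield" where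
  "dd u = (\<lambda>v. if v = u then const 1 else 0)"

definition fmult :: "superfun \<Rightarrow> vfield \<Rightarrow> vfield" where
  "fmult G V = (\<lambda>u. G \<odot> V u)"

definition vscale :: "complex \<Rightarrow> vfield \<Rightarrow> vfield" where
  "vscale c V = (\<lambda>u. const c \<odot> V u)"

text \<open>The parity of \<open>V\<close> is that of \<open>V u\<close> plus that of \<open>u\<close>; \<open>vpart True\<close> is the odd part.\<close>

definition vpart :: "bool \<Rightarrow> vfield \<Rightarrow> vfield" where
  "vpart q V = (\<lambda>u S. if (odd (card S) \<noteq> odd_coord u) = q then V u S else 0)"

definition vbracket :: "vfield \<Rightarrow> vfield \<Rightarrow> vfield" where
  "vbracket V W = (\<lambda>u. \<Sum>q\<in>UNIV. \<Sum>r\<in>UNIV.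
     vapply (vpart q V) (vpart r W u) -
     const (if q \<and> r then - 1 else 1) \<odot> vapply (vpart r W) (vpart q V u))"

section \<open>Contact vector fields and their prolongation\<close>

definition contact_D :: "idx \<Rightarrow> vfield" where
  "contact_D i = dd (Cxi i) + fmult (crd (Cxi i)) (dd Cx)"

definition contact_field :: "superfun \<Rightarrow> vfield" where
  "contact_field f = fmult f (dd Cx) +
     vscale (1/2) (\<Sum>j\<in>{I1, I2, I3, I4}. fmult (vapply (contact_D j) (invol f)) (contact_D j))"

definition lift0 :: "superfun \<Rightarrow> vfield" where
  "lift0 f = contact_field f + fmult (pd Cx f \<odot> crd (Ch 0 {})) (dd (Ch 0 {}))"

text \<open>Total derivatives. The sign comes from moving \<open>\<partial>\<^bsub>\<xi>i\<^esub>\<close> to its place in \<open>\<partial>\<^bsub>\<xi>i1\<^esub> \<dots> \<partial>\<^bsub>\<xi>ir\<^esub>\<close>.\<close>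

fun total_x :: vfield where
  "total_x Cx = const 1"
| "total_x (Cxi j) = 0"
| "total_x (Ch m I) = crd (Ch (Suc m) I)"

fun total_xi :: "idx \<Rightarrow> vfield" where
  "total_xi i Cx = 0"
| "total_xi i (Cxi j) = (if j = i then const 1 else 0)"
| "total_xi i (Ch m I) =
     (if i \<in> I then 0
      else const ((-1) ^ card {j \<in> I. num j < num i}) \<odot> crd (Ch m (insert i I)))"

definition Dx :: "superfun \<Rightarrow> superfun" where "Dx = vapply total_x"

definition Dxi :: "idx \<Rightarrow> superfun \<Rightarrow> superfun" where "Dxi i = vapply (total_xi i)"

definition Dxis :: "idx set \<Rightarrow> superfun \<Rightarrow> superfun" where
  "Dxis I F = foldr Dxi (filter (\<lambda>i. i \<in> I) [I1, I2, I3, I4]) F"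

text \<open>
  The standard prolongation formula. For \<open>V = a \<partial>\<^sub>x + \<Sum>i. b\<^sub>i \<partial>\<^bsub>\<xi>i\<^esub> + c \<partial>\<^sub>h\<close> on \<open>J\<^sup>0M\<close> with characteristic
  \<open>Q = c - a h\<^sub>x - \<Sum>i. b\<^sub>i h\<^bsub>\<xi>i\<^esub>\<close>, the prolongation is \<open>a D\<^sub>x + \<Sum>i. b\<^sub>i D\<^bsub>\<xi>i\<^esub>\<close> plus the evolutionary field of \<open>Q\<close>,
  whose coefficient at the jet coordinate \<open>D\<^sub>x\<^sup>m D\<^sub>I h\<close> is \<open>(-1)\<^bsup>|V||I|\<^esup> D\<^sub>x\<^sup>m D\<^sub>I Q\<close>. As \<open>|Q| = |V|\<close>, that
  sign is the \<open>|I|\<close>-fold grading involution of \<open>Q\<close>.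
\<close>

definition characteristic :: "vfield \<Rightarrow> superfun" where
  "characteristic V = V (Ch 0 {}) - V Cx \<odot> crd (Ch 1 {}) -
     (\<Sum>i\<in>{I1, I2, I3, I4}. V (Cxi i) \<odot> crd (Ch 0 {i}))"

fun prolong :: "vfield \<Rightarrow> vfield" where
  "prolong V Cx = V Cx"
| "prolong V (Cxi i) = V (Cxi i)"
| "prolong V (Ch m I) =
     (Dx ^^ m) (Dxis I ((invol ^^ card I) (characteristic V))) +
     V Cx \<odot> total_x (Ch m I) + (\<Sum>i\<in>{I1, I2, I3, I4}. V (Cxi i) \<odot> total_xi i (Ch m I))"

definition cont_infty :: "vfield set" where
  "cont_infty = {prolong (lift0 f) | f. f \<in> functions_M}"

section \<open>The differential system and its symmetries\<close>

text \<open>\<open>\<xi>\<^sub>i\<^sup>\<or> = \<partial>\<^bsub>\<xi>i\<^esub>(\<xi>\<^sub>1\<xi>\<^sub>2\<xi>\<^sub>3\<xi>\<^sub>4)\<close> is \<open>(-1)\<^bsup>i-1\<^esup>\<close> times the increasing product of the other three \<open>\<xi>\<close>'s.\<close>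

definition D_check :: "idx \<Rightarrow> superfun \<Rightarrow> superfun" where
  "D_check i F = const ((-1) ^ (num i - 1)) \<odot> Dxis (- {i}) F"

text \<open>
  For \<open>\<epsilon> = 0\<close> this system degenerates: its solutions are all \<open>g(x) + \<Sum>i. g\<^sub>i(x) \<xi>\<^sub>i + \<Sum>i<j. c\<^sub>i\<^sub>j \<xi>\<^sub>i\<xi>\<^sub>j\<close> with
  arbitrary \<open>g, g\<^sub>i\<close>, every \<open>X\<^sub>g\<close> with \<open>g = g(x)\<close> is a symmetry, and \<open>X\<^sub>f\<close> with \<open>f = \<xi>\<^sub>1\<close> is not one (it maps the solution
  \<open>x\<^sup>2\<xi>\<^sub>2\<close> to a nonzero multiple of \<open>x\<xi>\<^sub>1\<xi>\<^sub>2\<close>). The symmetry algebra is then infinite-dimensional.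
\<close>

definition system_E :: "complex \<Rightarrow> superfun set" where
  "system_E \<epsilon> = (let h = crd (Ch 0 {}) in
     {const \<epsilon> \<odot> Dx (Dx h) + Dxi I1 (Dxi I2 (Dxi I3 (Dxi I4 h)))} \<union>
     {crd (Cxi i) \<odot> (const \<epsilon> \<odot> Dx (Dxi i h) + D_check i h) | i. True} \<union>
     {Dx (Dxi i (Dxi j h)) | i j. True})"

text \<open>The ideal of \<open>functions_J\<close> generated by all total derivatives of the equations (a two-sided
  ideal when the equations are homogeneous).\<close>

inductive_set ideal_infty :: "superfun set \<Rightarrow> superfun set" for Es where
  zero: "0 \<in> ideal_infty Es"
| step: "\<lbrakk>F \<in> Es; G \<in> functions_J; K \<in> ideal_infty Es\<rbrakk>
         \<Longrightarrow> G \<odot> (Dx ^^ m) (Dxis I F) + K \<in> ideal_infty Es"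

definition symmetries :: "superfun set \<Rightarrow> vfield set" where
  "symmetries Es = {V \<in> cont_infty. \<forall>F\<in>ideal_infty Es. vapply V F \<in> ideal_infty Es}"

section \<open>Lie superalgebras\<close>

record 'a superalg =
  sa_carrier :: "'a set"
  sa_even :: "'a set"
  sa_odd :: "'a set"
  sa_add :: "'a \<Rightarrow> 'a \<Rightarrow> 'a"
  sa_scale :: "complex \<Rightarrow> 'a \<Rightarrow> 'a"
  sa_bracket :: "'a \<Rightarrow> 'a \<Rightarrow> 'a"

definition superalg_iso :: "'a superalg \<Rightarrow> 'b superalg \<Rightarrow> ('a \<Rightarrow> 'b) \<Rightarrow> bool" where
  "superalg_iso A B \<phi> \<longleftrightarrow>
     bij_betw \<phi> (sa_carrier A) (sa_carrier B) \<and>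
     \<phi> ` sa_even A = sa_even B \<and> \<phi> ` sa_odd A = sa_odd B \<and>
     (\<forall>u\<in>sa_carrier A. \<forall>c. \<phi> (sa_scale A c u) = sa_scale B c (\<phi> u)) \<and>
     (\<forall>u\<in>sa_carrier A. \<forall>v\<in>sa_carrier A.
        \<phi> (sa_add A u v) = sa_add B (\<phi> u) (\<phi> v) \<and>
        \<phi> (sa_bracket A u v) = sa_bracket B (\<phi> u) (\<phi> v))"

definition superalg_isomorphic :: "'a superalg \<Rightarrow> 'b superalg \<Rightarrow> bool" where
  "superalg_isomorphic A B \<longleftrightarrow> (\<exists>\<phi>. superalg_iso A B \<phi>)"

definition vfield_superalg :: "vfield set \<Rightarrow> vfield superalg" where
  "vfield_superalg L = \<lparr>
     sa_carrier = L,
     sa_even = {V \<in> L. vpart False V = V},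
     sa_odd = {V \<in> L. vpart True V = V},
     sa_add = (+),
     sa_scale = vscale,
     sa_bracket = vbracket\<rparr>"

subsection \<open>The Lie superalgebras \<open>\<Gamma>(s\<^sub>1, s\<^sub>2, s\<^sub>3)\<close>\<close>

text \<open>
  \<open>sl\<^sub>2\<close> is the algebra of trace-free matrices in the basis \<open>(x, y)\<close> of \<open>\<complex>\<^sup>2\<close>, so that index \<open>1\<close> stands
  for \<open>x\<close> and \<open>2\<close> for \<open>y\<close>, and \<open>t $ i $ j $ k\<close> is the coefficient of \<open>e\<^sub>i \<otimes> e\<^sub>j \<otimes> e\<^sub>k\<close>.
\<close>

type_synonym mat2 = "complex ^ 2 ^ 2"
type_synonym tens = "complex ^ 2 ^ 2 ^ 2"
type_synonym gam = "mat2 \<times> mat2 \<times> mat2 \<times> tens"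

definition slX :: mat2 where "slX = vector [vector [0, 1], vector [0, 0]]"
definition slH :: mat2 where "slH = vector [vector [1, 0], vector [0, - 1]]"
definition slY :: mat2 where "slY = vector [vector [0, 0], vector [1, 0]]"

definition mscale :: "complex \<Rightarrow> mat2 \<Rightarrow> mat2" where
  "mscale c A = (\<chi> i j. c * A $ i $ j)"

definition tscale :: "complex \<Rightarrow> tens \<Rightarrow> tens" where
  "tscale c t = (\<chi> i j k. c * t $ i $ j $ k)"

definition commutator :: "mat2 \<Rightarrow> mat2 \<Rightarrow> mat2" where
  "commutator A B = A ** B - B ** A"

definition act :: "mat2 \<Rightarrow> mat2 \<Rightarrow> mat2 \<Rightarrow> tens \<Rightarrow> tens" where
  "act A B C t = (\<chi> i j k. (\<Sum>l\<in>UNIV. A $ i $ l * t $ l $ j $ k) +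
     (\<Sum>l\<in>UNIV. B $ j $ l * t $ i $ l $ k) + (\<Sum>l\<in>UNIV. C $ k $ l * t $ i $ j $ l))"

definition eta :: "2 \<Rightarrow> 2 \<Rightarrow> complex" where
  "eta i j = (if i = 1 \<and> j = 2 then 1 else if i = 2 \<and> j = 1 then - 1 else 0)"

text \<open>\<open>phi i j\<close> is \<open>\<phi>(e\<^sub>i e\<^sub>j)\<close>.\<close>

definition phi :: "2 \<Rightarrow> 2 \<Rightarrow> mat2" where
  "phi i j = (if i = 1 \<and> j = 1 then slX else if i = 2 \<and> j = 2 then - slY else mscale (- 1/2) slH)"

definition odd_bracket1 :: "tens \<Rightarrow> tens \<Rightarrow> mat2" where
  "odd_bracket1 t u = (\<Sum>i\<in>UNIV. \<Sum>j\<in>UNIV. \<Sum>k\<in>UNIV. \<Sum>l\<in>UNIV. \<Sum>m\<in>UNIV. \<Sum>n\<in>UNIV.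
     mscale (t $ i $ j $ k * u $ l $ m $ n * eta j m * eta k n) (phi i l))"

definition odd_bracket2 :: "tens \<Rightarrow> tens \<Rightarrow> mat2" where
  "odd_bracket2 t u = (\<Sum>i\<in>UNIV. \<Sum>j\<in>UNIV. \<Sum>k\<in>UNIV. \<Sum>l\<in>UNIV. \<Sum>m\<in>UNIV. \<Sum>n\<in>UNIV.
     mscale (t $ i $ j $ k * u $ l $ m $ n * eta i l * eta k n) (phi j m))"

definition odd_bracket3 :: "tens \<Rightarrow> tens \<Rightarrow> mat2" where
  "odd_bracket3 t u = (\<Sum>i\<in>UNIV. \<Sum>j\<in>UNIV. \<Sum>k\<in>UNIV. \<Sum>l\<in>UNIV. \<Sum>m\<in>UNIV. \<Sum>n\<in>UNIV.
     mscale (t $ i $ j $ k * u $ l $ m $ n * eta i l * eta j m) (phi k n))"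

fun gam_bracket :: "complex \<Rightarrow> complex \<Rightarrow> complex \<Rightarrow> gam \<Rightarrow> gam \<Rightarrow> gam" where
  "gam_bracket s1 s2 s3 (A1, A2, A3, t) (B1, B2, B3, u) =
     (commutator A1 B1 + mscale s1 (odd_bracket1 t u),
      commutator A2 B2 + mscale s2 (odd_bracket2 t u),
      commutator A3 B3 + mscale s3 (odd_bracket3 t u),
      act A1 A2 A3 u - act B1 B2 B3 t)"

fun gam_scale :: "complex \<Rightarrow> gam \<Rightarrow> gam" where
  "gam_scale c (A1, A2, A3, t) = (mscale c A1, mscale c A2, mscale c A3, tscale c t)"

definition sl2 :: "mat2 set" where "sl2 = {A. trace A = 0}"

definition Gamma_superalg :: "complex \<Rightarrow> complex \<Rightarrow> complex \<Rightarrow> gam superalg" where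
  "Gamma_superalg s1 s2 s3 = \<lparr>
     sa_carrier = sl2 \<times> sl2 \<times> sl2 \<times> UNIV,
     sa_even = sl2 \<times> sl2 \<times> sl2 \<times> {0},
     sa_odd = {0} \<times> {0} \<times> {0} \<times> UNIV,
     sa_add = (+),
     sa_scale = gam_scale,
     sa_bracket = gam_bracket s1 s2 s3\<rparr>"

definition D21 :: "complex \<Rightarrow> gam superalg" where
  "D21 a = Gamma_superalg (- 1 - a) 1 a"

end

theory Submission
  imports Defs
begin

text \<open>
  A function on \<open>J\<^sup>\<infinity>M\<close> that is linear in the jet coordinates is a linear differential operator \<open>L\<close> on functions of
  \<open>x, \<xi>\<close>, and the prolonged contact field with generating function \<open>f\<close> acts on it by \<open>L \<mapsto> X\<^sub>f L \<minusplus> L (X\<^sub>f - f\<^sub>x)\<close>. For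
  \<open>\<epsilon> \<noteq> 0\<close> the system has finite type: an operator lies in the ideal iff it annihilates the \<open>9|8\<close>-dimensional space of
  solutions. Hence \<open>f\<close> generates a symmetry iff \<open>X\<^sub>f - f\<^sub>x\<close> maps solutions to solutions. As \<open>X\<^sub>f s - f\<^sub>x s\<close> is the contact
  bracket of \<open>f\<close> and \<open>s\<close>, and the solutions are closed under it, every solution generates a symmetry; conversely, applying
  \<open>X\<^sub>f - f\<^sub>x\<close> to the solutions \<open>1\<close> and \<open>x\<close> shows that \<open>f\<close> is itself a solution. The contact bracket on the
  solution space is that of \<open>D(2,1;a)\<close>.
\<close>

section \<open>Entire functions\<close>

text \<open>Two obstacles shape the argument. The ideal contains arbitrary jet functions, so
  membership is not by itself a statement about operators; and a point gives no values to odd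
  coordinates, so a general solution cannot be substituted into a jet function. Membership is
  therefore proved by normal forms: modulo the ideal a linear jet function is a combination of 17
  parametric derivatives, and 17 explicit solutions pair triangularly with these. Necessary
  conditions are drawn only from the solutions 1 and x, whose jets are honest points. Identities
  between prolonged fields are checked on operators and carried back, since a linear jet function is
  determined by its operator.

  The parameter \<open>a\<close> arises in the bracket of the \<xi>_i with the odd solutions that
  start with x \<xi>_j: its so_4-part is w plus \<epsilon> times the Hodge dual of w, so the
  self-dual part is scaled by 1 + \<epsilon> and the anti-self-dual part by 1 - \<epsilon>. Hence
  s_2 : s_3 = (1 + \<epsilon>) : (1 - \<epsilon>). Normalizing s_2 = 1 gives s_3 = a, and s_1 + s_2
  + s_3 = 0 gives s_1 = -2 / (1 + \<epsilon>).\<close>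

lemma entire_in_coinduct:
  assumes "g \<in> X" and "\<forall>p q. (\<forall>u\<in>V. p u = q u) \<longrightarrow> g p = g q"
    and "\<And>g. g \<in> X \<Longrightarrow> continuous_on UNIV g"
    and "\<And>g p u. g \<in> X \<Longrightarrow> (\<lambda>z. g (p(u := z))) field_differentiable at (p u)"
    and "\<And>g u. g \<in> X \<Longrightarrow> even_pd u g \<in> X"
  shows "entire_in V g"
proof -
  \<comment> \<open>\<open>X\<close> is closed under \<open>even_pd\<close>, so all iterated
    derivatives inherit the two regularity properties of its members; dependence on \<open>V\<close>
    is demanded of \<open>g\<close> alone.\<close>
  have "fold even_pd us g \<in> X" if "g \<in> X" for us g
    using that assms(5) by (induction us arbitrary: g) auto
  with assms show ?thesis unfolding entire_in_def by blast
qed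

lemma entire_in_cong: "entire_in V g \<Longrightarrow> (\<And>u. u \<in> V \<Longrightarrow> p u = q u) \<Longrightarrow> g p = g q"
  unfolding entire_in_def by blast

lemma entire_in_continuous: "entire_in V g \<Longrightarrow> continuous_on UNIV g"
  unfolding entire_in_def by (metis fold_simps(1))

lemma entire_in_differentiable:
  "entire_in V g \<Longrightarrow> (\<lambda>z. g (p(u := z))) field_differentiable at w"
proof -
  assume "entire_in V g"
  \<comment> \<open>The definition gives differentiability only at \<open>p u\<close>, so the base
    point is moved to \<open>p(u := w)\<close>.\<close>
  then have "(\<lambda>z. fold even_pd [] g ((p(u := w))(u := z))) field_differentiable at ((p(u := w)) u)"
    unfolding entire_in_def by blast
  then show ?thesis by simp
qed

lemma entire_in_has_derivative:
  "entire_in V g \<Longrightarrow> ((\<lambda>z. g (p(u := z))) has_field_derivative even_pd u g p) (at (p u))"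
  unfolding even_pd_def by (rule field_differentiable_derivI[OF entire_in_differentiable])

lemma even_pd_eqI:
  assumes "\<And>p. ((\<lambda>z. g (p(u := z))) has_field_derivative h p) (at (p u))"
  shows "even_pd u g = h"
  unfolding even_pd_def using assms by (auto intro: DERIV_imp_deriv)

lemma entire_in_even_pd: "entire_in V g \<Longrightarrow> entire_in V (even_pd u g)"
proof -
  assume g: "entire_in V g"
  have "even_pd u g p = even_pd u g q" if "\<forall>v\<in>V. p v = q v" for p q
  proof (cases "u \<in> V")
    case True
    then have "(\<lambda>z. g (p(u := z))) = (\<lambda>z. g (q(u := z)))"
      using that by (intro ext entire_in_cong[OF g]) auto
    then show ?thesis using True that by (simp add: even_pd_def)
  next
    case False
    have "even_pd u g p = 0" for p
    proof -
      have "(\<lambda>z. g (p(u := z))) = (\<lambda>z. g p)"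
        using False by (intro ext entire_in_cong[OF g]) auto
      then show ?thesis by (simp add: even_pd_def)
    qed
    then show ?thesis by simp
  qed
  moreover have "continuous_on UNIV (fold even_pd us (even_pd u g)) \<and>
    (\<forall>p v. (\<lambda>z. fold even_pd us (even_pd u g) (p(v := z))) field_differentiable at (p v))" for us
    using g unfolding entire_in_def by (metis fold_simps(2))
  ultimately show ?thesis unfolding entire_in_def by blast
qed

lemma even_pd_const [simp]: "even_pd u (\<lambda>p. c) = (\<lambda>p. 0)" "even_pd u 0 = 0"
  by (auto simp: even_pd_def fun_eq_iff zero_fun_def)

lemma entire_in_const: "entire_in V (\<lambda>p. c)"
  by (rule entire_in_coinduct[where X = "range (\<lambda>c p. c)"]) auto

lemma even_pd_coord: "even_pd u (\<lambda>p. p v) = (\<lambda>p. if u = v then 1 else 0)"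
  by (auto simp: even_pd_def fun_eq_iff)

lemma entire_in_coord:
  assumes "v \<in> V"
  shows "entire_in V (\<lambda>p. p v)"
proof (rule entire_in_coinduct[where X = "insert (\<lambda>p. p v) (range (\<lambda>c p. c))"])
  fix g :: "(coord \<Rightarrow> complex) \<Rightarrow> complex" and p u assume "g \<in> insert (\<lambda>p. p v) (range (\<lambda>c p. c))"
  then show "(\<lambda>z. g (p(u := z))) field_differentiable at (p u)"
    by (cases "u = v") auto
qed (use assms in \<open>auto simp: even_pd_coord intro: continuous_on_product_coordinates\<close>)

text \<open>Products of entire functions are not stable under differentiation, but finite sums of
  such products are: the derivative of one summand consists of two summands. This is the invariant
  class for \<open>entire_in_coinduct\<close>, from which closure under products and sums
  follows.\<close>

inductive_set product_sums :: "coord set \<Rightarrow> ((coord \<Rightarrow> complex) \<Rightarrow> complex) set" for V where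
  zero: "(\<lambda>p. 0) \<in> product_sums V"
| step: "\<lbrakk>entire_in V g; entire_in V h; k \<in> product_sums V\<rbrakk> \<Longrightarrow> (\<lambda>p. g p * h p + k p) \<in> product_sums V"

lemma entire_in_product_sums:
  assumes "g \<in> product_sums V"
  shows "entire_in V g"
proof (rule entire_in_coinduct[OF assms])
  show "\<forall>p q. (\<forall>u\<in>V. p u = q u) \<longrightarrow> g p = g q"
    using assms
  proof induction
    case (step g h k)
    then show ?case by (metis entire_in_cong)
  qed auto
  fix g :: "(coord \<Rightarrow> complex) \<Rightarrow> complex" and u
  assume g: "g \<in> product_sums V"
  then show "continuous_on UNIV g"
  proof induction
    case (step g h k)
    then show ?case
      using entire_in_continuous[of V] by (metis continuous_on_add continuous_on_mult)
  qed simp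
  show "(\<lambda>z. g (p(u := z))) field_differentiable at (p u)" for p u
    using g
  proof induction
    case (step g h k)
    then show ?case
      using entire_in_differentiable[of V] by (metis field_differentiable_add field_differentiable_mult)
  qed auto
  have "even_pd u g \<in> product_sums V \<and>
     (\<forall>p. ((\<lambda>z. g (p(u := z))) has_field_derivative even_pd u g p) (at (p u)))"
    using g
  proof induction
    case (step g h k)
    let ?d = "\<lambda>p. even_pd u g p * h p + (g p * even_pd u h p + even_pd u k p)"
    have D: "((\<lambda>z. g (p(u := z)) * h (p(u := z)) + k (p(u := z))) has_field_derivative ?d p) (at (p u))" for p
    proof -
      have "((\<lambda>z. k (p(u := z))) has_field_derivative even_pd u k p) (at (p u))" using step by blast
      from DERIV_add[OF DERIV_mult[OF entire_in_has_derivative[OF step(1), of p u] entire_in_has_derivative[OF step(2), of p u]] this]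
      show ?thesis by (simp add: algebra_simps)
    qed
    then have eq: "even_pd u (\<lambda>p. g p * h p + k p) = ?d" by (intro even_pd_eqI)
    have "?d \<in> product_sums V"
      using step by (intro product_sums.step entire_in_even_pd) auto
    then show ?case unfolding eq using D by blast
  qed (auto intro: product_sums.intros)
  then show "even_pd u g \<in> product_sums V" ..
qed

lemma entire_in_mult:
  assumes "entire_in V g" "entire_in V h"
  shows "entire_in V (\<lambda>p. g p * h p)"
  using entire_in_product_sums[OF product_sums.step[OF assms product_sums.zero]] by simp

lemma entire_in_add:
  assumes "entire_in V g" "entire_in V h"
  shows "entire_in V (\<lambda>p. g p + h p)"
  using entire_in_product_sums[OF product_sums.step[OF assms(1) entire_in_const[of _ 1]
        product_sums.step[OF assms(2) entire_in_const[of _ 1] product_sums.zero]]] by simp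

lemma entire_in_sum:
  "(\<And>i. i \<in> I \<Longrightarrow> entire_in V (g i)) \<Longrightarrow> entire_in V (\<lambda>p. \<Sum>i\<in>I. g i p)"
  by (induction I rule: infinite_finite_induct) (auto intro: entire_in_add entire_in_const)

lemma entire_in_mono:
  assumes "entire_in V g" "V \<subseteq> W"
  shows "entire_in W g"
  using assms unfolding entire_in_def by (metis subsetD)

lemma even_pd_add:
  assumes "entire_in V g" "entire_in V h"
  shows "even_pd u (\<lambda>p. g p + h p) = (\<lambda>p. even_pd u g p + even_pd u h p)"
  using assms by (intro even_pd_eqI) (auto intro!: derivative_eq_intros entire_in_has_derivative)

lemma even_pd_mult:
  assumes "entire_in V g" "entire_in V h"
  shows "even_pd u (\<lambda>p. g p * h p) = (\<lambda>p. even_pd u g p * h p + g p * even_pd u h p)"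
  using assms by (intro even_pd_eqI) (auto intro!: derivative_eq_intros entire_in_has_derivative)

lemma even_pd_cmult:
  assumes "entire_in V g"
  shows "even_pd u (\<lambda>p. c * g p) = (\<lambda>p. c * even_pd u g p)"
  using assms by (intro even_pd_eqI) (auto intro!: derivative_eq_intros entire_in_has_derivative)

lemma even_pd_sum:
  assumes "\<And>i. i \<in> I \<Longrightarrow> entire_in V (g i)"
  shows "even_pd u (\<lambda>p. \<Sum>i\<in>I. g i p) = (\<lambda>p. \<Sum>i\<in>I. even_pd u (g i) p)"
  using assms by (intro even_pd_eqI) (auto intro!: derivative_eq_intros entire_in_has_derivative)

section \<open>Signs and products of superfunctions\<close>

lemma UNIV_idx: "(UNIV :: idx set) = {I1, I2, I3, I4}"
  using idx.exhaust by auto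

instance idx :: finite
  by standard (simp add: UNIV_idx)

definition set_code :: "idx set \<Rightarrow> nat" where
  "set_code I = (\<Sum>i\<in>I. 2 ^ (num i - 1))"

lemma set_code_eq: "set_code I = of_bool (I1 \<in> I) + 2 * of_bool (I2 \<in> I) + 4 * of_bool (I3 \<in> I) + 8 * of_bool (I4 \<in> I)"
proof -
  have "set_code I = (\<Sum>i\<in>UNIV. if i \<in> I then 2 ^ (num i - 1) else 0)"
    unfolding set_code_def by (simp add: sum.If_cases)
  then show ?thesis by (simp add: UNIV_idx)
qed

lemma set_code_inject: "set_code I = set_code J \<Longrightarrow> I = J"
proof -
  assume "set_code I = set_code J"
  then have "(i \<in> I) = (i \<in> J)" for i
    by (cases i) (auto simp: set_code_eq of_bool_def split: if_splits)
  then show ?thesis by blast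
qed

text \<open>\<open>set_code\<close> is a binary code below 16, so \<open>16 * m + set_code I\<close>
  determines \<open>m\<close> and \<open>I\<close>; the offset 5 keeps the jet coordinates clear of
  the ranks 0 to 4 of the base coordinates.\<close>

lemma inj_rank: "inj rank"
proof (rule injI)
  fix u v assume eq: "rank u = rank v"
  have less: "set_code I < 16" for I
    by (simp add: set_code_eq of_bool_def)
  have Ch: "rank (Ch m I) = 5 + (16 * m + set_code I)" for m I
    by (simp add: set_code_def)
  have num: "num i < 5" "0 < num i" for i by (cases i; simp)+
  have num_inj: "num i = num j \<Longrightarrow> i = j" for i j by (cases i; cases j; simp)
  have code: "m = n \<and> I = J" if "rank (Ch m I) = rank (Ch n J)" for m n I J
  proof -
    have "16 * m + set_code I = 16 * n + set_code J" using that unfolding Ch by simp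
    then have "m = n" "set_code I = set_code J" using less[of I] less[of J] by arith+
    then show ?thesis using set_code_inject by blast
  qed
  have Ch_ge: "5 \<le> rank (Ch m I)" for m I by simp
  show "u = v"
  proof (cases u; cases v)
    fix i j assume "u = Cxi i" "v = Cxi j"
    then show ?thesis using eq num_inj by simp
  next
    fix m I n J assume "u = Ch m I" "v = Ch n J"
    then show ?thesis using eq code by blast
  next
    fix i m I assume "u = Cxi i" "v = Ch m I"
    then show ?thesis using eq num(1)[of i] Ch_ge[of m I] by simp
  next
    fix i m I assume "u = Ch m I" "v = Cxi i"
    then show ?thesis using eq num(1)[of i] Ch_ge[of m I] by simp
  next
    fix i assume "u = Cx" "v = Cxi i"
    then show ?thesis using eq num(2)[of i] by simp
  next
    fix i assume "u = Cxi i" "v = Cx"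
    then show ?thesis using eq num(2)[of i] by simp
  qed (use eq in auto)
qed

lemma rank_less_cases: "u \<noteq> v \<Longrightarrow> rank u < rank v \<or> rank v < rank u"
  using inj_rank by (metis injD linorder_neqE_nat)

lemma inversions_finite: "finite A \<Longrightarrow> finite B \<Longrightarrow> finite {(a, b). a \<in> A \<and> b \<in> B \<and> rank b < rank a}"
  by (rule finite_subset[of _ "A \<times> B"]) auto

lemma inversions_Un_left:
  assumes "finite A" "finite A'" "finite B" "A \<inter> A' = {}"
  shows "inversions (A \<union> A') B = inversions A B + inversions A' B"
proof -
  have "{(a, b). a \<in> A \<union> A' \<and> b \<in> B \<and> rank b < rank a} =
    {(a, b). a \<in> A \<and> b \<in> B \<and> rank b < rank a} \<union> {(a, b). a \<in> A' \<and> b \<in> B \<and> rank b < rank a}" by auto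
  then show ?thesis unfolding inversions_def
    using assms by (auto intro!: card_Un_disjoint inversions_finite)
qed

lemma inversions_Un_right:
  assumes "finite A" "finite B'" "finite B" "B \<inter> B' = {}"
  shows "inversions A (B \<union> B') = inversions A B + inversions A B'"
proof -
  have "{(a, b). a \<in> A \<and> b \<in> B \<union> B' \<and> rank b < rank a} =
    {(a, b). a \<in> A \<and> b \<in> B \<and> rank b < rank a} \<union> {(a, b). a \<in> A \<and> b \<in> B' \<and> rank b < rank a}" by auto
  then show ?thesis unfolding inversions_def
    using assms by (auto intro!: card_Un_disjoint inversions_finite)
qed

text \<open>Ranks of distinct coordinates differ, so each pair in \<open>A \<times> B\<close> is an
  inversion in exactly one of the two orders.\<close>

lemma inversions_swap:
  assumes "finite A" "finite B" "A \<inter> B = {}"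
  shows "inversions A B + inversions B A = card A * card B"
proof -
  let ?X = "{(a, b). a \<in> A \<and> b \<in> B \<and> rank b < rank a}"
  let ?Y = "{(b, a). b \<in> B \<and> a \<in> A \<and> rank a < rank b}"
  have mem: "(a, b) \<in> ?X \<union> prod.swap ` ?Y" if "a \<in> A" "b \<in> B" for a b
  proof -
    have "rank a < rank b \<or> rank b < rank a" using that assms(3) rank_less_cases[of a b] by blast
    then show ?thesis using that by force
  qed
  have "A \<times> B \<subseteq> ?X \<union> prod.swap ` ?Y"
  proof (rule subsetI)
    fix x assume "x \<in> A \<times> B"
    then show "x \<in> ?X \<union> prod.swap ` ?Y" using mem[of "fst x" "snd x"] by (cases x) simp
  qed
  then have "A \<times> B = ?X \<union> prod.swap ` ?Y" by auto
  moreover have "?X \<inter> prod.swap ` ?Y = {}" by auto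
  ultimately have "card (A \<times> B) = card ?X + card (prod.swap ` ?Y)"
    using assms by (simp add: card_Un_disjoint inversions_finite)
  also have "card (prod.swap ` ?Y) = card ?Y" by (rule card_image) auto
  finally show ?thesis unfolding inversions_def by (simp add: card_cartesian_product)
qed

lemma inversions_empty [simp]: "inversions {} B = 0" "inversions A {} = 0"
  unfolding inversions_def by auto

lemma inversions_singleton_left: "inversions {u} B = card {b \<in> B. rank b < rank u}"
proof -
  have "{(a, b). a \<in> {u} \<and> b \<in> B \<and> rank b < rank u} = Pair u ` {b \<in> B. rank b < rank u}" by auto
  moreover have "{(a, b). a \<in> {u} \<and> b \<in> B \<and> rank b < rank a} = {(a, b). a \<in> {u} \<and> b \<in> B \<and> rank b < rank u}" by auto
  ultimately show ?thesis unfolding inversions_def by (simp add: card_image inj_on_def)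
qed

text \<open>The sum over the infinite set \<open>Pow S\<close> is 0 by convention. For this reason
  \<open>const 1\<close> is a unit only for superfunctions supported on finite sets.\<close>

lemma sprod_infinite: "infinite S \<Longrightarrow> (F \<odot> G) S = 0"
  unfolding sprod_def by (auto simp: fun_eq_iff)

lemma sprod_add_left: "(F + F') \<odot> G = F \<odot> G + F' \<odot> G"
  unfolding sprod_def by (auto simp: fun_eq_iff sum.distrib algebra_simps)

lemma sprod_add_right: "F \<odot> (G + G') = F \<odot> G + F \<odot> G'"
  unfolding sprod_def by (auto simp: fun_eq_iff sum.distrib algebra_simps)

lemma sprod_const_left: "const c \<odot> F = (\<lambda>S p. if finite S then c * F S p else 0)"
proof (intro ext)
  fix S :: "coord set" and p :: "coord \<Rightarrow> complex"
  have "(const c \<odot> F) S p = (\<Sum>A\<in>{{}}. (- 1) ^ inversions A (S - A) * const c A p * F (S - A) p)" if "finite S"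
    unfolding sprod_def using that by (intro sum.mono_neutral_right) (auto simp: const_def)
  then show "(const c \<odot> F) S p = (if finite S then c * F S p else 0)"
    by (auto simp: sprod_infinite const_def)
qed

lemma sprod_const_right: "F \<odot> const c = (\<lambda>S p. if finite S then c * F S p else 0)"
proof (intro ext)
  fix S :: "coord set" and p :: "coord \<Rightarrow> complex"
  have "(F \<odot> const c) S p = (\<Sum>A\<in>{S}. (- 1) ^ inversions A (S - A) * F A p * const c (S - A) p)" if "finite S"
    unfolding sprod_def using that by (intro sum.mono_neutral_right) (auto simp: const_def)
  then show "(F \<odot> const c) S p = (if finite S then c * F S p else 0)"
    by (auto simp: sprod_infinite const_def)
qed

text \<open>Both sides are sums over the ordered partitions of \<open>S\<close> into three blocks.
  The signs agree because \<open>inversions\<close> is additive over disjoint unions in each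
  argument.\<close>

lemma sprod_assoc: "(F \<odot> G) \<odot> H = F \<odot> (G \<odot> H)"
proof (intro ext)
  fix S :: "coord set" and p :: "coord \<Rightarrow> complex"
  show "((F \<odot> G) \<odot> H) S p = (F \<odot> (G \<odot> H)) S p"
  proof (cases "finite S")
    case fin: True
    let ?e = "\<lambda>A B. (- 1 :: complex) ^ inversions A B"
    have "((F \<odot> G) \<odot> H) S p =
      (\<Sum>B\<in>Pow S. \<Sum>A\<in>Pow B. ?e B (S - B) * (?e A (B - A) * F A p * G (B - A) p) * H (S - B) p)"
      unfolding sprod_def by (simp add: sum_distrib_left sum_distrib_right)
    also have "\<dots> = (\<Sum>(B, A)\<in>(SIGMA B:Pow S. Pow B). ?e B (S - B) * (?e A (B - A) * F A p * G (B - A) p) * H (S - B) p)"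
      using fin by (intro sum.Sigma) (auto intro: finite_subset)
    also have "\<dots> = (\<Sum>(A, C)\<in>(SIGMA A:Pow S. Pow (S - A)).
        ?e A (S - A) * F A p * (?e C (S - A - C) * G C p * H (S - A - C) p))"
    proof (rule sum.reindex_bij_witness[of _ "\<lambda>(A, C). (A \<union> C, A)" "\<lambda>(B, A). (A, B - A)"], goal_cases)
      case (5 BA)
      then obtain A B where BA: "BA = (B, A)" "A \<subseteq> B" "B \<subseteq> S" by auto
      have f: "finite A" "finite (B - A)" "finite (S - B)" using BA fin by (auto intro: finite_subset)
      have "inversions B (S - B) = inversions A (S - B) + inversions (B - A) (S - B)"
        using inversions_Un_left[of A "B - A" "S - B"] f BA by (simp add: Un_absorb1)
      moreover have "inversions A (S - A) = inversions A (B - A) + inversions A (S - B)"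
      proof -
        have "(B - A) \<union> (S - B) = S - A" using BA by auto
        then show ?thesis using inversions_Un_right[of A "S - B" "B - A"] f by force
      qed
      moreover have "S - A - (B - A) = S - B" using BA by auto
      ultimately show ?case using BA by (simp add: power_add)
    qed auto
    also have "\<dots> = (\<Sum>A\<in>Pow S. \<Sum>C\<in>Pow (S - A). ?e A (S - A) * F A p * (?e C (S - A - C) * G C p * H (S - A - C) p))"
      using fin by (intro sum.Sigma[symmetric]) auto
    also have "\<dots> = (F \<odot> (G \<odot> H)) S p"
      unfolding sprod_def by (simp add: sum_distrib_left)
    finally show ?thesis .
  qed (simp add: sprod_infinite)
qed

lemma invol_sprod: "invol (F \<odot> G) = invol F \<odot> invol G"
proof (intro ext)
  fix S :: "coord set" and p :: "coord \<Rightarrow> complex"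
  have "(- 1 :: complex) ^ card S = (- 1) ^ card A * (- 1) ^ card (S - A)" if "finite S" "A \<in> Pow S" for A
    using that by (simp add: card_Diff_subset finite_subset card_mono flip: power_add)
  then show "invol (F \<odot> G) S p = (invol F \<odot> invol G) S p"
    by (cases "finite S") (auto simp: invol_def sprod_infinite sprod_def sum_distrib_left intro!: sum.cong)
qed

text \<open>Exchanging the blocks \<open>A\<close> and \<open>S - A\<close> costs the sign
  (-1)^(|A||S - A|), and |S - A| has the parity \<open>r\<close> wherever \<open>W\<close>
  contributes.\<close>

lemma sprod_commute:
  assumes W: "\<And>S. W S \<noteq> 0 \<Longrightarrow> odd (card S) = r"
  shows "W \<odot> F = (if r then invol F else F) \<odot> W"
proof (intro ext)
  fix S :: "coord set" and p :: "coord \<Rightarrow> complex"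
  show "(W \<odot> F) S p = ((if r then invol F else F) \<odot> W) S p"
  proof (cases "finite S")
    case fin: True
    have "(W \<odot> F) S p = (\<Sum>A\<in>Pow S. (- 1) ^ inversions (S - A) A * W (S - A) p * F A p)"
      unfolding sprod_def by (rule sum.reindex_bij_witness[of _ "\<lambda>A. S - A" "\<lambda>A. S - A"]) (auto simp: double_diff)
    also have "\<dots> = ((if r then invol F else F) \<odot> W) S p"
      unfolding sprod_def
    proof (rule sum.cong[OF refl])
      fix A assume "A \<in> Pow S"
      then have f: "finite A" "finite (S - A)" using fin finite_subset by auto
      have "(- 1 :: complex) ^ inversions (S - A) A * (- 1) ^ inversions A (S - A) = (- 1) ^ (card A * card (S - A))"
        using inversions_swap[OF f] by (metis Diff_disjoint add.commute power_add)
      then have "(- 1 :: complex) ^ inversions (S - A) A = (- 1) ^ inversions A (S - A) * (- 1) ^ (card A * card (S - A))"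
        by (metis (no_types, lifting) left_minus_one_mult_self mult.commute mult.left_commute)
      moreover have "W (S - A) p = 0 \<or> odd (card (S - A)) = r" using W[of "S - A"] by (cases "W (S - A) = 0") auto
      ultimately show "(- 1) ^ inversions (S - A) A * W (S - A) p * F A p =
          (- 1) ^ inversions A (S - A) * (if r then invol F else F) A p * W (S - A) p"
        by (cases "even (card A)") (auto simp: invol_def power_mult)
    qed
    finally show ?thesis .
  qed (simp add: sprod_infinite)
qed

text \<open>If \<open>u\<close> is not in \<open>S\<close>, the subsets of \<open>insert u S\<close>
  are split by whether \<open>u\<close> goes to the left or to the right factor. If \<open>u\<close>
  is in \<open>S\<close>, the left side is 0 and the terms on the right cancel in pairs when
  \<open>u\<close> is moved between the factors.\<close>

lemma pd_odd_sprod: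
  assumes u: "odd_coord u"
  shows "pd u (F \<odot> G) = pd u F \<odot> G + invol F \<odot> pd u G"
proof (intro ext)
  fix S :: "coord set" and p :: "coord \<Rightarrow> complex"
  let ?e = "\<lambda>A B. (- 1 :: complex) ^ inversions A B"
  let ?n = "\<lambda>S. (- 1 :: complex) ^ card {s \<in> S. rank s < rank u}"
  have n: "?n T = ?e {u} T" for T by (simp add: inversions_singleton_left)
  show "pd u (F \<odot> G) S p = (pd u F \<odot> G + invol F \<odot> pd u G) S p"
  proof (cases "finite S")
    case fin: True
    show ?thesis
    proof (cases "u \<in> S")
      case True
      have "(pd u F \<odot> G) S p + (invol F \<odot> pd u G) S p =
         (\<Sum>A\<in>Pow S. if u \<in> A then ?e A (S - A) * invol F A p * pd u G (S - A) p
                     else ?e A (S - A) * pd u F A p * G (S - A) p)"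
        unfolding sprod_def sum.distrib[symmetric] using True u by (intro sum.cong) (auto simp: pd_def)
      also have "\<dots> = 0"
      proof -
        let ?g = "\<lambda>A. if u \<in> A then ?e A (S - A) * invol F A p * pd u G (S - A) p
                     else ?e A (S - A) * pd u F A p * G (S - A) p"
        let ?X = "{A \<in> Pow S. u \<in> A}" and ?Y = "{A \<in> Pow S. u \<notin> A}"
        have "sum ?g (Pow S) = sum ?g ?X + sum ?g ?Y"
          using fin by (subst sum.union_disjoint[symmetric]) (auto intro: sum.cong)
        moreover have "sum ?g ?X = - sum ?g ?Y"
          unfolding sum_negf[symmetric]
        proof (rule sum.reindex_bij_witness[of _ "\<lambda>A. insert u A" "\<lambda>A. A - {u}"], goal_cases)
          case (5 A)
          then have A: "A = insert u (A - {u})" "A \<subseteq> S" "u \<in> A" by auto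
          define B where "B = A - {u}"
          have B: "A = insert u B" "u \<notin> B" "B \<subseteq> S" using A B_def by auto
          define C where "C = S - A"
          have C: "S - A = C" "S - B = insert u C" "u \<notin> C" using B True C_def by auto
          have f: "finite B" "finite C" using fin B C_def finite_subset by auto
          have i1: "inversions (insert u B) C = inversions {u} C + inversions B C"
            using inversions_Un_left[of "{u}" B C] f B by simp
          have i2: "inversions B (insert u C) = inversions B {u} + inversions B C"
            using inversions_Un_right[of B C "{u}"] f C by simp
          have i3: "inversions B {u} + inversions {u} B = card B"
            using inversions_swap[of B "{u}"] f B by simp
          have i4: "(- 1 :: complex) ^ inversions B {u} = (- 1) ^ inversions {u} B * (- 1) ^ card B"
            unfolding i3[symmetric] power_add by simp
          show ?case
            unfolding B_def[symmetric] C(1,2) unfolding B(1)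
            using u B(2) C(3) f by (simp add: i1 i2 i4 power_add pd_def invol_def n)
        qed (use True in auto)
        ultimately show ?thesis by simp
      qed
      finally show ?thesis using u True by (simp add: pd_def)
    next
      case False
      have fin': "finite (insert u S)" using fin by simp
      let ?X = "{A \<in> Pow (insert u S). u \<in> A}" and ?Y = "Pow S"
      let ?g = "\<lambda>A. ?n S * (?e A (insert u S - A) * F A p * G (insert u S - A) p)"
      have "pd u (F \<odot> G) S p = sum ?g (Pow (insert u S))"
        using u False by (simp add: pd_def sprod_def sum_distrib_left)
      also have "\<dots> = sum ?g ?X + sum ?g ?Y"
        using fin False by (subst sum.union_disjoint[symmetric]) (auto intro!: sum.cong)
      also have "sum ?g ?X = (pd u F \<odot> G) S p"
        unfolding sprod_def
      proof (rule sum.reindex_bij_witness[of _ "\<lambda>A. insert u A" "\<lambda>A. A - {u}"], goal_cases)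
        case (5 A)
        define B where "B = A - {u}"
        have B: "A = insert u B" "u \<notin> B" "B \<subseteq> S" using 5 B_def by auto
        define C where "C = S - B"
        have C: "insert u S - A = C" "S - B = C" "u \<notin> C" "S = B \<union> C" "B \<inter> C = {}" using B False C_def by auto
        have f: "finite B" "finite C" using fin C finite_subset by auto
        have i1: "inversions (insert u B) C = inversions {u} C + inversions B C"
          using inversions_Un_left[of "{u}" B C] f B by simp
        have i2: "inversions {u} S = inversions {u} B + inversions {u} C"
          using inversions_Un_right[of "{u}" C B] f C by simp
        show ?case
          unfolding B_def[symmetric] C(1,2) unfolding B(1)
          using u B(2) C(3) f by (simp add: i1 i2 power_add pd_def n)
      qed (use False in auto)
      also have "sum ?g ?Y = (invol F \<odot> pd u G) S p"
        unfolding sprod_def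
      proof (rule sum.cong[OF refl])
        fix B assume BS: "B \<in> Pow S"
        define C where "C = S - B"
        have C: "insert u S - B = insert u C" "S - B = C" "u \<notin> C" "u \<notin> B" "S = B \<union> C" "B \<inter> C = {}" using BS False C_def by auto
        have f: "finite B" "finite C" using fin C finite_subset by auto
        have i1: "inversions B (insert u C) = inversions B {u} + inversions B C"
          using inversions_Un_right[of B C "{u}"] f C by simp
        have i2: "inversions {u} S = inversions {u} B + inversions {u} C"
          using inversions_Un_right[of "{u}" C B] f C by simp
        have i3: "inversions B {u} + inversions {u} B = card B"
          using inversions_swap[of B "{u}"] f C by simp
        have i4: "(- 1 :: complex) ^ inversions B {u} = (- 1) ^ inversions {u} B * (- 1) ^ card B"
          unfolding i3[symmetric] power_add by simp
        show "?g B = ?e B (S - B) * invol F B p * pd u G (S - B) p"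
          unfolding C(1,2)
          using u C(3) f by (simp add: i1 i2 i4 power_add pd_def invol_def n)
      qed
      finally show ?thesis by simp
    qed
  next
    case False
    then show ?thesis using u by (simp add: pd_def sprod_infinite)
  qed
qed

section \<open>The ring of functions on the jet space\<close>

lemma jet_coords_mono: "k \<le> l \<Longrightarrow> jet_coords k \<subseteq> jet_coords l"
  unfolding jet_coords_def by fastforce

lemma finite_jet_coords: "finite (jet_coords k)"
proof -
  have "{Ch m I | m I. m + card I \<le> k} \<subseteq> (\<lambda>(m, I). Ch m I) ` ({..k} \<times> UNIV)"
    by auto
  then have "finite {Ch m I | m I. m + card I \<le> k}"
    by (rule finite_subset) simp
  then show ?thesis unfolding jet_coords_def base_coords_def by simp
qed

lemma coord_in_jet_coords: "\<exists>k. u \<in> jet_coords k"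
  by (cases u) (auto simp: jet_coords_def base_coords_def)

lemma superfuns_zero: "F \<in> superfuns V \<Longrightarrow> \<not> S \<subseteq> {u \<in> V. odd_coord u} \<Longrightarrow> F S = 0"
  unfolding superfuns_def by blast

lemma superfuns_entire: "F \<in> superfuns V \<Longrightarrow> entire_in {u \<in> V. \<not> odd_coord u} (F S)"
  unfolding superfuns_def by blast

lemma superfunsI:
  "(\<And>S p. \<not> S \<subseteq> {u \<in> V. odd_coord u} \<Longrightarrow> F S p = 0) \<Longrightarrow>
   (\<And>S. entire_in {u \<in> V. \<not> odd_coord u} (F S)) \<Longrightarrow> F \<in> superfuns V"
  unfolding superfuns_def by (auto simp: fun_eq_iff)

lemma superfuns_mono:
  assumes "V \<subseteq> W" "F \<in> superfuns V"
  shows "F \<in> superfuns W"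
proof (rule superfunsI)
  fix S p assume "\<not> S \<subseteq> {u \<in> W. odd_coord u}"
  then have "\<not> S \<subseteq> {u \<in> V. odd_coord u}" using assms by blast
  then show "F S p = 0" using superfuns_zero[OF assms(2)] by simp
next
  fix S show "entire_in {u \<in> W. \<not> odd_coord u} (F S)"
    using superfuns_entire[OF assms(2)] by (rule entire_in_mono) (use assms in auto)
qed

lemma superfuns_const: "const c \<in> superfuns V"
  by (rule superfunsI) (auto simp: const_def intro: entire_in_const)

lemma superfuns_add:
  assumes "F \<in> superfuns V" "G \<in> superfuns V"
  shows "F + G \<in> superfuns V"
proof (rule superfunsI)
  fix S p assume "\<not> S \<subseteq> {u \<in> V. odd_coord u}"
  then show "(F + G) S p = 0" using assms by (simp add: superfuns_zero)
next
  fix S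
  have "(F + G) S = (\<lambda>p. F S p + G S p)" by auto
  then show "entire_in {u \<in> V. \<not> odd_coord u} ((F + G) S)"
    using entire_in_add[OF assms[THEN superfuns_entire]] by simp
qed

lemma superfuns_sprod:
  assumes "F \<in> superfuns V" "G \<in> superfuns V"
  shows "F \<odot> G \<in> superfuns V"
proof (rule superfunsI)
  fix S p assume S: "\<not> S \<subseteq> {u \<in> V. odd_coord u}"
  have "F A p = 0 \<or> G (S - A) p = 0" if "A \<subseteq> S" for A
  proof -
    have "\<not> A \<subseteq> {u \<in> V. odd_coord u} \<or> \<not> S - A \<subseteq> {u \<in> V. odd_coord u}" using S that by blast
    then show ?thesis using superfuns_zero[OF assms(1)] superfuns_zero[OF assms(2)] by (metis zero_fun_apply)
  qed
  then show "(F \<odot> G) S p = 0" unfolding sprod_def by (intro sum.neutral) auto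
next
  fix S show "entire_in {u \<in> V. \<not> odd_coord u} ((F \<odot> G) S)"
    unfolding sprod_def
    by (intro entire_in_sum entire_in_mult entire_in_const superfuns_entire assms)
qed

lemma superfuns_invol:
  assumes "F \<in> superfuns V"
  shows "invol F \<in> superfuns V"
proof (rule superfunsI)
  fix S p assume "\<not> S \<subseteq> {u \<in> V. odd_coord u}"
  then show "invol F S p = 0" using assms by (simp add: superfuns_zero invol_def)
next
  fix S show "entire_in {u \<in> V. \<not> odd_coord u} (invol F S)"
    unfolding invol_def by (intro entire_in_mult entire_in_const superfuns_entire assms)
qed

lemma superfuns_pd:
  assumes "F \<in> superfuns V"
  shows "pd u F \<in> superfuns V"
proof (cases "odd_coord u")
  case True
  show ?thesis
  proof (rule superfunsI)
    fix S p assume "\<not> S \<subseteq> {u \<in> V. odd_coord u}"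
    then have "\<not> insert u S \<subseteq> {u \<in> V. odd_coord u}" by blast
    then show "pd u F S p = 0" using assms True by (simp add: superfuns_zero pd_def)
  next
    fix S show "entire_in {u \<in> V. \<not> odd_coord u} (pd u F S)"
      using True unfolding pd_def
      by (cases "u \<in> S") (auto intro!: entire_in_mult entire_in_const superfuns_entire[OF assms])
  qed
next
  case False
  show ?thesis
  proof (rule superfunsI)
    fix S p assume "\<not> S \<subseteq> {u \<in> V. odd_coord u}"
    then show "pd u F S p = 0" using assms False by (simp add: superfuns_zero pd_def)
  next
    fix S show "entire_in {u \<in> V. \<not> odd_coord u} (pd u F S)"
      using False unfolding pd_def by (auto intro!: entire_in_even_pd superfuns_entire[OF assms])
  qed
qed

lemma superfuns_crd:
  assumes "u \<in> V"
  shows "crd u \<in> superfuns V"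
proof (rule superfunsI)
  fix S p assume "\<not> S \<subseteq> {u \<in> V. odd_coord u}"
  then show "crd u S p = 0" using assms by (auto simp: crd_def)
next
  fix S show "entire_in {u \<in> V. \<not> odd_coord u} (crd u S)"
  proof (cases "odd_coord u")
    case True
    then show ?thesis unfolding crd_def by (auto intro: entire_in_const)
  next
    case False
    then have "entire_in {u \<in> V. \<not> odd_coord u} (\<lambda>p. p u)" using assms by (intro entire_in_coord) auto
    then show ?thesis using False unfolding crd_def by (cases "S = {}") (auto intro: entire_in_const)
  qed
qed

lemma functions_J_common:
  assumes "F \<in> functions_J" "G \<in> functions_J"
  obtains k where "F \<in> superfuns (jet_coords k)" "G \<in> superfuns (jet_coords k)"
proof -
  obtain k l where "F \<in> superfuns (jet_coords k)" "G \<in> superfuns (jet_coords l)"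
    using assms unfolding functions_J_def by blast
  then have "F \<in> superfuns (jet_coords (max k l))" "G \<in> superfuns (jet_coords (max k l))"
    using superfuns_mono jet_coords_mono by (meson max.cobounded1 max.cobounded2)+
  then show ?thesis by (rule that)
qed

lemma functions_JI: "F \<in> superfuns (jet_coords k) \<Longrightarrow> F \<in> functions_J"
  unfolding functions_J_def by blast

lemma functions_J_const: "const c \<in> functions_J"
  by (rule functions_JI[of _ 0]) (rule superfuns_const)

lemma const_0: "const 0 = 0"
  by (auto simp: const_def fun_eq_iff)

lemma functions_J_0: "0 \<in> functions_J"
  using functions_J_const[of 0] unfolding const_0 .

lemma functions_J_add: "F \<in> functions_J \<Longrightarrow> G \<in> functions_J \<Longrightarrow> F + G \<in> functions_J"
  by (metis functions_JI functions_J_common superfuns_add)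

lemma functions_J_sprod: "F \<in> functions_J \<Longrightarrow> G \<in> functions_J \<Longrightarrow> F \<odot> G \<in> functions_J"
  by (metis functions_JI functions_J_common superfuns_sprod)

lemma functions_J_invol: "F \<in> functions_J \<Longrightarrow> invol F \<in> functions_J"
  by (metis functions_JI functions_J_common superfuns_invol)

lemma functions_J_pd: "F \<in> functions_J \<Longrightarrow> pd u F \<in> functions_J"
  by (metis functions_JI functions_J_common superfuns_pd)

lemma functions_J_crd: "crd u \<in> functions_J"
  using coord_in_jet_coords superfuns_crd functions_JI by blast

lemma functions_M_subset_J: "F \<in> functions_M \<Longrightarrow> F \<in> functions_J"
  unfolding functions_M_def
  by (rule functions_JI[of _ 0], rule superfuns_mono[of base_coords]) (auto simp: jet_coords_def)

lemma functions_J_infinite: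
  assumes "F \<in> functions_J" "infinite S"
  shows "F S = 0"
proof -
  obtain k where "F \<in> superfuns (jet_coords k)" using assms(1) unfolding functions_J_def by blast
  moreover have "\<not> S \<subseteq> {u \<in> jet_coords k. odd_coord u}"
    using assms(2) finite_jet_coords[of k] by (metis (no_types, lifting) finite_subset mem_Collect_eq subsetD subsetI)
  ultimately show ?thesis by (rule superfuns_zero)
qed

lemma sprod_const_functions_J:
  assumes "F \<in> functions_J"
  shows "const c \<odot> F = (\<lambda>S p. c * F S p)" "F \<odot> const c = (\<lambda>S p. c * F S p)"
  using functions_J_infinite[OF assms] by (auto simp: sprod_const_left sprod_const_right fun_eq_iff)

lemma uminus_superfun: "F \<in> functions_J \<Longrightarrow> - F = const (-1) \<odot> F"
  by (simp add: sprod_const_functions_J fun_eq_iff)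

lemma functions_J_uminus: "F \<in> functions_J \<Longrightarrow> - F \<in> functions_J"
  by (simp add: uminus_superfun functions_J_sprod functions_J_const)

lemma functions_J_minus: "F \<in> functions_J \<Longrightarrow> G \<in> functions_J \<Longrightarrow> F - G \<in> functions_J"
  using functions_J_add[of F "- G"] functions_J_uminus by simp

section \<open>The ring of jet functions as a type\<close>

typedef jfun = functions_J morphisms rep abs_jfun
  using functions_J_0 by blast

setup_lifting type_definition_jfun

text \<open>Jet functions are supported on finite sets of odd coordinates, so here
  \<open>const 1\<close> is a genuine unit. As a type they admit generic ring rewriting with
  \<open>sprod\<close> as multiplication.\<close>

instantiation jfun :: ring_1
begin
lift_definition zero_jfun :: jfun is "0 :: superfun" by (rule functions_J_0)
lift_definition one_jfun :: jfun is "const 1" by (rule functions_J_const)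
lift_definition plus_jfun :: "jfun \<Rightarrow> jfun \<Rightarrow> jfun" is "(+) :: superfun \<Rightarrow> _" by (rule functions_J_add)
lift_definition minus_jfun :: "jfun \<Rightarrow> jfun \<Rightarrow> jfun" is "(-) :: superfun \<Rightarrow> _" by (rule functions_J_minus)
lift_definition uminus_jfun :: "jfun \<Rightarrow> jfun" is "uminus :: superfun \<Rightarrow> _" by (rule functions_J_uminus)
lift_definition times_jfun :: "jfun \<Rightarrow> jfun \<Rightarrow> jfun" is "(\<odot>)" by (rule functions_J_sprod)
instance
proof
  fix F G H :: jfun
  show "F + G + H = F + (G + H)" "F + G = G + F" "0 + F = F" "- F + F = 0" "F - G = F + - G"
    by (transfer; simp add: algebra_simps fun_eq_iff)+
  show "F * G * H = F * (G * H)" by transfer (rule sprod_assoc)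
  show "(F + G) * H = F * H + G * H" by transfer (rule sprod_add_left)
  show "F * (G + H) = F * G + F * H" by transfer (rule sprod_add_right)
  show "1 * F = F" "F * 1 = F" by (transfer; simp add: sprod_const_functions_J)+
  show "(0 :: jfun) \<noteq> 1"
    by transfer (metis const_def one_neq_zero zero_fun_apply)
qed
end

section \<open>Derivatives, scalars and parity signs in the ring\<close>

lift_definition pdj :: "coord \<Rightarrow> jfun \<Rightarrow> jfun" is pd by (rule functions_J_pd)
lift_definition crdj :: "coord \<Rightarrow> jfun" is crd by (rule functions_J_crd)
lift_definition cst :: "complex \<Rightarrow> jfun" is const by (rule functions_J_const)
lift_definition inv_j :: "jfun \<Rightarrow> jfun" is invol by (rule functions_J_invol)

lemma rep_functions_J: "rep F \<in> functions_J"
  using rep by blast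

lemma rep_sum: "rep (sum f A) = (\<Sum>i\<in>A. rep (f i))"
  by (induction A rule: infinite_finite_induct) (auto simp: zero_jfun.rep_eq plus_jfun.rep_eq)

lemma pd_add:
  assumes "F \<in> functions_J" "G \<in> functions_J"
  shows "pd u (F + G) = pd u F + pd u G"
proof (cases "odd_coord u")
  case False
  obtain k where "F \<in> superfuns (jet_coords k)" "G \<in> superfuns (jet_coords k)"
    using assms functions_J_common by blast
  then have "even_pd u (\<lambda>p. F S p + G S p) = (\<lambda>p. even_pd u (F S) p + even_pd u (G S) p)" for S
    by (rule even_pd_add[OF superfuns_entire superfuns_entire])
  then show ?thesis using False by (simp add: pd_def fun_eq_iff plus_fun_def)
qed (auto simp: pd_def fun_eq_iff algebra_simps)

lemma pd_sprod:
  assumes "F \<in> functions_J" "G \<in> functions_J"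
  shows "pd u (F \<odot> G) = pd u F \<odot> G + (if odd_coord u then invol F else F) \<odot> pd u G"
proof (cases "odd_coord u")
  case True
  then show ?thesis by (simp add: pd_odd_sprod)
next
  case False
  obtain k where k: "F \<in> superfuns (jet_coords k)" "G \<in> superfuns (jet_coords k)"
    using assms functions_J_common by blast
  let ?V = "{u \<in> jet_coords k. \<not> odd_coord u}"
  note e = superfuns_entire[OF k(1)] superfuns_entire[OF k(2)]
  show ?thesis
  proof (intro ext)
    fix S p
    let ?c = "\<lambda>A. (- 1 :: complex) ^ inversions A (S - A)"
    have "pd u (F \<odot> G) S = even_pd u (\<lambda>p. \<Sum>A\<in>Pow S. ?c A * (F A p * G (S - A) p))"
      using False by (simp add: pd_def sprod_def mult.assoc)
    also have "\<dots> = (\<lambda>p. \<Sum>A\<in>Pow S. even_pd u (\<lambda>p. ?c A * (F A p * G (S - A) p)) p)"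
      by (intro even_pd_sum[of _ ?V] entire_in_mult entire_in_const e)
    also have "\<dots> = (\<lambda>p. \<Sum>A\<in>Pow S. ?c A * (even_pd u (F A) p * G (S - A) p + F A p * even_pd u (G (S - A)) p))"
      by (simp add: even_pd_cmult[OF entire_in_mult[OF e]] even_pd_mult[OF e])
    finally show "pd u (F \<odot> G) S p = (pd u F \<odot> G + (if odd_coord u then invol F else F) \<odot> pd u G) S p"
      using False by (simp add: pd_def sprod_def sum.distrib[symmetric] algebra_simps)
  qed
qed

lemma pd_invol:
  assumes "F \<in> functions_J"
  shows "invol (pd u F) = (if odd_coord u then - pd u (invol F) else pd u (invol F))"
proof (cases "odd_coord u")
  case True
  have "F (insert u S) = 0" if "infinite S" for S
    using that functions_J_infinite[OF assms, of "insert u S"] by simp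
  then have "invol (pd u F) S p = (- pd u (invol F)) S p" for S p
    using True by (cases "finite S") (auto simp: pd_def invol_def)
  then show ?thesis using True by (auto simp: fun_eq_iff)
next
  case False
  obtain k where "F \<in> superfuns (jet_coords k)"
    using assms functions_J_common by blast
  then have "even_pd u (\<lambda>p. c * F S p) = (\<lambda>p. c * even_pd u (F S) p)" for S c
    by (rule even_pd_cmult[OF superfuns_entire])
  then show ?thesis using False by (auto simp: fun_eq_iff pd_def invol_def)
qed

text \<open>The sign rule for moving an object of parity \<open>q\<close> past \<open>F\<close>,
  where \<open>F\<close> may be inhomogeneous.\<close>

definition tw :: "bool \<Rightarrow> jfun \<Rightarrow> jfun" where
  "tw q F = (if q then inv_j F else F)"

definition sgn_j :: "bool \<Rightarrow> jfun" where
  "sgn_j q = (if q then - 1 else 1)"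

text \<open>Parity as an eigenvalue of the grading involution; 0 has both parities, which makes sums
  and products unproblematic.\<close>

definition homog :: "bool \<Rightarrow> jfun \<Rightarrow> bool" where
  "homog q F \<longleftrightarrow> inv_j F = sgn_j q * F"

lemma pdj_add [simp]: "pdj u (F + G) = pdj u F + pdj u G"
  by transfer (rule pd_add)

lemma pdj_0 [simp]: "pdj u 0 = 0"
  using pdj_add[of u 0 0] by simp

lemma pdj_minus [simp]: "pdj u (- F) = - pdj u F"
  using pdj_add[of u F "- F"] by (simp add: eq_neg_iff_add_eq_0 add.commute)

lemma pdj_diff [simp]: "pdj u (F - G) = pdj u F - pdj u G"
  using pdj_add[of u F "- G"] by simp

lemma pdj_sum: "pdj u (sum f A) = (\<Sum>i\<in>A. pdj u (f i))"
  by (induction A rule: infinite_finite_induct) auto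

lemma inv_j_inv_j [simp]: "inv_j (inv_j F) = F"
  by transfer (auto simp: invol_def fun_eq_iff simp flip: mult.assoc power_add)

lemma inv_j_add [simp]: "inv_j (F + G) = inv_j F + inv_j G"
  by transfer (auto simp: invol_def fun_eq_iff algebra_simps)

lemma inv_j_0 [simp]: "inv_j 0 = 0"
  by transfer (auto simp: invol_def fun_eq_iff)

lemma inv_j_minus [simp]: "inv_j (- F) = - inv_j F"
  by transfer (auto simp: invol_def fun_eq_iff)

lemma inv_j_diff [simp]: "inv_j (F - G) = inv_j F - inv_j G"
  by transfer (auto simp: invol_def fun_eq_iff algebra_simps)

lemma inv_j_mult [simp]: "inv_j (F * G) = inv_j F * inv_j G"
  by transfer (rule invol_sprod)

lemma inv_j_cst [simp]: "inv_j (cst c) = cst c"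
  by transfer (auto simp: invol_def const_def fun_eq_iff)

lemma cst_1 [simp]: "cst 1 = 1"
  by transfer simp

lemma inv_j_1 [simp]: "inv_j 1 = 1"
  using inv_j_cst[of 1] by simp

lemma cst_0 [simp]: "cst 0 = 0"
  by transfer (rule const_0)

lemma cst_add: "cst (c + d) = cst c + cst d"
  by transfer (auto simp: const_def fun_eq_iff)

lemma cst_mult: "cst (c * d) = cst c * cst d"
  by transfer (auto simp: sprod_const_functions_J functions_J_const, auto simp: const_def fun_eq_iff)

lemma cst_minus: "cst (- c) = - cst c"
  by transfer (auto simp: const_def fun_eq_iff)

lemma cst_commute: "F * cst c = cst c * F"
  by transfer (simp add: sprod_const_functions_J)

lemma cst_left_commute: "F * (cst c * G) = cst c * (F * G)"
  by (metis cst_commute mult.assoc)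

lemma inv_j_crdj [simp]: "inv_j (crdj u) = (if odd_coord u then - crdj u else crdj u)"
  by transfer (auto simp: invol_def crd_def fun_eq_iff)

lemma pdj_mult: "pdj u (F * G) = pdj u F * G + tw (odd_coord u) F * pdj u G"
  unfolding tw_def by transfer (simp add: pd_sprod)

lemma inv_j_pdj: "inv_j (pdj u F) = (if odd_coord u then - pdj u (inv_j F) else pdj u (inv_j F))"
  by transfer (simp add: pd_invol)

lemma pdj_cst [simp]: "pdj u (cst c) = 0"
  by transfer (auto simp: pd_def const_def fun_eq_iff even_pd_def)

lemma pdj_1 [simp]: "pdj u 1 = 0"
  using pdj_cst[of u 1] by simp

lemma pdj_cst_mult [simp]: "pdj u (cst c * F) = cst c * pdj u F"
  by (simp add: pdj_mult tw_def)

lemma pdj_crdj: "pdj u (crdj v) = (if u = v then 1 else 0)"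
proof transfer
  fix u v
  show "pd u (crd v) = (if u = v then const 1 else 0)"
  proof (cases "odd_coord u")
    case True
    have "card {s \<in> {}. rank s < rank u} = 0" by simp
    then show ?thesis using True
      by (auto simp: pd_def crd_def fun_eq_iff const_def even_pd_def)
  next
    case False
    then have "even_pd u (crd v S) = (if u = v then const 1 S else 0)" for S
      by (auto simp: crd_def even_pd_coord const_def fun_eq_iff)
    then show ?thesis using False by (auto simp: pd_def fun_eq_iff)
  qed
qed

lemma tw_simps [simp]:
  "tw False F = F" "tw q (F + G) = tw q F + tw q G" "tw q 0 = 0" "tw q (- F) = - tw q F"
  "tw q (F - G) = tw q F - tw q G" "tw q (F * G) = tw q F * tw q G" "tw q (cst c) = cst c"
  "tw q 1 = 1" "tw q (tw q F) = F"
  by (auto simp: tw_def)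

lemma homogD: "homog q F \<Longrightarrow> tw r F = sgn_j (q \<and> r) * F"
  by (auto simp: tw_def homog_def sgn_j_def)

lemma homog_rep:
  assumes "homog q F" "odd (card S) \<noteq> q"
  shows "rep F S = 0"
proof -
  have "invol (rep F) S = (if q then - rep F S else rep F S)"
    using assms unfolding homog_def sgn_j_def by (auto simp: uminus_jfun.rep_eq simp flip: inv_j.rep_eq)
  then have "(- 1) ^ card S * rep F S p = (if q then - rep F S p else rep F S p)" for p
    by (auto simp: invol_def fun_eq_iff split: if_splits)
  then have "rep F S p = 0" for p using assms(2) by (auto split: if_splits)
  then show ?thesis by auto
qed

lemma homog_left_commute:
  assumes "homog q W"
  shows "W * F = tw q F * W"
proof -
  have "rep W \<odot> rep F = (if q then invol (rep F) else rep F) \<odot> rep W"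
    using homog_rep[OF assms] by (intro sprod_commute) blast
  then show ?thesis
    by (auto simp: tw_def times_jfun.rep_eq inv_j.rep_eq simp flip: rep_inject split: if_splits)
qed

lemma homog_mult: "homog q F \<Longrightarrow> homog r G \<Longrightarrow> homog (q \<noteq> r) (F * G)"
  unfolding homog_def by (auto simp: sgn_j_def)

lemma homog_add: "homog q F \<Longrightarrow> homog q G \<Longrightarrow> homog q (F + G)"
  unfolding homog_def by (auto simp: sgn_j_def algebra_simps)

lemma homog_minus: "homog q F \<Longrightarrow> homog q (- F)"
  unfolding homog_def by (auto simp: sgn_j_def algebra_simps)

lemma homog_diff: "homog q F \<Longrightarrow> homog q G \<Longrightarrow> homog q (F - G)"
  unfolding homog_def by (auto simp: sgn_j_def algebra_simps)

lemma homog_0: "homog q 0"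
  by (simp add: homog_def)

lemma homog_sum: "(\<And>i. i \<in> A \<Longrightarrow> homog q (f i)) \<Longrightarrow> homog q (sum f A)"
  by (induction A rule: infinite_finite_induct) (auto intro: homog_add homog_0)

lemma homog_cst_mult: "homog q F \<Longrightarrow> homog q (cst c * F)"
  unfolding homog_def by (auto simp: sgn_j_def)

lemma homog_crdj: "homog (odd_coord u) (crdj u)"
  by (auto simp: homog_def sgn_j_def)

lemma homog_pdj: "homog q F \<Longrightarrow> homog (q \<noteq> odd_coord u) (pdj u F)"
  unfolding homog_def by (auto simp: inv_j_pdj sgn_j_def)

lemma pd_outside:
  assumes F: "F \<in> superfuns V" and u: "u \<notin> V"
  shows "pd u F = 0"
proof (cases "odd_coord u")
  case True
  have "F (insert u S) = 0" for S using u by (intro superfuns_zero[OF F]) auto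
  then show ?thesis using True by (auto simp: pd_def fun_eq_iff)
next
  case False
  have "even_pd u (F S) p = 0" for S p
  proof -
    have "(\<lambda>z. F S (p(u := z))) = (\<lambda>z. F S p)"
      using u by (intro ext entire_in_cong[OF superfuns_entire[OF F]]) auto
    then show ?thesis by (simp add: even_pd_def)
  qed
  then show ?thesis using False by (auto simp: pd_def fun_eq_iff)
qed

lemma pdj_outside: "rep F \<in> superfuns V \<Longrightarrow> u \<notin> V \<Longrightarrow> pdj u F = 0"
  by (simp add: pdj.rep_eq zero_jfun.rep_eq pd_outside flip: rep_inject)

text \<open>A jet function involves jets of bounded order, and there are finitely many of these.
  Hence the sum that defines the action of a vector field is a true finite sum.\<close>

lemma finite_pdj_support: "finite {u. pdj u F \<noteq> 0}"
proof -
  obtain k where k: "rep F \<in> superfuns (jet_coords k)"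
    using rep_functions_J functions_J_def by blast
  then have "{u. pdj u F \<noteq> 0} \<subseteq> jet_coords k" using pdj_outside by blast
  then show ?thesis using finite_jet_coords finite_subset by blast
qed

text \<open>Of two distinct odd coordinates exactly one has the smaller rank, so exactly one of the
  two orders of removal picks up an additional sign.\<close>

lemma pdj_odd_anticommute:
  assumes "odd_coord u" "odd_coord v"
  shows "pdj u (pdj v F) = - pdj v (pdj u F)"
  using assms
proof (transfer fixing: u v)
  fix F assume F: "F \<in> functions_J" and uv: "odd_coord u" "odd_coord v"
  let ?n = "\<lambda>u S. card {s \<in> S. rank s < rank u}"
  show "pd u (pd v F) = - pd v (pd u F)"
  proof (intro ext)
    fix S p
    consider "u = v \<or> u \<in> S \<or> v \<in> S" | "infinite S" | "finite S" "u \<noteq> v" "u \<notin> S" "v \<notin> S" by blast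
    then show "pd u (pd v F) S p = (- pd v (pd u F)) S p"
    proof cases
      case 2
      then have "F (insert u (insert v S)) = 0" "F (insert v (insert u S)) = 0"
        using functions_J_infinite[OF F] by auto
      then show ?thesis using uv by (simp add: pd_def)
    next
      case 3
      have n: "?n w (insert w' S) = ?n w S + of_bool (rank w' < rank w)" if "w' \<notin> S" for w w'
      proof -
        have "{s \<in> insert w' S. rank s < rank w} =
            (if rank w' < rank w then insert w' {s \<in> S. rank s < rank w} else {s \<in> S. rank s < rank w})"
          by auto
        then show ?thesis using that 3(1) by simp
      qed
      have "rank u < rank v \<and> \<not> rank v < rank u \<or> rank v < rank u \<and> \<not> rank u < rank v"
        using rank_less_cases[OF 3(2)] by auto
      then show ?thesis
        using uv 3 n[OF 3(3), of v] n[OF 3(4), of u] by (auto simp: pd_def insert_commute)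
    qed (use uv in \<open>auto simp: pd_def\<close>)
  qed
qed

lemma pdj_odd_square: "odd_coord u \<Longrightarrow> pdj u (pdj u F) = 0"
  by transfer (auto simp: pd_def fun_eq_iff)

lemma pdj_even_odd_commute:
  assumes "\<not> odd_coord u" "odd_coord v"
  shows "pdj u (pdj v F) = pdj v (pdj u F)"
  using assms
proof (transfer fixing: u v)
  fix F assume "F \<in> functions_J" and uv: "\<not> odd_coord u" "odd_coord v"
  then obtain k where k: "F \<in> superfuns (jet_coords k)" using functions_J_common by blast
  have "even_pd u (pd v F S) = pd v (pd u F) S" for S
    using uv by (cases "v \<in> S") (auto simp: pd_def even_pd_cmult[OF superfuns_entire[OF k]])
  then show "pd u (pd v F) = pd v (pd u F)" using uv by (subst (1) pd_def) auto
qed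

section \<open>Functions on the base\<close>

definition base_fun :: "jfun set" where
  "base_fun = {F. rep F \<in> functions_M}"

lemma base_fun_mult: "F \<in> base_fun \<Longrightarrow> G \<in> base_fun \<Longrightarrow> F * G \<in> base_fun"
  unfolding base_fun_def functions_M_def by (simp add: times_jfun.rep_eq superfuns_sprod)

lemma base_fun_add: "F \<in> base_fun \<Longrightarrow> G \<in> base_fun \<Longrightarrow> F + G \<in> base_fun"
  unfolding base_fun_def functions_M_def by (simp add: plus_jfun.rep_eq superfuns_add)

lemma base_fun_cst: "cst c \<in> base_fun"
  unfolding base_fun_def functions_M_def by (simp add: cst.rep_eq superfuns_const)

lemma base_fun_0: "0 \<in> base_fun" and base_fun_1: "1 \<in> base_fun"
  using base_fun_cst[of 0] base_fun_cst[of 1] by simp_all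

lemma base_fun_minus: "F \<in> base_fun \<Longrightarrow> - F \<in> base_fun"
  using base_fun_mult[OF base_fun_cst[of "- 1"], of F] by (simp add: cst_minus)

lemma base_fun_diff: "F \<in> base_fun \<Longrightarrow> G \<in> base_fun \<Longrightarrow> F - G \<in> base_fun"
  using base_fun_add[of F "- G"] base_fun_minus by simp

lemma base_fun_sum: "(\<And>i. i \<in> A \<Longrightarrow> f i \<in> base_fun) \<Longrightarrow> sum f A \<in> base_fun"
  by (induction A rule: infinite_finite_induct) (auto intro: base_fun_add base_fun_0)

lemma base_fun_pdj: "F \<in> base_fun \<Longrightarrow> pdj u F \<in> base_fun"
  unfolding base_fun_def functions_M_def by (simp add: pdj.rep_eq superfuns_pd)

lemma base_fun_inv_j: "F \<in> base_fun \<Longrightarrow> inv_j F \<in> base_fun"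
  unfolding base_fun_def functions_M_def by (simp add: inv_j.rep_eq superfuns_invol)

lemma base_fun_tw: "F \<in> base_fun \<Longrightarrow> tw q F \<in> base_fun"
  by (simp add: tw_def base_fun_inv_j)

lemma base_fun_sgn_j: "sgn_j q \<in> base_fun"
  by (simp add: sgn_j_def base_fun_1 base_fun_minus)

abbreviation "X \<equiv> crdj Cx"
abbreviation "xi i \<equiv> crdj (Cxi i)"
abbreviation "h m I \<equiv> crdj (Ch m I)"
abbreviation "dx \<equiv> pdj Cx"
abbreviation "dxi i \<equiv> pdj (Cxi i)"

lemma base_fun_X: "X \<in> base_fun" and base_fun_xi: "xi i \<in> base_fun"
  unfolding base_fun_def functions_M_def by (simp_all add: crdj.rep_eq superfuns_crd base_coords_def)

lemmas base_fun_intros = base_fun_mult base_fun_add base_fun_cst base_fun_0 base_fun_1 base_fun_minus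
  base_fun_diff base_fun_sum base_fun_pdj base_fun_inv_j base_fun_tw base_fun_X base_fun_xi base_fun_sgn_j

lemma dx_dxi: "dx (dxi i F) = dxi i (dx F)"
  by (rule pdj_even_odd_commute) auto

lemma dxi_dxi: "dxi i (dxi i F) = 0"
  by (rule pdj_odd_square) auto

lemma dxi_swap: "dxi i (dxi j F) = - dxi j (dxi i F)"
  by (rule pdj_odd_anticommute) auto

lemma sum_idx: "(\<Sum>i\<in>UNIV. f i) = f I1 + f I2 + f I3 + f I4"
  by (simp add: UNIV_idx add.assoc)

section \<open>Iterated partial derivatives on the base\<close>

definition sg :: "idx \<Rightarrow> idx set \<Rightarrow> complex" where
  "sg i I = (- 1) ^ card {j \<in> I. num j < num i}"

lemma card_num_less: "card {j \<in> I. num j < num i} = (\<Sum>j\<in>UNIV. of_bool (j \<in> I \<and> num j < num i))"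
  by (simp add: Collect_conj_eq)

lemma sg_eq:
  "sg I1 I = 1"
  "sg I2 I = (if I1 \<in> I then -1 else 1)"
  "sg I3 I = (if I1 \<in> I then -1 else 1) * (if I2 \<in> I then -1 else 1)"
  "sg I4 I = (if I1 \<in> I then -1 else 1) * (if I2 \<in> I then -1 else 1) * (if I3 \<in> I then -1 else 1)"
  unfolding sg_def card_num_less sum_idx by simp_all

definition dxis :: "idx set \<Rightarrow> jfun \<Rightarrow> jfun" where
  "dxis I F = foldr dxi (filter (\<lambda>i. i \<in> I) [I1, I2, I3, I4]) F"

lemma dxis_eq: "dxis I F =
  (let F4 = (if I4 \<in> I then dxi I4 F else F); F3 = (if I3 \<in> I then dxi I3 F4 else F4);
       F2 = (if I2 \<in> I then dxi I2 F3 else F3) in (if I1 \<in> I then dxi I1 F2 else F2))"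
  by (simp add: dxis_def)

lemma dxi_dxis: "dxi i (dxis I F) = (if i \<in> I then 0 else cst (sg i I) * dxis (insert i I) F)"
proof -
  note sw = dxi_swap[of I2 I1] dxi_swap[of I3 I1] dxi_swap[of I3 I2]
    dxi_swap[of I4 I1] dxi_swap[of I4 I2] dxi_swap[of I4 I3]
  show ?thesis
    by (cases i; cases "I1 \<in> I"; cases "I2 \<in> I"; cases "I3 \<in> I"; cases "I4 \<in> I")
       (simp_all add: dxis_eq Let_def sg_eq sw dxi_dxi cst_minus)
qed

text \<open>The value of the jet coordinate \<open>Ch m I\<close> on the jet of the section
  \<open>h = F\<close>.\<close>

definition dbase :: "nat \<Rightarrow> idx set \<Rightarrow> jfun \<Rightarrow> jfun" where
  "dbase m I F = (dx ^^ m) (dxis I F)"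

lemma dx_dbase: "dx (dbase m I F) = dbase (Suc m) I F"
  by (simp add: dbase_def)

lemma dxi_funpow_dx: "dxi i ((dx ^^ m) F) = (dx ^^ m) (dxi i F)"
  by (induction m) (simp_all flip: dx_dxi)

lemma funpow_dx_cst_mult: "(dx ^^ m) (cst c * F) = cst c * (dx ^^ m) F"
  by (induction m) simp_all

lemma funpow_dx_0 [simp]: "(dx ^^ m) 0 = 0"
  by (induction m) simp_all

lemma dxi_dbase: "dxi i (dbase m I F) = (if i \<in> I then 0 else cst (sg i I) * dbase m (insert i I) F)"
  by (simp add: dbase_def dxi_funpow_dx dxi_dxis funpow_dx_cst_mult)

lemma dxis_add: "dxis I (F + G) = dxis I F + dxis I G"
  by (simp add: dxis_eq)

lemma dbase_add: "dbase m I (F + G) = dbase m I F + dbase m I G"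
proof -
  have "(dx ^^ m) (F + G) = (dx ^^ m) F + (dx ^^ m) G" for F G by (induction m) simp_all
  then show ?thesis by (simp add: dbase_def dxis_add)
qed

lemma dbase_cst_mult: "dbase m I (cst c * F) = cst c * dbase m I F"
proof -
  have "dxis I (cst c * F) = cst c * dxis I F" by (simp add: dxis_eq)
  then show ?thesis by (simp add: dbase_def funpow_dx_cst_mult)
qed

lemma dbase_minus: "dbase m I (- F) = - dbase m I F"
  using dbase_cst_mult[of m I "- 1" F] by (simp add: cst_minus)

lemma dbase_0: "dbase m I 0 = 0"
  using dbase_cst_mult[of m I 0 0] by simp

lemma base_fun_dbase: "F \<in> base_fun \<Longrightarrow> dbase m I F \<in> base_fun"
proof -
  assume F: "F \<in> base_fun"
  then have "dxis I F \<in> base_fun" by (simp add: dxis_eq base_fun_pdj)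
  then show ?thesis unfolding dbase_def by (induction m) (auto intro: base_fun_pdj)
qed

lemma card_idx: "card I = of_bool (I1 \<in> I) + of_bool (I2 \<in> I) + of_bool (I3 \<in> I) + of_bool (I4 \<in> I)"
proof -
  have "card I = (\<Sum>i\<in>UNIV. of_bool (i \<in> I))" by simp
  then show ?thesis unfolding sum_idx .
qed

lemma inv_j_dbase: "inv_j (dbase m I F) = sgn_j (odd (card I)) * dbase m I (inv_j F)"
proof -
  have "inv_j (dxis I F) = sgn_j (odd (card I)) * dxis I (inv_j F)"
    by (cases "I1 \<in> I"; cases "I2 \<in> I"; cases "I3 \<in> I"; cases "I4 \<in> I")
       (simp_all add: dxis_eq card_idx sgn_j_def inv_j_pdj)
  moreover have "inv_j ((dx ^^ m) F) = (dx ^^ m) (inv_j F)" for F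
    by (induction m) (simp_all add: inv_j_pdj)
  moreover have "(dx ^^ m) (sgn_j q * F) = sgn_j q * (dx ^^ m) F" for q F
    using funpow_dx_cst_mult[of m "- 1" F] by (simp add: sgn_j_def cst_minus)
  ultimately show ?thesis by (simp add: dbase_def)
qed

lemma tw_dbase: "tw q (dbase m I (tw q F)) = sgn_j (q \<and> odd (card I)) * dbase m I F"
  by (simp add: tw_def inv_j_dbase sgn_j_def)

section \<open>Vector fields\<close>

definition vap :: "(coord \<Rightarrow> jfun) \<Rightarrow> jfun \<Rightarrow> jfun" where
  "vap V F = (\<Sum>u | pdj u F \<noteq> 0. V u * pdj u F)"

lemma rep_vap: "rep (vap V F) = vapply (\<lambda>u. rep (V u)) (rep F)"
proof -
  have "{u. pdj u F \<noteq> 0} = {u. pd u (rep F) \<noteq> 0}"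
    by (simp add: pdj.rep_eq zero_jfun.rep_eq flip: rep_inject)
  then show ?thesis
    unfolding vap_def vapply_def by (simp add: rep_sum times_jfun.rep_eq pdj.rep_eq)
qed

lemma vap_eq:
  assumes "finite U" "\<And>u. u \<notin> U \<Longrightarrow> pdj u F = 0"
  shows "vap V F = (\<Sum>u\<in>U. V u * pdj u F)"
  unfolding vap_def using assms by (intro sum.mono_neutral_left) auto

lemma vap_add: "vap V (F + G) = vap V F + vap V G"
proof -
  let ?U = "{u. pdj u F \<noteq> 0} \<union> {u. pdj u G \<noteq> 0}"
  have "finite ?U" by (simp add: finite_pdj_support)
  then have "vap V K = (\<Sum>u\<in>?U. V u * pdj u K)" if "K \<in> {F, G, F + G}" for K
    using that by (intro vap_eq) auto
  then show ?thesis by (simp add: distrib_left sum.distrib)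
qed

lemma vap_cst_mult: "vap V (cst c * F) = cst c * vap V F"
proof -
  let ?U = "{u. pdj u F \<noteq> 0}"
  have "vap V K = (\<Sum>u\<in>?U. V u * pdj u K)" if "K \<in> {F, cst c * F}" for K
    using that by (intro vap_eq finite_pdj_support) auto
  then show ?thesis by (simp add: sum_distrib_left cst_left_commute)
qed

lemma vap_0: "vap V 0 = 0"
  using vap_cst_mult[of V 0 0] by simp

lemma vap_add_field: "vap (\<lambda>u. V u + W u) F = vap V F + vap W F"
  unfolding vap_def by (simp add: distrib_right sum.distrib)

lemma vap_crdj: "vap V (crdj u) = V u"
proof -
  have "vap V (crdj u) = (\<Sum>v\<in>{u}. V v * pdj v (crdj u))"
    by (intro vap_eq) (auto simp: pdj_crdj)
  then show ?thesis by (simp add: pdj_crdj)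
qed

definition homog_field :: "bool \<Rightarrow> (coord \<Rightarrow> jfun) \<Rightarrow> bool" where
  "homog_field q V \<longleftrightarrow> (\<forall>u. homog (q \<noteq> odd_coord u) (V u))"

lemma vap_mult:
  assumes "homog_field q V"
  shows "vap V (F * G) = vap V F * G + tw q F * vap V G"
proof -
  let ?U = "{u. pdj u F \<noteq> 0} \<union> {u. pdj u G \<noteq> 0}"
  have "finite ?U" by (simp add: finite_pdj_support)
  then have e: "vap V K = (\<Sum>u\<in>?U. V u * pdj u K)" if "K \<in> {F, G, F * G}" for K
    using that by (intro vap_eq) (auto simp: pdj_mult)
  \<comment> \<open>\<open>V u\<close> has parity \<open>q\<close> plus that of \<open>u\<close>, so
    moving it past the already twisted \<open>F\<close> leaves just the twist by
    \<open>q\<close>.\<close>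
  have "V u * (tw (odd_coord u) F * K) = tw q F * (V u * K)" for u K
  proof -
    have "V u * tw (odd_coord u) F = tw q F * V u"
    proof -
      have "homog (q \<noteq> odd_coord u) (V u)" using assms unfolding homog_field_def by blast
      from homog_left_commute[OF this, of "tw (odd_coord u) F"] show ?thesis
        by (cases "odd_coord u"; cases q) simp_all
    qed
    then show ?thesis by (metis mult.assoc)
  qed
  then show ?thesis
    using e by (simp add: pdj_mult distrib_left sum.distrib sum_distrib_left sum_distrib_right mult.assoc)
qed

lemma vap_base_fun:
  assumes "F \<in> base_fun"
  shows "vap V F = V Cx * dx F + (\<Sum>i\<in>UNIV. V (Cxi i) * dxi i F)"
proof -
  have "vap V F = (\<Sum>u\<in>base_coords. V u * pdj u F)"
  proof (rule vap_eq)
    show "pdj u F = 0" if "u \<notin> base_coords" for u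
      using assms that unfolding base_fun_def functions_M_def by (auto intro: pdj_outside)
  qed (simp add: base_coords_def)
  also have "\<dots> = V Cx * dx F + (\<Sum>u\<in>range Cxi. V u * pdj u F)"
    unfolding base_coords_def by (subst sum.insert) auto
  also have "(\<Sum>u\<in>range Cxi. V u * pdj u F) = (\<Sum>i\<in>UNIV. V (Cxi i) * dxi i F)"
    by (subst sum.reindex) (auto simp: inj_def)
  finally show ?thesis .
qed

section \<open>Total derivatives\<close>

fun tot_x :: "coord \<Rightarrow> jfun" where
  "tot_x Cx = 1"
| "tot_x (Cxi j) = 0"
| "tot_x (Ch m I) = h (Suc m) I"

fun tot_xi :: "idx \<Rightarrow> coord \<Rightarrow> jfun" where
  "tot_xi i Cx = 0"
| "tot_xi i (Cxi j) = (if j = i then 1 else 0)"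
| "tot_xi i (Ch m I) = (if i \<in> I then 0 else cst (sg i I) * h m (insert i I))"

lemma rep_tot_x: "rep (tot_x u) = total_x u"
  by (cases u) (auto simp: one_jfun.rep_eq zero_jfun.rep_eq crdj.rep_eq)

lemma rep_tot_xi: "rep (tot_xi i u) = total_xi i u"
  by (cases u) (auto simp: one_jfun.rep_eq zero_jfun.rep_eq crdj.rep_eq times_jfun.rep_eq cst.rep_eq sg_def)

lemma homog_tot_x: "homog_field False tot_x"
  unfolding homog_field_def
proof
  show "homog (False \<noteq> odd_coord u) (tot_x u)" for u
    by (cases u) (auto simp: homog_def sgn_j_def)
qed

lemma homog_tot_xi: "homog_field True (tot_xi i)"
  unfolding homog_field_def
proof
  show "homog (True \<noteq> odd_coord u) (tot_xi i u)" for u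
    by (cases u) (auto simp: homog_def sgn_j_def)
qed

definition "Dxj = vap tot_x"
definition "Dxij i = vap (tot_xi i)"
definition "Dxisj I F = foldr Dxij (filter (\<lambda>i. i \<in> I) [I1, I2, I3, I4]) F"

lemma rep_Dxj: "rep (Dxj F) = Dx (rep F)"
  unfolding Dxj_def Dx_def rep_vap rep_tot_x ..

lemma rep_Dxij: "rep (Dxij i F) = Dxi i (rep F)"
  unfolding Dxij_def Dxi_def rep_vap rep_tot_xi ..

lemma rep_Dxisj: "rep (Dxisj I F) = Dxis I (rep F)"
proof -
  have "rep (foldr Dxij is F) = foldr Dxi is (rep F)" for "is"
    by (induction "is") (auto simp: rep_Dxij)
  then show ?thesis unfolding Dxisj_def Dxis_def .
qed

lemma rep_Dxj_pow: "rep ((Dxj ^^ m) F) = (Dx ^^ m) (rep F)"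
  by (induction m) (auto simp: rep_Dxj)

lemma Dxj_base_fun: "F \<in> base_fun \<Longrightarrow> Dxj F = dx F"
  by (simp add: Dxj_def vap_base_fun)

lemma Dxij_base_fun: "F \<in> base_fun \<Longrightarrow> Dxij i F = dxi i F"
  by (cases i) (simp_all add: Dxij_def vap_base_fun sum_idx)

section \<open>Functions that are linear in the jet coordinates\<close>

text \<open>A function \<open>F = \<Sum>u. c\<^sub>u h\<^sub>u\<close> with coefficients on the base is the same thing as the linear
  differential operator \<open>L = \<Sum>u. c\<^sub>u \<partial>\<^sub>u\<close>. Total derivatives of \<open>F\<close> correspond to compositions of \<open>L\<close>
  with partial derivatives.\<close>

inductive lin :: "jfun \<Rightarrow> (jfun \<Rightarrow> jfun) \<Rightarrow> bool" where
  zero: "lin 0 (\<lambda>s. 0)"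
| step: "c \<in> base_fun \<Longrightarrow> lin F L \<Longrightarrow> lin (c * h m I + F) (\<lambda>s. c * dbase m I s + L s)"

lemma lin_add: "lin F L \<Longrightarrow> lin G K \<Longrightarrow> lin (F + G) (\<lambda>s. L s + K s)"
  by (induction rule: lin.induct) (auto simp: add.assoc intro: lin.step)

lemma lin_mult:
  assumes c: "c \<in> base_fun"
  shows "lin F L \<Longrightarrow> lin (c * F) (\<lambda>s. c * L s)"
proof (induction rule: lin.induct)
  case zero
  then show ?case using lin.zero by simp
next
  case (step d F L m I)
  from lin.step[OF base_fun_mult[OF c step(1)] step(3), of m I] show ?case
    by (simp add: distrib_left mult.assoc)
qed

lemma lin_minus: "lin F L \<Longrightarrow> lin (- F) (\<lambda>s. - L s)"
  using lin_mult[OF base_fun_minus[OF base_fun_1]] by simp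

lemma lin_diff: "lin F L \<Longrightarrow> lin G K \<Longrightarrow> lin (F - G) (\<lambda>s. L s - K s)"
  using lin_add[OF _ lin_minus] by simp

lemma lin_h: "lin (h m I) (dbase m I)"
  using lin.step[OF base_fun_1 lin.zero, of m I] by simp

lemma lin_sum: "(\<And>i. i \<in> A \<Longrightarrow> lin (F i) (L i)) \<Longrightarrow> lin (sum F A) (\<lambda>s. \<Sum>i\<in>A. L i s)"
  by (induction A rule: infinite_finite_induct) (auto intro: lin.zero lin_add)

lemma lin_linear:
  "lin F L \<Longrightarrow> L (s + t) = L s + L t \<and> L (cst c * s) = cst c * L s \<and> L 0 = 0"
  by (induction rule: lin.induct)
     (auto simp: dbase_add dbase_cst_mult dbase_0 algebra_simps cst_left_commute)

lemma lin_base_fun: "lin F L \<Longrightarrow> s \<in> base_fun \<Longrightarrow> L s \<in> base_fun"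
  by (induction rule: lin.induct) (auto intro: base_fun_intros base_fun_dbase)

lemma lin_Dxj: "lin F L \<Longrightarrow> lin (Dxj F) (\<lambda>s. dx (L s))"
proof (induction rule: lin.induct)
  case zero
  then show ?case using lin.zero by (simp add: Dxj_def vap_0)
next
  case (step c F L m I)
  have "Dxj (c * h m I + F) = dx c * h m I + (c * h (Suc m) I + Dxj F)"
    using Dxj_base_fun[OF step(1)] unfolding Dxj_def
    by (simp add: vap_add vap_mult[OF homog_tot_x] vap_crdj)
  moreover have "dx (c * dbase m I s + L s) = dx c * dbase m I s + (c * dbase (Suc m) I s + dx (L s))" for s
    by (simp add: pdj_mult dx_dbase)
  moreover have "lin (dx c * h m I + (c * h (Suc m) I + Dxj F))
      (\<lambda>s. dx c * dbase m I s + (c * dbase (Suc m) I s + dx (L s)))"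
    using step by (intro lin.step base_fun_pdj)
  ultimately show ?case by (simp only:)
qed

lemma lin_Dxij: "lin F L \<Longrightarrow> lin (Dxij i F) (\<lambda>s. dxi i (L s))"
proof (induction rule: lin.induct)
  case zero
  then show ?case using lin.zero by (simp add: Dxij_def vap_0)
next
  case (step c F L m I)
  define e where "e = inv_j c * (if i \<in> I then 0 else cst (sg i I))"
  have 1: "Dxij i (c * h m I + F) = dxi i c * h m I + (e * h m (insert i I) + Dxij i F)"
    using Dxij_base_fun[OF step(1)] unfolding Dxij_def e_def
    by (simp add: vap_add vap_mult[OF homog_tot_xi] vap_crdj tw_def mult.assoc)
  have 2: "dxi i (c * dbase m I s + L s) = dxi i c * dbase m I s + (e * dbase m (insert i I) s + dxi i (L s))" for s
    by (simp add: pdj_mult dxi_dbase tw_def e_def mult.assoc)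
  have "e \<in> base_fun" using step(1) unfolding e_def by (auto intro: base_fun_intros)
  then have "lin (dxi i c * h m I + (e * h m (insert i I) + Dxij i F))
      (\<lambda>s. dxi i c * dbase m I s + (e * dbase m (insert i I) s + dxi i (L s)))"
    using step by (intro lin.step base_fun_pdj)
  with 1 2 show ?case by (simp only:)
qed

lemma lin_total:
  assumes "lin F L"
  shows "lin ((Dxj ^^ m) (Dxisj I F)) (\<lambda>s. dbase m I (L s))"
proof -
  have "lin (foldr Dxij is F) (\<lambda>s. foldr dxi is (L s))" for "is"
    using assms by (induction "is") (auto intro: lin_Dxij)
  then have "lin (Dxisj I F) (\<lambda>s. dxis I (L s))" unfolding Dxisj_def dxis_def .
  then show ?thesis unfolding dbase_def by (induction m) (auto intro: lin_Dxj)
qed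

section \<open>Contact vector fields\<close>

definition Dc :: "idx \<Rightarrow> jfun \<Rightarrow> jfun" where
  "Dc i F = dxi i F + xi i * dx F"

text \<open>With \<open>coef_xi\<close>, the coefficients of X_f in the coordinate frame instead of
  the frame of the contact derivatives. Applying \<open>inv_j\<close> to \<open>f\<close> beforehand
  provides the sign (-1)^|f| for inhomogeneous \<open>f\<close>.\<close>

definition coef_x :: "jfun \<Rightarrow> jfun" where
  "coef_x f = f + cst (1/2) * (\<Sum>j\<in>UNIV. Dc j (inv_j f) * xi j)"

definition coef_xi :: "jfun \<Rightarrow> idx \<Rightarrow> jfun" where
  "coef_xi f i = cst (1/2) * Dc i (inv_j f)"

text \<open>\<open>XF f\<close> is \<open>X\<^sub>f\<close>, and \<open>YF f = X\<^sub>f - f\<^sub>x\<close> is also the contact bracket with \<open>f\<close>.\<close>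

definition XF :: "jfun \<Rightarrow> jfun \<Rightarrow> jfun" where
  "XF f s = f * dx s + cst (1/2) * (\<Sum>j\<in>UNIV. Dc j (inv_j f) * Dc j s)"

definition YF :: "jfun \<Rightarrow> jfun \<Rightarrow> jfun" where
  "YF f s = XF f s - dx f * s"

lemma XF_coefs: "XF f s = coef_x f * dx s + (\<Sum>i\<in>UNIV. coef_xi f i * dxi i s)"
  unfolding XF_def coef_x_def coef_xi_def Dc_def[of _ s]
  by (simp add: algebra_simps sum.distrib sum_distrib_left sum_distrib_right)

definition charact :: "jfun \<Rightarrow> jfun" where
  "charact f = dx f * h 0 {} - coef_x f * h 1 {} - (\<Sum>i\<in>UNIV. coef_xi f i * h 0 {i})"

fun contact_pr :: "jfun \<Rightarrow> coord \<Rightarrow> jfun" where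
  "contact_pr f Cx = coef_x f"
| "contact_pr f (Cxi i) = coef_xi f i"
| "contact_pr f (Ch m I) = (Dxj ^^ m) (Dxisj I ((inv_j ^^ card I) (charact f))) +
     coef_x f * h (Suc m) I + (\<Sum>i\<in>UNIV. coef_xi f i * tot_xi i (Ch m I))"

lemma Dc_add [simp]: "Dc i (F + G) = Dc i F + Dc i G"
  by (simp add: Dc_def algebra_simps)

lemma Dc_diff [simp]: "Dc i (F - G) = Dc i F - Dc i G"
  by (simp add: Dc_def algebra_simps)

lemma Dc_cst_mult [simp]: "Dc i (cst c * F) = cst c * Dc i F"
  by (simp add: Dc_def algebra_simps cst_left_commute)

lemma Dc_minus [simp]: "Dc i (- F) = - Dc i F"
  by (simp add: Dc_def)

lemma Dc_0 [simp]: "Dc i 0 = 0"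
  by (simp add: Dc_def)

lemma base_fun_Dc: "F \<in> base_fun \<Longrightarrow> Dc i F \<in> base_fun"
  unfolding Dc_def by (intro base_fun_intros)

lemma base_fun_coefs: "f \<in> base_fun \<Longrightarrow> coef_x f \<in> base_fun" "f \<in> base_fun \<Longrightarrow> coef_xi f i \<in> base_fun"
  unfolding coef_x_def coef_xi_def by (auto intro!: base_fun_intros base_fun_Dc)

lemma base_fun_XF: "f \<in> base_fun \<Longrightarrow> s \<in> base_fun \<Longrightarrow> XF f s \<in> base_fun"
  unfolding XF_def by (auto intro!: base_fun_intros base_fun_Dc)

lemma base_fun_YF: "f \<in> base_fun \<Longrightarrow> s \<in> base_fun \<Longrightarrow> YF f s \<in> base_fun"
  unfolding YF_def by (auto intro!: base_fun_intros base_fun_XF)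

lemma dxis_empty: "dxis {} F = F" and dxis_single: "dxis {i} F = dxi i F"
  by (simp_all add: dxis_eq) (cases i; simp)

text \<open>The characteristic of the lifted field is f_x h - X_f h, and this is the negative of X_f
  - f_x applied to h.\<close>

lemma lin_charact:
  assumes f: "f \<in> base_fun"
  shows "lin (charact f) (\<lambda>s. - YF f s)"
proof -
  have "lin (charact f) (\<lambda>s. dx f * dbase 0 {} s - coef_x f * dbase 1 {} s - (\<Sum>i\<in>UNIV. coef_xi f i * dbase 0 {i} s))"
    unfolding charact_def using f by (intro lin_diff lin_sum lin_mult lin_h base_fun_coefs base_fun_pdj)
  then show ?thesis
    by (simp add: YF_def XF_coefs dbase_def dxis_empty dxis_single algebra_simps)
qed

lemma homog_inv_j: "homog q f \<Longrightarrow> homog q (inv_j f)"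
  unfolding homog_def by (auto simp: sgn_j_def split: if_splits)

lemma homog_xi: "homog True (xi i)"
  by (simp add: homog_def sgn_j_def)

lemma homog_dx: "homog q f \<Longrightarrow> homog q (dx f)"
  using homog_pdj[of q f Cx] by simp

lemma homog_Dc: "homog q f \<Longrightarrow> homog (\<not> q) (Dc i f)"
  unfolding Dc_def using homog_pdj[of q f "Cxi i"] homog_mult[OF homog_xi homog_dx, of q f i]
  by (cases q) (auto intro: homog_add)

lemma homog_coef_x: "homog q f \<Longrightarrow> homog q (coef_x f)"
  unfolding coef_x_def using homog_mult[OF homog_Dc[OF homog_inv_j] homog_xi, of q f]
  by (cases q) (auto intro!: homog_add homog_cst_mult homog_sum)

lemma homog_coef_xi: "homog q f \<Longrightarrow> homog (\<not> q) (coef_xi f i)"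
  unfolding coef_xi_def by (intro homog_cst_mult homog_Dc homog_inv_j)

lemma homog_charact: "homog q f \<Longrightarrow> homog q (charact f)"
  unfolding charact_def
  using homog_mult[OF homog_dx homog_crdj[of "Ch 0 {}"], of q f]
    homog_mult[OF homog_coef_x homog_crdj[of "Ch 1 {}"], of q f]
    homog_mult[OF homog_coef_xi homog_crdj[of "Ch 0 {i}" for i], of q f]
  by (cases q) (auto intro!: homog_diff homog_sum)

lemma inv_j_pow_homog: "homog q F \<Longrightarrow> (inv_j ^^ n) F = sgn_j (q \<and> odd n) * F"
  by (induction n) (auto simp: homog_def sgn_j_def)

text \<open>A prolonged coefficient is a transport term, whose operator is X_f after the derivative
  \<open>dbase m I\<close>, plus the signed total derivative of the characteristic, whose operator
  is minus \<open>dbase m I\<close> after X_f - f_x. The sum is a supercommutator twisted by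
  f_x.\<close>

lemma lin_contact_pr:
  assumes f: "f \<in> base_fun" "homog q f"
  shows "lin (contact_pr f (Ch m I))
    (\<lambda>s. XF f (dbase m I s) - sgn_j (q \<and> odd (card I)) * dbase m I (YF f s))"
proof -
  let ?e = "sgn_j (q \<and> odd (card I))"
  have sg: "dbase m I (?e * F) = ?e * dbase m I F" for F
    by (simp add: sgn_j_def dbase_minus)
  have "lin (?e * charact f) (\<lambda>s. ?e * - YF f s)"
    by (intro lin_mult lin_charact f base_fun_sgn_j)
  from lin_total[OF this, of m I]
  have "lin ((Dxj ^^ m) (Dxisj I ((inv_j ^^ card I) (charact f)))) (\<lambda>s. - (?e * dbase m I (YF f s)))"
    unfolding inv_j_pow_homog[OF homog_charact[OF f(2)]] sg by (simp add: dbase_minus)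
  moreover have "lin (tot_xi i (Ch m I)) (\<lambda>s. dxi i (dbase m I s))" for i
    unfolding dxi_dbase using lin.zero by (auto intro: lin_mult lin_h base_fun_cst)
  ultimately have "lin (contact_pr f (Ch m I)) (\<lambda>s. - (?e * dbase m I (YF f s)) +
      coef_x f * dbase (Suc m) I s + (\<Sum>i\<in>UNIV. coef_xi f i * dxi i (dbase m I s)))"
    unfolding contact_pr.simps by (intro lin_add lin_sum lin_mult lin_h base_fun_coefs f)
  then show ?thesis by (simp add: XF_coefs dx_dbase algebra_simps)
qed

lemma homog_field_contact_pr:
  assumes "homog q f"
  shows "homog_field q (contact_pr f)"
  unfolding homog_field_def
proof
  fix u show "homog (q \<noteq> odd_coord u) (contact_pr f u)"
  proof (cases u)
    case Cx then show ?thesis using homog_coef_x[OF assms] by simp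
  next
    case (Cxi i) then show ?thesis using homog_coef_xi[OF assms] by simp
  next
    case (Ch m I)
    have D: "homog (r \<noteq> s) (vap V F)" if "homog_field r V" "homog s F" for r s V F
    proof -
      have "homog (r \<noteq> s) (V u * pdj u F)" for u
      proof -
        have "homog (r \<noteq> odd_coord u) (V u)" using that unfolding homog_field_def by blast
        from homog_mult[OF this homog_pdj[OF that(2), of u]] show ?thesis
          by (cases r; cases s; cases "odd_coord u") simp_all
      qed
      then show ?thesis unfolding vap_def by (intro homog_sum)
    qed
    have Dx: "homog r F \<Longrightarrow> homog r ((Dxj ^^ m) F)" for r F m
      using D[OF homog_tot_x] by (induction m) (auto simp: Dxj_def)
    have Dxi: "homog r F \<Longrightarrow> homog (r \<noteq> odd (length is)) (foldr Dxij is F)" for r F "is"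
    proof (induction "is")
      case (Cons a "is")
      from D[OF homog_tot_xi[of a] Cons(1)[OF Cons(2)]] show ?case
        by (cases r; cases "even (length is)") (simp_all add: Dxij_def)
    qed simp
    have len: "length (filter (\<lambda>i. i \<in> I) [I1, I2, I3, I4]) = card I"
      by (simp add: card_idx)
    have 1: "homog (q \<noteq> odd (card I)) ((Dxj ^^ m) (Dxisj I ((inv_j ^^ card I) (charact f))))"
    proof (intro Dx)
      have "homog q ((inv_j ^^ card I) (charact f))"
        using homog_charact[OF assms] homog_minus[OF homog_charact[OF assms]]
        by (auto simp: inv_j_pow_homog[OF homog_charact[OF assms]] sgn_j_def)
      from Dxi[OF this, of "filter (\<lambda>i. i \<in> I) [I1, I2, I3, I4]"]
      show "homog (q \<noteq> odd (card I)) (Dxisj I ((inv_j ^^ card I) (charact f)))"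
        unfolding Dxisj_def len .
    qed
    have 2: "homog (q \<noteq> odd (card I)) (coef_x f * h (Suc m) I)"
      using homog_mult[OF homog_coef_x[OF assms] homog_crdj[of "Ch (Suc m) I"]] by simp
    have 3: "homog (q \<noteq> odd (card I)) (coef_xi f i * tot_xi i (Ch m I))" for i
    proof -
      have "homog (True \<noteq> odd_coord (Ch m I)) (tot_xi i (Ch m I))"
        using homog_tot_xi[of i] unfolding homog_field_def by blast
      from homog_mult[OF homog_coef_xi[OF assms] this, of i] show ?thesis
        by (cases q; cases "odd (card I)") simp_all
    qed
    show ?thesis unfolding Ch contact_pr.simps odd_coord.simps
      by (intro homog_add homog_sum 1 2 3)
  qed
qed

lemma vap_contact_pr_base_fun: "c \<in> base_fun \<Longrightarrow> vap (contact_pr f) c = XF f c"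
  by (simp add: vap_base_fun XF_coefs)

text \<open>On the base \<open>XF f\<close> is the action of the prolonged field, so the product
  rule for homogeneous fields applies.\<close>

lemma XF_mult:
  assumes "homog q f" "c \<in> base_fun" "s \<in> base_fun"
  shows "XF f (c * s) = XF f c * s + tw q c * XF f s"
  using vap_mult[OF homog_field_contact_pr[OF assms(1)], of c s] assms
  by (simp add: vap_contact_pr_base_fun base_fun_mult)

text \<open>On linear functions a prolonged contact field acts by \<open>L \<mapsto> X\<^sub>f L - (-1)\<^bsup>|f||L|\<^esup> L (X\<^sub>f - f\<^sub>x)\<close>.\<close>

lemma lin_vap_contact_pr:
  assumes f: "f \<in> base_fun" "homog q f"
  shows "lin F L \<Longrightarrow> \<exists>K. lin (vap (contact_pr f) F) K \<and>
    (\<forall>s\<in>base_fun. K s = XF f (L s) - tw q (L (tw q (YF f s))))"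
proof (induction rule: lin.induct)
  case zero
  show ?case using lin.zero by (intro exI[of _ "\<lambda>s. 0"]) (simp add: vap_0 XF_def)
next
  case (step c F L m I)
  then obtain K where K: "lin (vap (contact_pr f) F) K"
    "\<And>s. s \<in> base_fun \<Longrightarrow> K s = XF f (L s) - tw q (L (tw q (YF f s)))" by blast
  let ?e = "sgn_j (q \<and> odd (card I))"
  let ?K = "\<lambda>s. XF f c * dbase m I s + (tw q c * (XF f (dbase m I s) - ?e * dbase m I (YF f s)) + K s)"
  have "vap (contact_pr f) (c * h m I + F) =
    XF f c * h m I + (tw q c * contact_pr f (Ch m I) + vap (contact_pr f) F)"
    using step(1) by (simp add: vap_add vap_mult[OF homog_field_contact_pr[OF f(2)]]
        vap_contact_pr_base_fun vap_crdj del: contact_pr.simps)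
  moreover have "lin (XF f c * h m I + (tw q c * contact_pr f (Ch m I) + vap (contact_pr f) F)) ?K"
    by (intro lin_add lin_mult lin_h lin_contact_pr f K(1) base_fun_XF base_fun_tw step(1))
  \<comment> \<open>Conjugation by \<open>tw q\<close> yields the sign (-1)^(|f||L|) for
    inhomogeneous \<open>L\<close> as well; on a single derivative it is the sign in
    \<open>tw_dbase\<close>.\<close>
  moreover have "?K s = XF f (c * dbase m I s + L s) - tw q (c * dbase m I (tw q (YF f s)) + L (tw q (YF f s)))"
    if s: "s \<in> base_fun" for s
  proof -
    have "XF f (F + G) = XF f F + XF f G" for F G
      by (simp add: XF_coefs algebra_simps sum.distrib)
    then show ?thesis
      using K(2)[OF s] XF_mult[OF f(2) step(1) base_fun_dbase[OF s]]
      by (simp add: tw_dbase algebra_simps)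
  qed
  ultimately show ?case by (intro exI[of _ ?K]) auto
qed

section \<open>The contact bracket\<close>

lemma homog_swap: "homog q a \<Longrightarrow> homog r b \<Longrightarrow> b * a = sgn_j (q \<and> r) * (a * b)"
  using homog_left_commute[of r b a] homogD[of q a r] by (simp add: mult.assoc)

lemma homog_left_swap:
  assumes "homog q a" "homog r b"
  shows "b * (a * z) = sgn_j (q \<and> r) * (a * (b * z))"
  by (simp add: homog_swap[OF assms] flip: mult.assoc)

lemma xi_swap: "xi i * xi j = - (xi j * xi i)"
  using homog_swap[OF homog_xi homog_xi, of j i] by (simp add: sgn_j_def)

text \<open>Halving in \<open>jfun\<close> is multiplication by the scalar \<open>cst (1/2)\<close>;
  this lemma and \<open>double_eq_0\<close> replace numeral arithmetic.\<close>

lemma half_double: "cst (1/2) * (a + a) = a"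
proof -
  have "cst (1/2) * (a + a) = (cst (1/2) + cst (1/2)) * a"
    by (simp only: distrib_left distrib_right)
  also have "cst (1/2) + cst (1/2) = 1" by (simp flip: cst_add)
  finally show ?thesis by simp
qed

lemma double_eq_0: "(a :: jfun) + a = 0 \<Longrightarrow> a = 0"
  using half_double[of a] by simp

lemma xi_xi: "xi i * xi i = 0"
  by (rule double_eq_0, rule iffD1[OF eq_neg_iff_add_eq_0 xi_swap])

lemma Dc_mult: "Dc i (F * G) = Dc i F * G + inv_j F * Dc i G"
proof -
  have "xi i * (F * z) = inv_j F * (xi i * z)" for z
    using homog_left_commute[OF homog_xi, of i F] by (simp add: tw_def flip: mult.assoc)
  then show ?thesis by (simp add: Dc_def pdj_mult tw_def algebra_simps)
qed

lemma Dc_dx: "Dc i (dx F) = dx (Dc i F)"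
  by (simp add: Dc_def pdj_mult pdj_crdj dx_dxi)

text \<open>The squares of the \<xi>-derivative and of \<open>xi i\<close> vanish, and the cross
  terms give the x-derivative: the contact distribution is not integrable.\<close>

lemma Dc_Dc: "Dc i (Dc i F) = dx F"
proof -
  have "xi i * (xi i * G) = 0" for G by (simp add: xi_xi flip: mult.assoc)
  then show ?thesis
    by (simp add: Dc_def pdj_mult pdj_crdj dx_dxi dxi_dxi tw_def algebra_simps)
qed

lemma Dc_swap:
  assumes "i \<noteq> j"
  shows "Dc i (Dc j F) = - Dc j (Dc i F)"
proof -
  have "xi i * (xi j * G) = - (xi j * (xi i * G))" for G
    using xi_swap[of i j] by (simp flip: mult.assoc)
  then show ?thesis
    using assms dxi_swap[of i j F] by (simp add: Dc_def pdj_mult pdj_crdj dx_dxi tw_def algebra_simps)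
qed

lemma homog_dx_Dc: "homog q f \<Longrightarrow> homog (\<not> q) (dx (Dc i f))"
  by (intro homog_dx homog_Dc)

lemma homog_Dc_Dc: "homog q f \<Longrightarrow> homog q (Dc i (Dc j f))"
  using homog_Dc[OF homog_Dc, of q f i j] by simp

text \<open>\<open>XX\<close> is \<open>2 X\<^sub>f\<close> for homogeneous \<open>f\<close>. Without the factors \<open>1/2\<close>, the rewriting in the ring \<open>jfun\<close>,
  which has no numerals to cancel, stays integral.\<close>

definition XX :: "bool \<Rightarrow> jfun \<Rightarrow> jfun \<Rightarrow> jfun" where
  "XX q f s = f * dx s + f * dx s + sgn_j q * (\<Sum>j\<in>UNIV. Dc j f * Dc j s)"

lemma XF_homog: "homog q f \<Longrightarrow> XF f s = cst (1/2) * XX q f s"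
proof -
  assume "homog q f"
  then have "Dc j (inv_j f) = sgn_j q * Dc j f" for j by (auto simp: homog_def sgn_j_def)
  moreover have "cst (1/2) * (f * dx s + f * dx s) = f * dx s"
    by (rule half_double)
  ultimately show ?thesis
    unfolding XF_def XX_def by (simp add: distrib_left sum_distrib_left mult.assoc)
qed

text \<open>For double sums whose summands agree only after symmetrization: the off-diagonal
  differences are antisymmetric and cancel, while the diagonal differences are balanced by the
  single sums.\<close>

lemma sum_symmetrized:
  fixes U V :: "idx \<Rightarrow> idx \<Rightarrow> jfun"
  assumes d: "\<And>i. A i + U i i = B i + V i i" and o: "\<And>i j. i \<noteq> j \<Longrightarrow> U i j + U j i = V i j + V j i"
  shows "(\<Sum>i\<in>UNIV. A i) + (\<Sum>i\<in>UNIV. \<Sum>j\<in>UNIV. U i j) = (\<Sum>i\<in>UNIV. B i) + (\<Sum>i\<in>UNIV. \<Sum>j\<in>UNIV. V i j)"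
proof -
  define W where "W i j = U i j - V i j" for i j
  have W: "W j i = - W i j" if "i \<noteq> j" for i j
  proof -
    have "W j i + W i j = (U i j + U j i) - (V i j + V j i)" unfolding W_def by (simp add: algebra_simps)
    then show ?thesis using o[OF that] by (simp add: eq_neg_iff_add_eq_0)
  qed
  have "W I2 I1 = - W I1 I2" "W I3 I1 = - W I1 I3" "W I4 I1 = - W I1 I4"
    "W I3 I2 = - W I2 I3" "W I4 I2 = - W I2 I4" "W I4 I3 = - W I3 I4"
    by (simp_all only: W[of I1 I2] W[of I1 I3] W[of I1 I4] W[of I2 I3] W[of I2 I4] W[of I3 I4] idx.distinct not_False_eq_True)
  then have 1: "(\<Sum>i\<in>UNIV. \<Sum>j\<in>UNIV. W i j) = (\<Sum>i\<in>UNIV. W i i)"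
    by (simp add: sum_idx)
  have "W i i = B i - A i" for i
  proof -
    have "W i i - (B i - A i) = (A i + U i i) - (B i + V i i)" unfolding W_def by (simp add: algebra_simps)
    then show ?thesis using d[of i] by simp
  qed
  then have 2: "(\<Sum>i\<in>UNIV. W i i) = (\<Sum>i\<in>UNIV. B i) - (\<Sum>i\<in>UNIV. A i)"
    by (simp add: sum_subtractf)
  have 3: "(\<Sum>i\<in>UNIV. \<Sum>j\<in>UNIV. W i j) = (\<Sum>i\<in>UNIV. \<Sum>j\<in>UNIV. U i j) - (\<Sum>i\<in>UNIV. \<Sum>j\<in>UNIV. V i j)"
    unfolding W_def by (simp add: sum_subtractf)
  have "a + u = b + v" if "u - v = b - a" for a b u v :: jfun
  proof -
    have "a + u - (b + v) = (u - v) - (b - a)" by (simp add: algebra_simps)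
    then show ?thesis unfolding that by simp
  qed
  from this[OF 3[symmetric, unfolded 1 2]] show ?thesis .
qed

lemma dx_sum: "dx (\<Sum>j\<in>UNIV. f j) = (\<Sum>j\<in>UNIV. dx (f j :: jfun))" by (rule pdj_sum)

lemma Dc_sum: "Dc i (\<Sum>j\<in>A. f j) = (\<Sum>j\<in>A. Dc i (f j))"
  by (induction A rule: infinite_finite_induct) auto

lemma XX_bracket:
  assumes f: "homog q f" and g: "homog r g"
  shows "XX q f (XX r g s) - sgn_j (q \<and> r) * XX r g (XX q f s) =
    XX (q \<noteq> r) (XX q f g - (dx f * g + dx f * g)) s"
proof -
  note F = f homog_dx[OF f] homog_Dc[OF f] homog_dx_Dc[OF f]
  note sw = homog_swap[OF f g] homog_swap[OF homog_dx[OF f] g] homog_swap[OF homog_Dc[OF f] g]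
    homog_swap[OF homog_dx_Dc[OF f] g] homog_swap[OF homog_Dc[OF f] homog_Dc[OF g]]
    homog_swap[OF f homog_Dc[OF g]] homog_swap[OF homog_Dc_Dc[OF f] homog_Dc[OF g]]
    homog_swap[OF homog_dx[OF f] homog_Dc[OF g]]
  note lsw = homog_left_swap[OF f g] homog_left_swap[OF homog_dx[OF f] g] homog_left_swap[OF homog_Dc[OF f] g]
    homog_left_swap[OF homog_dx_Dc[OF f] g] homog_left_swap[OF homog_Dc[OF f] homog_Dc[OF g]]
    homog_left_swap[OF f homog_Dc[OF g]] homog_left_swap[OF homog_Dc_Dc[OF f] homog_Dc[OF g]]
    homog_left_swap[OF homog_dx[OF f] homog_Dc[OF g]]
  have inv: "inv_j f = sgn_j q * f" "inv_j (dx f) = sgn_j q * dx f" "\<And>i. inv_j (Dc i f) = sgn_j (\<not> q) * Dc i f"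
    "inv_j g = sgn_j r * g" "inv_j (dx g) = sgn_j r * dx g" "\<And>i. inv_j (Dc i g) = sgn_j (\<not> r) * Dc i g"
    using F g homog_dx[OF g] homog_Dc[OF g] unfolding homog_def by blast+
  let ?d = "\<lambda>z :: jfun. z + z"
  let ?e = "sgn_j (q \<and> r)" and ?\<sigma> = "sgn_j q" and ?\<tau> = "sgn_j r"
  \<comment> \<open>The terms are grouped by the number of indices they carry: none, one or two. The
    last two groups mix, because D_i applied twice is the x-derivative and moves diagonal terms into
    the single sums.\<close>
  define U0 where "U0 = ?d (?d (f * dx (g * dx s) - ?e * (g * dx (f * dx s))))"
  define U1 where "U1 i = ?d (?\<tau> * (f * dx (Dc i g * Dc i s)) + ?\<sigma> * (Dc i f * Dc i (g * dx s)) -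
    ?e * (?\<sigma> * (g * dx (Dc i f * Dc i s)) + ?\<tau> * (Dc i g * Dc i (f * dx s))))" for i
  define U2 where "U2 i j = ?\<sigma> * (?\<tau> * (Dc i f * Dc i (Dc j g * Dc j s) - ?e * (Dc i g * Dc i (Dc j f * Dc j s))))" for i j
  define V0 where "V0 = ?d (?d ((f * dx g - dx f * g) * dx s))"
  define V1 where "V1 i = ?d (?\<sigma> * (Dc i f * Dc i g * dx s) + ?\<sigma> * (?\<tau> * (Dc i (f * dx g - dx f * g) * Dc i s)))" for i
  define V2 where "V2 i j = ?\<tau> * (Dc i (Dc j f * Dc j g) * Dc i s)" for i j
  have L: "XX q f (XX r g s) - ?e * XX r g (XX q f s) = U0 + ((\<Sum>i\<in>UNIV. U1 i) + (\<Sum>i\<in>UNIV. \<Sum>j\<in>UNIV. U2 i j))"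
    unfolding XX_def U0_def U1_def U2_def
    by (cases q; cases r) (simp_all add: sgn_j_def dx_sum Dc_sum sum.distrib sum_subtractf sum_negf sum_distrib_left algebra_simps)
  have R: "XX (q \<noteq> r) (XX q f g - (dx f * g + dx f * g)) s = V0 + ((\<Sum>i\<in>UNIV. V1 i) + (\<Sum>i\<in>UNIV. \<Sum>j\<in>UNIV. V2 i j))"
    unfolding XX_def V0_def V1_def V2_def
    by (cases q; cases r) (simp_all add: sgn_j_def dx_sum Dc_sum sum.distrib sum_subtractf sum_negf sum_distrib_left sum_distrib_right algebra_simps)
  have E0: "U0 = V0"
    unfolding U0_def V0_def
    by (cases q; cases r) (simp_all add: sw lsw pdj_mult tw_def sgn_j_def algebra_simps)
  have E1: "U1 i + U2 i i = V1 i + V2 i i" for i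
    unfolding U1_def V1_def U2_def V2_def
    by (cases q; cases r) (simp_all add: sw lsw pdj_mult Dc_mult tw_def inv Dc_dx Dc_Dc sgn_j_def algebra_simps)
  \<comment> \<open>For distinct indices the second-order terms cancel in the symmetrized sum, as
    D_i and D_j anticommute.\<close>
  have E2: "U2 i j + U2 j i = V2 i j + V2 j i" if "i \<noteq> j" for i j
  proof -
    note Dc_swap[OF that]
    then show ?thesis
      unfolding U1_def V1_def U2_def V2_def
      by (cases q; cases r) (simp_all add: sw lsw Dc_mult inv sgn_j_def algebra_simps)
  qed
  show ?thesis unfolding L R E0 using sum_symmetrized[of U1 U2 V1 V2, OF E1 E2] by simp
qed

lemma XX_cst: "XX q f (cst c * s) = cst c * XX q f s"
  unfolding XX_def by (simp add: sum_idx algebra_simps sgn_j_def cst_left_commute)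

lemma XF_add_left: "XF (f + g) s = XF f s + XF g s"
  unfolding XF_def by (simp add: sum_idx algebra_simps)

lemma XF_add_right: "XF f (s + t) = XF f s + XF f t"
  unfolding XF_def by (simp add: sum_idx algebra_simps)

lemma XF_cst_left: "XF (cst c * f) s = cst c * XF f s"
  unfolding XF_def by (simp add: sum_idx algebra_simps cst_left_commute[of "cst (1/2)" c])

lemma XF_cst_right: "XF f (cst c * s) = cst c * XF f s"
  unfolding XF_def by (simp add: sum_idx algebra_simps cst_left_commute[of "cst (1/2)" c]
      cst_left_commute[of f c] cst_left_commute[of "Dc j (inv_j f)" c for j])

lemma XF_minus_right: "XF f (- s) = - XF f s"
  using XF_cst_right[of f "- 1" s] by (simp add: cst_minus)

lemma XF_diff_right: "XF f (s - t) = XF f s - XF f t"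
  using XF_add_right[of f s "- t"] by (simp add: XF_minus_right)

lemma YF_add_left: "YF (f + g) s = YF f s + YF g s"
  unfolding YF_def by (simp add: XF_add_left algebra_simps)

lemma YF_add_right: "YF f (s + t) = YF f s + YF f t"
  unfolding YF_def by (simp add: XF_add_right algebra_simps)

lemma YF_homog:
  assumes "homog q f"
  shows "YF f g = cst (1/2) * (XX q f g - (dx f * g + dx f * g))"
  using half_double[of "dx f * g"] unfolding YF_def XF_homog[OF assms] right_diff_distrib by simp

lemma homog_XF:
  assumes "homog q f" "homog r s"
  shows "homog (q \<noteq> r) (XF f s)"
proof -
  have "homog (q \<noteq> r) (Dc j (inv_j f) * Dc j s)" for j
    using homog_mult[OF homog_Dc[OF homog_inv_j[OF assms(1)]] homog_Dc[OF assms(2)], of j j] by (cases q) auto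
  moreover have "homog (q \<noteq> r) (f * dx s)" by (intro homog_mult homog_dx assms)
  ultimately show ?thesis unfolding XF_def by (intro homog_add homog_cst_mult homog_sum)
qed

lemma homog_YF: "homog q f \<Longrightarrow> homog r s \<Longrightarrow> homog (q \<noteq> r) (YF f s)"
  unfolding YF_def by (intro homog_diff homog_XF homog_mult homog_dx)

lemma XF_bracket:
  assumes f: "homog q f" and g: "homog r g"
  shows "XF f (XF g s) - sgn_j (q \<and> r) * XF g (XF f s) = XF (YF f g) s"
proof -
  have "XF f (XF g s) - sgn_j (q \<and> r) * XF g (XF f s) =
      cst (1/2) * (cst (1/2) * (XX q f (XX r g s) - sgn_j (q \<and> r) * XX r g (XX q f s)))"
    unfolding XF_homog[OF f] XF_homog[OF g]
    by (cases q; cases r) (simp_all add: XX_cst sgn_j_def right_diff_distrib distrib_left)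
  also have "\<dots> = cst (1/2) * XF (XX q f g - (dx f * g + dx f * g)) s"
  proof -
    have "homog (q \<noteq> r) (XX q f g)"
    proof -
      have "XX q f g = XF f g + XF f g" unfolding XF_homog[OF f]
        by (metis distrib_left half_double)
      then show ?thesis using homog_XF[OF f g] homog_add by metis
    qed
    then have "homog (q \<noteq> r) (XX q f g - (dx f * g + dx f * g))"
      by (intro homog_diff homog_add homog_mult homog_dx f g)
    then show ?thesis unfolding XX_bracket[OF f g] by (simp add: XF_homog)
  qed
  finally show ?thesis unfolding YF_homog[OF f] XF_cst_left .
qed

text \<open>The assignment of f_x to \<open>f\<close> is a cocycle for the contact fields. This is
  why the operators X_f - f_x close under the bracket.\<close>

lemma dx_YF:
  assumes f: "homog q f" and g: "homog r g"
  shows "dx (YF f g) = XF f (dx g) - sgn_j (q \<and> r) * XF g (dx f)"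
proof -
  note sw = homog_swap[OF f g] homog_swap[OF homog_dx[OF homog_dx[OF f]] g] homog_swap[OF homog_dx_Dc[OF f] homog_Dc[OF g]]
  have "dx (XX q f g - (dx f * g + dx f * g)) = XX q f (dx g) - sgn_j (q \<and> r) * XX r g (dx f)"
    unfolding XX_def
    by (cases q; cases r) (simp_all add: sw pdj_mult pdj_sum tw_def sgn_j_def Dc_dx sum.distrib sum_negf algebra_simps)
  then show ?thesis
    unfolding YF_homog[OF f] XF_homog[OF f] XF_homog[OF g] pdj_cst_mult
    by (cases q; cases r) (simp_all add: sgn_j_def right_diff_distrib distrib_left)
qed

text \<open>The Jacobi identity of the contact bracket. The first-order parts combine by
  \<open>XF_bracket\<close>, the terms of order zero by the cocycle identity \<open>dx_YF\<close>,
  and the products of f_x and g_x cancel by their commutation sign.\<close>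

lemma YF_bracket:
  assumes f: "homog q f" "f \<in> base_fun" and g: "homog r g" "g \<in> base_fun" and s: "s \<in> base_fun"
  shows "YF f (YF g s) - sgn_j (q \<and> r) * YF g (YF f s) = YF (YF f g) s"
proof -
  note XFm = XF_mult[OF f(1) base_fun_pdj[OF g(2)] s, of Cx] XF_mult[OF g(1) base_fun_pdj[OF f(2)] s, of Cx]
  have tw: "tw q (dx g) = sgn_j (q \<and> r) * dx g" "tw r (dx f) = sgn_j (q \<and> r) * dx f"
    using homogD[OF homog_dx[OF g(1)], of q] homogD[OF homog_dx[OF f(1)], of r] by (simp_all add: conj_commute)
  have sw: "dx g * (dx f * s) = sgn_j (q \<and> r) * (dx f * (dx g * s))"
    by (rule homog_left_swap[OF homog_dx[OF f(1)] homog_dx[OF g(1)]])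
  show ?thesis
    unfolding YF_def[of "YF f g"] XF_bracket[OF f(1) g(1), symmetric] dx_YF[OF f(1) g(1)]
    unfolding YF_def XF_diff_right XFm tw
    by (cases q; cases r) (simp_all add: sw sgn_j_def algebra_simps)
qed

section \<open>Parity components\<close>

definition part :: "bool \<Rightarrow> jfun \<Rightarrow> jfun" where
  "part q f = cst (1/2) * (f + sgn_j q * inv_j f)"

lemma homog_part: "homog q (part q f)"
  unfolding homog_def part_def by (auto simp: sgn_j_def algebra_simps)

lemma part_sum: "part False f + part True f = f"
  using half_double[of f] unfolding part_def by (simp add: sgn_j_def algebra_simps)

lemma base_fun_part: "f \<in> base_fun \<Longrightarrow> part q f \<in> base_fun"
  unfolding part_def by (intro base_fun_intros)

lemma inv_j_pow_add: "(inv_j ^^ n) (f + g) = (inv_j ^^ n) f + (inv_j ^^ n) g"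
  by (induction n) auto

lemma Dxj_pow_add: "(Dxj ^^ n) (f + g) = (Dxj ^^ n) f + (Dxj ^^ n) g"
  by (induction n) (auto simp: Dxj_def vap_add)

lemma Dxisj_add: "Dxisj I (f + g) = Dxisj I f + Dxisj I g"
proof -
  have "foldr Dxij is (f + g) = foldr Dxij is f + foldr Dxij is g" for "is"
    by (induction "is") (auto simp: Dxij_def vap_add)
  then show ?thesis unfolding Dxisj_def .
qed

lemma coef_add: "coef_x (f + g) = coef_x f + coef_x g" "coef_xi (f + g) i = coef_xi f i + coef_xi g i"
  by (simp_all add: coef_x_def coef_xi_def sum.distrib algebra_simps)

lemma charact_add: "charact (f + g) = charact f + charact g"
  unfolding charact_def by (simp add: coef_add sum.distrib algebra_simps)

lemma contact_pr_add: "contact_pr (f + g) u = contact_pr f u + contact_pr g u"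
  by (cases u) (simp_all add: coef_add charact_add inv_j_pow_add Dxisj_add Dxj_pow_add sum.distrib distrib_right)

lemma vpart_rep:
  assumes "homog_field q V"
  shows "vpart r (\<lambda>u. rep (V u)) = (if r = q then (\<lambda>u. rep (V u)) else 0)"
proof (intro ext)
  fix u S p
  have "homog (q \<noteq> odd_coord u) (V u)" using assms unfolding homog_field_def by blast
  from homog_rep[OF this, of S] show "vpart r (\<lambda>u. rep (V u)) u S p = (if r = q then (\<lambda>u. rep (V u)) else 0) u S p"
    by (cases "odd (card S)"; cases "odd_coord u"; cases q; cases r) (auto simp: vpart_def)
qed

lemma vpart_add: "vpart q (V + W) = vpart q V + vpart q W"
  by (auto simp: vpart_def fun_eq_iff)

text \<open>A field has the parity of its generating function, so the parity projection of fields
  can be carried out on generating functions.\<close>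

lemma vpart_contact_pr: "vpart q (\<lambda>u. rep (contact_pr f u)) = (\<lambda>u. rep (contact_pr (part q f) u))"
proof -
  have "(\<lambda>u. rep (contact_pr f u)) =
      (\<lambda>u. rep (contact_pr (part False f) u)) + (\<lambda>u. rep (contact_pr (part True f) u))"
    using contact_pr_add[of "part False f" "part True f"] unfolding part_sum
    by (simp add: fun_eq_iff plus_jfun.rep_eq)
  then show ?thesis
    by (cases q) (simp_all add: vpart_add vpart_rep[OF homog_field_contact_pr[OF homog_part]])
qed

section \<open>The prolongation formula\<close>

lemma vapply_contact_D: "vapply (contact_D j) (rep F) = rep (Dc j F)"
proof -
  let ?V = "\<lambda>u. (if u = Cxi j then 1 else 0) + xi j * (if u = Cx then 1 else 0)"
  have "contact_D j u = rep (?V u)" for u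
    by (simp add: contact_D_def dd_def fmult_def plus_jfun.rep_eq times_jfun.rep_eq crdj.rep_eq
        zero_jfun.rep_eq one_jfun.rep_eq)
  then have "contact_D j = (\<lambda>u. rep (?V u))" by (rule ext)
  then have "vapply (contact_D j) (rep F) = rep (vap ?V F)" by (simp only: rep_vap)
  also have "vap ?V F = (\<Sum>u\<in>{u. pdj u F \<noteq> 0} \<union> {Cx, Cxi j}. ?V u * pdj u F)"
    by (intro vap_eq) (auto simp: finite_pdj_support)
  also have "\<dots> = (\<Sum>u\<in>{Cx, Cxi j}. ?V u * pdj u F)"
    by (intro sum.mono_neutral_right) (auto simp: finite_pdj_support)
  also have "\<dots> = Dc j F" by (simp add: Dc_def add.commute)
  finally show ?thesis .
qed

lemma lift0_rep:
  "lift0 (rep f) Cx = rep (coef_x f)"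
  "lift0 (rep f) (Cxi i) = rep (coef_xi f i)"
  "lift0 (rep f) (Ch 0 {}) = rep (dx f * h 0 {})"
proof -
  let ?D = "\<lambda>u. f * (if u = Cx then 1 else 0) + cst (1/2) * (\<Sum>j\<in>UNIV. Dc j (inv_j f) *
      ((if u = Cxi j then 1 else 0) + xi j * (if u = Cx then 1 else 0)))
      + dx f * h 0 {} * (if u = Ch 0 {} then 1 else 0)"
  have "lift0 (rep f) u = rep (?D u)" for u
    unfolding lift0_def contact_field_def vscale_def fmult_def inv_j.rep_eq[symmetric] vapply_contact_D
    by (simp add: contact_D_def dd_def fmult_def plus_jfun.rep_eq times_jfun.rep_eq crdj.rep_eq
        zero_jfun.rep_eq one_jfun.rep_eq cst.rep_eq pdj.rep_eq rep_sum UNIV_idx)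
  moreover have "F * (if P then 1 else 0) = (if P then F else 0)" for F :: jfun and P by simp
  ultimately show "lift0 (rep f) Cx = rep (coef_x f)" "lift0 (rep f) (Cxi i) = rep (coef_xi f i)"
    "lift0 (rep f) (Ch 0 {}) = rep (dx f * h 0 {})"
    by (simp_all add: coef_x_def coef_xi_def)
qed

lemma prolong_lift0: "prolong (lift0 (rep f)) = (\<lambda>u. rep (contact_pr f u))"
proof
  fix u
  have inv: "(invol ^^ n) (rep F) = rep ((inv_j ^^ n) F)" for n F
    by (induction n) (auto simp: inv_j.rep_eq)
  have char: "characteristic (lift0 (rep f)) = rep (charact f)"
    unfolding characteristic_def lift0_rep charact_def
    by (simp add: minus_jfun.rep_eq plus_jfun.rep_eq times_jfun.rep_eq crdj.rep_eq rep_sum UNIV_idx)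
  show "prolong (lift0 (rep f)) u = rep (contact_pr f u)"
  proof (cases u)
    case (Ch m I)
    show ?thesis
      unfolding Ch prolong.simps contact_pr.simps char inv
      by (simp add: lift0_rep plus_jfun.rep_eq times_jfun.rep_eq crdj.rep_eq rep_sum UNIV_idx
          rep_Dxj_pow rep_Dxisj rep_tot_xi del: total_xi.simps tot_xi.simps)
  qed (simp_all add: lift0_rep)
qed

section \<open>Faithfulness of the operator representation\<close>

text \<open>A derivation of \<open>lin\<close> may use the same jet coordinate several times. The
  coefficients are collected here, so that they can be read off by testing.\<close>

lemma lin_normal_form:
  "lin F L \<Longrightarrow> \<exists>U c. finite U \<and> (\<forall>m I. c m I \<in> base_fun) \<and> (\<forall>m I. (m, I) \<notin> U \<longrightarrow> c m I = 0) \<and>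
     F = (\<Sum>(m, I)\<in>U. c m I * h m I) \<and> (\<forall>s. L s = (\<Sum>(m, I)\<in>U. c m I * dbase m I s))"
proof (induction rule: lin.induct)
  case zero
  show ?case by (intro exI[of _ "{}"] exI[of _ "\<lambda>m I. 0"]) (simp add: base_fun_0)
next
  case (step d F L n J)
  then obtain U c where IH: "finite U" "\<And>m I. c m I \<in> base_fun" "\<And>m I. (m, I) \<notin> U \<Longrightarrow> c m I = 0"
    "F = (\<Sum>(m, I)\<in>U. c m I * h m I)" "\<And>s. L s = (\<Sum>(m, I)\<in>U. c m I * dbase m I s)" by blast
  let ?c = "\<lambda>m I. if (m, I) = (n, J) then d + c m I else c m I"
  have sum: "(\<Sum>(m, I)\<in>insert (n, J) U. ?c m I * k m I) = d * k n J + (\<Sum>(m, I)\<in>U. c m I * k m I)" for k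
  proof -
    have "(\<Sum>(m, I)\<in>insert (n, J) U. ?c m I * k m I) =
        (d + c n J) * k n J + (\<Sum>(m, I)\<in>U - {(n, J)}. ?c m I * k m I)"
      using IH(1) by (subst sum.insert_remove) auto
    also have "(\<Sum>(m, I)\<in>U - {(n, J)}. ?c m I * k m I) = (\<Sum>(m, I)\<in>U - {(n, J)}. c m I * k m I)"
    proof (rule sum.cong[OF refl])
      fix x assume "x \<in> U - {(n, J)}"
      then show "(case x of (m, I) \<Rightarrow> ?c m I * k m I) = (case x of (m, I) \<Rightarrow> c m I * k m I)"
        by (cases x) (simp, blast)
    qed
    also have "(d + c n J) * k n J + \<dots> = d * k n J + (\<Sum>(m, I)\<in>insert (n, J) U. c m I * k m I)"
      using IH(1) by (subst sum.insert_remove) (auto simp: algebra_simps)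
    also have "(\<Sum>(m, I)\<in>insert (n, J) U. c m I * k m I) = (\<Sum>(m, I)\<in>U. c m I * k m I)"
      using IH(1,3) by (intro sum.mono_neutral_right) auto
    finally show ?thesis .
  qed
  show ?case
    using IH step(1) sum[of "\<lambda>m I. h m I"] sum[of "\<lambda>m I. dbase m I s" for s]
    by (intro exI[of _ "insert (n, J) U"] exI[of _ ?c]) (auto intro: base_fun_add)
qed

section \<open>Monomials dual to the partial derivatives\<close>

definition xis :: "idx set \<Rightarrow> jfun" where
  "xis I = foldr (\<lambda>i t. xi i * t) (filter (\<lambda>i. i \<in> I) [I4, I3, I2, I1]) 1"

lemma xis_eq: "xis I =
  (let t1 = (if I1 \<in> I then xi I1 else 1); t2 = (if I2 \<in> I then xi I2 * t1 else t1);
       t3 = (if I3 \<in> I then xi I3 * t2 else t2) in (if I4 \<in> I then xi I4 * t3 else t3))"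
  by (simp add: xis_def)

lemma dxi_xi: "dxi i (xi j) = (if i = j then 1 else 0)"
  by (auto simp: pdj_crdj)

lemma dxi_xis: "i \<notin> I \<Longrightarrow> dxi i (xis I) = 0"
  by (cases i; cases "I1 \<in> I"; cases "I2 \<in> I"; cases "I3 \<in> I"; cases "I4 \<in> I")
     (simp_all add: xis_eq pdj_mult dxi_xi)

text \<open>Up to sign, the derivative by \<xi>_i can be moved to the innermost place.\<close>

lemma dxis_eq_0:
  assumes "dxi i t = 0" "i \<in> I"
  shows "dxis I t = 0"
proof -
  note sw = dxi_swap[of I1 I2] dxi_swap[of I1 I3] dxi_swap[of I1 I4]
  show ?thesis
  proof (cases i)
    case I1
    then show ?thesis using assms by (simp add: dxis_eq Let_def sw)
  next
    case I2
    then show ?thesis using assms by (simp add: dxis_eq Let_def dxi_swap[of I2 I3] dxi_swap[of I2 I4])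
  next
    case I3
    then show ?thesis using assms by (simp add: dxis_eq Let_def dxi_swap[of I3 I4])
  next
    case I4
    then show ?thesis using assms by (simp add: dxis_eq Let_def)
  qed
qed

text \<open>No sign occurs because \<open>xis\<close> has its factors in decreasing order: the
  innermost derivative of \<open>dxis\<close>, that of largest index, meets the leftmost
  factor.\<close>

lemma dxis_xis: "dxis I (xis I) = 1"
  by (cases "I1 \<in> I"; cases "I2 \<in> I"; cases "I3 \<in> I"; cases "I4 \<in> I")
     (simp_all add: dxis_eq xis_eq pdj_mult dxi_xi tw_def)

lemma dx_xis: "dx (xis I) = 0"
  by (simp add: xis_eq Let_def pdj_mult pdj_crdj)

lemma dxi_X_pow: "dxi i (X ^ m * t) = X ^ m * dxi i t"
proof -
  have "dxi i (X ^ m) = 0" "inv_j (X ^ m) = X ^ m"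
    by (induction m) (simp_all add: pdj_mult pdj_crdj)
  then show ?thesis by (simp add: pdj_mult tw_def)
qed

lemma dxis_X_pow: "dxis I (X ^ m * t) = X ^ m * dxis I t"
  by (simp add: dxis_eq Let_def dxi_X_pow)

lemma dx_X_pow:
  assumes "dx t = 0"
  shows "dx (X ^ m * t) = cst (of_nat m) * (X ^ (m - 1) * t)"
proof (induction m)
  case (Suc m)
  have "X * (cst (of_nat m) * (X ^ (m - 1) * t)) = cst (of_nat m) * (X ^ m * t)"
    unfolding cst_left_commute by (cases m) (simp_all add: mult.assoc)
  moreover have "dx (X ^ Suc m * t) = X ^ m * t + X * dx (X ^ m * t)"
    by (simp add: pdj_mult[of _ X] pdj_crdj mult.assoc)
  ultimately show ?case
    unfolding Suc by (simp add: cst_add distrib_right)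
qed (simp add: assms)

lemma dx_pow_X_pow:
  assumes "dx t = 0"
  shows "m < n \<Longrightarrow> (dx ^^ n) (X ^ m * t) = 0" "(dx ^^ m) (X ^ m * t) = cst (fact m) * t"
proof -
  have d: "(dx ^^ Suc n) F = (dx ^^ n) (dx F)" for n F by (simp add: funpow_swap1)
  show "m < n \<Longrightarrow> (dx ^^ n) (X ^ m * t) = 0"
  proof (induction n arbitrary: m)
    case (Suc n)
    show ?case
    proof (cases m)
      case 0
      then show ?thesis using assms by (simp only: d) simp
    next
      case (Suc k)
      then show ?thesis using Suc.IH[of k] Suc.prems
        unfolding d dx_X_pow[OF assms] funpow_dx_cst_mult by simp
    qed
  qed simp
  show "(dx ^^ m) (X ^ m * t) = cst (fact m) * t"
  proof (induction m)
    case (Suc m)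
    have "(dx ^^ Suc m) (X ^ Suc m * t) = cst (of_nat (Suc m)) * (cst (fact m) * t)"
      unfolding d dx_X_pow[OF assms] funpow_dx_cst_mult using Suc by simp
    also have "\<dots> = cst (of_nat (Suc m) * fact m) * t"
      unfolding cst_mult mult.assoc ..
    finally show ?case by simp
  qed simp
qed

lemma base_fun_X_xis: "X ^ m * xis I \<in> base_fun"
proof -
  have "X ^ m \<in> base_fun" by (induction m) (auto intro: base_fun_intros)
  moreover have "xis I \<in> base_fun" by (simp add: xis_eq Let_def base_fun_intros)
  ultimately show ?thesis by (rule base_fun_mult)
qed

text \<open>Induction on the order \<open>m + card I\<close>. Applied to x^m \<xi>_I, a derivative
  with \<open>n > m\<close> or \<open>J\<close> not contained in \<open>I\<close> gives 0, the
  remaining ones other than (m, I) have smaller order and hence coefficient 0, and what is left is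
  the coefficient at (m, I) times a factorial.\<close>

lemma lin_zero_imp:
  assumes "lin F L" "\<And>s. s \<in> base_fun \<Longrightarrow> L s = 0"
  shows "F = 0"
proof -
  obtain U c where U: "finite U" "\<And>m I. (m, I) \<notin> U \<Longrightarrow> c m I = 0" "F = (\<Sum>(m, I)\<in>U. c m I * h m I)"
    and L: "\<And>s. L s = (\<Sum>(m, I)\<in>U. c m I * dbase m I s)"
    using lin_normal_form[OF assms(1)] by blast
  have "c m I = 0" for m I
  proof (induction "m + card I" arbitrary: m I rule: less_induct)
    case less
    show ?case
    proof (cases "(m, I) \<in> U")
      case True
      have z: "c n J * dbase n J (X ^ m * xis I) = 0" if "(n, J) \<noteq> (m, I)" for n J
      proof (cases "n \<le> m \<and> J \<subseteq> I")
        case True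
        then have "n + card J < m + card I"
          using that by (metis add_mono_thms_linordered_field(1,2,5) card_mono card_subset_eq finite nat_less_le)
        then show ?thesis using less by simp
      next
        case False
        have "dbase n J (X ^ m * xis I) = 0"
        proof -
          from False consider "m < n" | j where "j \<in> J" "j \<notin> I" by force
          then show ?thesis
          proof cases
            case 1
            have "dx (dxis J (xis I)) = 0"
              using dxi_funpow_dx[of _ 1] by (simp add: dxis_eq Let_def dx_dxi dx_xis)
            from dx_pow_X_pow(1)[OF this 1] show ?thesis by (simp add: dbase_def dxis_X_pow)
          next
            case 2
            then show ?thesis by (simp add: dbase_def dxis_X_pow dxis_eq_0[OF dxi_xis])
          qed
        qed
        then show ?thesis by simp
      qed
      have "0 = (\<Sum>(n, J)\<in>U. c n J * dbase n J (X ^ m * xis I))"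
        using L assms(2)[OF base_fun_X_xis[of m I]] by simp
      also have "\<dots> = (\<Sum>(n, J)\<in>{(m, I)}. c n J * dbase n J (X ^ m * xis I))"
        using U(1) True z by (intro sum.mono_neutral_right) fastforce+
      also have "\<dots> = c m I * cst (fact m)"
        using dx_pow_X_pow(2)[of 1 m] by (simp add: dbase_def dxis_X_pow dxis_xis)
      finally have "cst (1 / fact m) * (cst (fact m) * c m I) = 0"
        by (simp add: cst_commute)
      then show ?thesis by (simp flip: mult.assoc cst_mult)
    qed (use U in auto)
  qed
  then show ?thesis using U(3) by simp
qed

lemma lin_unique: "lin F L \<Longrightarrow> lin G K \<Longrightarrow> (\<And>s. s \<in> base_fun \<Longrightarrow> L s = K s) \<Longrightarrow> F = G"
  using lin_zero_imp[OF lin_diff, of F L G K] by simp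

section \<open>The Lie superalgebra of lifted contact fields\<close>

lemma tw_XF:
  assumes "homog r g"
  shows "tw q (XF g s) = sgn_j (q \<and> r) * XF g (tw q s)"
proof -
  have "inv_j (Dc j s) = - Dc j (inv_j s)" for j s
    by (simp add: Dc_def inv_j_pdj)
  moreover have "inv_j (dx s) = dx (inv_j s)" by (simp add: inv_j_pdj)
  moreover have "inv_j g = sgn_j r * g" using assms by (simp add: homog_def)
  ultimately show ?thesis
    unfolding tw_def XF_def by (cases r) (simp_all add: sum_idx sgn_j_def algebra_simps)
qed

lemma tw_YF:
  assumes "homog r g"
  shows "tw q (YF g s) = sgn_j (q \<and> r) * YF g (tw q s)"
  using homogD[OF homog_dx[OF assms], of q]
  by (auto simp: YF_def tw_XF[OF assms] sgn_j_def conj_commute)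

text \<open>It suffices to compare coefficients. At x and \<xi>_i these are values of X_f, so
  \<open>XF_bracket\<close> applies. At jet coordinates both sides are linear in the jets, so by
  \<open>lin_unique\<close> their operators are compared: the mixed terms cancel, leaving
  \<open>XF_bracket\<close> and \<open>YF_bracket\<close>.\<close>

lemma contact_pr_bracket:
  assumes f: "f \<in> base_fun" "homog q f" and g: "g \<in> base_fun" "homog r g"
  shows "vap (contact_pr f) (contact_pr g u) - sgn_j (q \<and> r) * vap (contact_pr g) (contact_pr f u) =
    contact_pr (YF f g) u"
proof (cases u)
  case Cx
  have "contact_pr e Cx = XF e X" for e by (simp add: XF_coefs pdj_crdj)
  then show ?thesis
    using XF_bracket[OF f(2) g(2), of X] f g
    by (simp add: Cx vap_contact_pr_base_fun base_fun_XF base_fun_X del: contact_pr.simps)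
next
  case (Cxi i)
  have "contact_pr e (Cxi i) = XF e (xi i)" for e by (cases i) (simp_all add: XF_coefs pdj_crdj sum_idx)
  then show ?thesis
    using XF_bracket[OF f(2) g(2), of "xi i"] f g
    by (simp add: Cxi vap_contact_pr_base_fun base_fun_XF base_fun_xi del: contact_pr.simps)
next
  case (Ch m I)
  let ?o = "odd (card I)"
  obtain K where K: "lin (vap (contact_pr f) (contact_pr g (Ch m I))) K"
    "\<And>s. s \<in> base_fun \<Longrightarrow> K s = XF f (XF g (dbase m I s) - sgn_j (r \<and> ?o) * dbase m I (YF g s)) -
       tw q (XF g (dbase m I (tw q (YF f s))) - sgn_j (r \<and> ?o) * dbase m I (YF g (tw q (YF f s))))"
    using lin_vap_contact_pr[OF f lin_contact_pr[OF g, of m I]] by blast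
  obtain M where M: "lin (vap (contact_pr g) (contact_pr f (Ch m I))) M"
    "\<And>s. s \<in> base_fun \<Longrightarrow> M s = XF g (XF f (dbase m I s) - sgn_j (q \<and> ?o) * dbase m I (YF f s)) -
       tw r (XF f (dbase m I (tw r (YF g s))) - sgn_j (q \<and> ?o) * dbase m I (YF f (tw r (YF g s))))"
    using lin_vap_contact_pr[OF g lin_contact_pr[OF f, of m I]] by blast
  have "lin (vap (contact_pr f) (contact_pr g (Ch m I)) - sgn_j (q \<and> r) * vap (contact_pr g) (contact_pr f (Ch m I)))
      (\<lambda>s. K s - sgn_j (q \<and> r) * M s)"
    by (intro lin_diff lin_mult base_fun_sgn_j K M)
  moreover have "lin (contact_pr (YF f g) (Ch m I))
    (\<lambda>s. XF (YF f g) (dbase m I s) - sgn_j ((q \<noteq> r) \<and> ?o) * dbase m I (YF (YF f g) s))"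
    by (intro lin_contact_pr base_fun_YF homog_YF f g)
  moreover have "K s - sgn_j (q \<and> r) * M s =
      XF (YF f g) (dbase m I s) - sgn_j ((q \<noteq> r) \<and> ?o) * dbase m I (YF (YF f g) s)" if s: "s \<in> base_fun" for s
  proof -
    have sg: "dbase m I (sgn_j t * F) = sgn_j t * dbase m I F" "XF F' (sgn_j t * F) = sgn_j t * XF F' F" for F F' t
      by (simp_all add: sgn_j_def dbase_minus XF_minus_right)
    have tP: "tw t (dbase m I F) = sgn_j (t \<and> ?o) * dbase m I (tw t F)" for t F
      using tw_dbase[of t m I "tw t F"] by simp
    have dd: "dbase m I (F - G) = dbase m I F - dbase m I G" for F G
      using dbase_add[of m I F "- G"] by (simp add: dbase_minus)
    show ?thesis
      unfolding K(2)[OF s] M(2)[OF s] XF_bracket[OF f(2) g(2), symmetric]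
        YF_bracket[OF f(2,1) g(2,1) s, symmetric]
      by (cases q; cases r; cases ?o)
        (simp_all add: tP tw_XF[OF f(2)] tw_XF[OF g(2)] tw_YF[OF f(2)] tw_YF[OF g(2)] XF_diff_right
          sgn_j_def dd dbase_add dbase_minus XF_add_right XF_minus_right algebra_simps)
  qed
  ultimately show ?thesis unfolding Ch by (rule lin_unique)
qed

text \<open>The homogeneous case is summed over the four pairs of parities; both sides are additive
  in \<open>f\<close> and \<open>g\<close>.\<close>

lemma vbracket_contact_pr:
  assumes f: "f \<in> base_fun" and g: "g \<in> base_fun"
  shows "vbracket (\<lambda>u. rep (contact_pr f u)) (\<lambda>u. rep (contact_pr g u)) = (\<lambda>u. rep (contact_pr (YF f g) u))"
proof
  fix u
  have "rep (sgn_j t) = const (if t then - 1 else 1)" for t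
    by (cases t) (simp_all add: sgn_j_def uminus_jfun.rep_eq one_jfun.rep_eq const_def fun_eq_iff)
  then have "vbracket (\<lambda>u. rep (contact_pr f u)) (\<lambda>u. rep (contact_pr g u)) u =
    rep (\<Sum>q\<in>UNIV. \<Sum>r\<in>UNIV. vap (contact_pr (part q f)) (contact_pr (part r g) u) -
       sgn_j (q \<and> r) * vap (contact_pr (part r g)) (contact_pr (part q f) u))"
    unfolding vbracket_def vpart_contact_pr
    by (simp add: rep_sum minus_jfun.rep_eq times_jfun.rep_eq rep_vap)
  also have "(\<Sum>q\<in>UNIV. \<Sum>r\<in>UNIV. vap (contact_pr (part q f)) (contact_pr (part r g) u) -
       sgn_j (q \<and> r) * vap (contact_pr (part r g)) (contact_pr (part q f) u)) =
     (\<Sum>q\<in>UNIV. \<Sum>r\<in>UNIV. contact_pr (YF (part q f) (part r g)) u)"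
    using f g by (intro sum.cong refl contact_pr_bracket base_fun_part homog_part)
  also have "\<dots> = contact_pr (YF (part False f + part True f) (part False g + part True g)) u"
    by (simp add: UNIV_bool YF_add_left YF_add_right contact_pr_add algebra_simps)
  finally show "vbracket (\<lambda>u. rep (contact_pr f u)) (\<lambda>u. rep (contact_pr g u)) u = rep (contact_pr (YF f g) u)"
    unfolding part_sum .
qed

section \<open>The system and its ideal\<close>

definition si :: "idx \<Rightarrow> complex" where
  "si i = (- 1) ^ (num i - 1)"

text \<open>Each equation is paired with its operator, so that one case analysis serves the ideal,
  generated by the functions, and the solutions, annihilated by the operators.\<close>

inductive eqn :: "complex \<Rightarrow> jfun \<Rightarrow> (jfun \<Rightarrow> jfun) \<Rightarrow> bool" for \<epsilon> where
  eqn0: "eqn \<epsilon> (cst \<epsilon> * Dxj (Dxj (h 0 {})) + Dxij I1 (Dxij I2 (Dxij I3 (Dxij I4 (h 0 {})))))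
    (\<lambda>s. cst \<epsilon> * dx (dx s) + dxi I1 (dxi I2 (dxi I3 (dxi I4 s))))"
| eqn1: "eqn \<epsilon> (xi i * (cst \<epsilon> * Dxj (Dxij i (h 0 {})) + cst (si i) * Dxisj (- {i}) (h 0 {})))
    (\<lambda>s. xi i * (cst \<epsilon> * dx (dxi i s) + cst (si i) * dxis (- {i}) s))"
| eqn2: "eqn \<epsilon> (Dxj (Dxij i (Dxij j (h 0 {})))) (\<lambda>s. dx (dxi i (dxi j s)))"

lemma system_E_eq: "system_E \<epsilon> = {rep F |F. \<exists>L. eqn \<epsilon> F L}"
proof -
  have 1: "F \<in> system_E \<epsilon> \<Longrightarrow> \<exists>G L. F = rep G \<and> eqn \<epsilon> G L" for F
    unfolding system_E_def Let_def D_check_def crdj.rep_eq[symmetric] cst.rep_eq[symmetric]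
      rep_Dxj[symmetric] rep_Dxij[symmetric] rep_Dxisj[symmetric] times_jfun.rep_eq[symmetric]
      plus_jfun.rep_eq[symmetric] si_def[symmetric]
    using eqn0[of \<epsilon>] eqn1[of \<epsilon>] eqn2[of \<epsilon>] by blast
  have 2: "rep G \<in> system_E \<epsilon>" if "eqn \<epsilon> G L" for G L
    using that unfolding system_E_def Let_def D_check_def crdj.rep_eq[symmetric] cst.rep_eq[symmetric]
      rep_Dxj[symmetric] rep_Dxij[symmetric] rep_Dxisj[symmetric] times_jfun.rep_eq[symmetric]
      plus_jfun.rep_eq[symmetric] si_def[symmetric]
    by cases blast+
  show ?thesis using 1 2 by blast
qed

lemma dbase_0_empty: "dbase 0 {} s = s"
  by (simp add: dbase_def dxis_empty)

lemma lin_h0: "lin (h 0 {}) (\<lambda>s. s)"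
  using lin_h[of 0 "{}"] unfolding dbase_0_empty .

lemma lin_Dxisj: "lin F L \<Longrightarrow> lin (Dxisj I F) (\<lambda>s. dxis I (L s))"
  using lin_total[of F L 0 I] by (simp add: dbase_def)

lemma eqn_lin: "eqn \<epsilon> F L \<Longrightarrow> lin F L"
  by (induction rule: eqn.induct)
     (intro lin_add lin_mult base_fun_intros lin_Dxj lin_Dxij lin_Dxisj lin_h0)+

lemma card_compl_idx: "card (- {i :: idx}) = 3"
  by (cases i) (simp_all add: card_idx)

text \<open>All operators of the system are even: they contain zero, two or four odd derivatives, or
  one or three of them together with the odd factor \<open>xi i\<close>.\<close>

lemma eqn_inv_j: "eqn \<epsilon> F L \<Longrightarrow> L (inv_j s) = inv_j (L s)"
proof (induction rule: eqn.induct)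
  case (eqn1 i)
  have "inv_j (dxis (- {i}) s) = - dxis (- {i}) (inv_j s)"
    using inv_j_dbase[of 0 "- {i}" s] by (simp add: dbase_def card_compl_idx sgn_j_def)
  then show ?case by (simp add: inv_j_pdj algebra_simps)
qed (simp_all add: inv_j_pdj)

definition sols :: "complex \<Rightarrow> jfun set" where
  "sols \<epsilon> = {s \<in> base_fun. \<forall>F L. eqn \<epsilon> F L \<longrightarrow> L s = 0}"

definition ideal_j :: "complex \<Rightarrow> jfun set" where
  "ideal_j \<epsilon> = {F. rep F \<in> ideal_infty (system_E \<epsilon>)}"

lemma sols_base_fun: "s \<in> sols \<epsilon> \<Longrightarrow> s \<in> base_fun"
  by (simp add: sols_def)

lemma sols_eqn: "s \<in> sols \<epsilon> \<Longrightarrow> eqn \<epsilon> F L \<Longrightarrow> L s = 0"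
  by (simp add: sols_def)

lemma sols_iff:
  "s \<in> sols \<epsilon> \<longleftrightarrow> s \<in> base_fun \<and> cst \<epsilon> * dx (dx s) + dxi I1 (dxi I2 (dxi I3 (dxi I4 s))) = 0 \<and>
    (\<forall>i. xi i * (cst \<epsilon> * dx (dxi i s) + cst (si i) * dxis (- {i}) s) = 0) \<and>
    (\<forall>i j. dx (dxi i (dxi j s)) = 0)"
  (is "_ \<longleftrightarrow> ?R")
proof
  assume "s \<in> sols \<epsilon>"
  then show ?R
    using sols_base_fun sols_eqn[OF _ eqn0] sols_eqn[OF _ eqn1] sols_eqn[OF _ eqn2] by blast
next
  assume ?R
  have "L s = 0" if "eqn \<epsilon> F L" for F L
    using that by cases (use \<open>?R\<close> in auto)
  with \<open>?R\<close> show "s \<in> sols \<epsilon>" unfolding sols_def by blast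
qed

lemma solsI: "s \<in> base_fun \<Longrightarrow> (\<And>F L. eqn \<epsilon> F L \<Longrightarrow> L s = 0) \<Longrightarrow> s \<in> sols \<epsilon>"
  by (simp add: sols_def)

lemma sols_add:
  assumes "s \<in> sols \<epsilon>" "t \<in> sols \<epsilon>"
  shows "s + t \<in> sols \<epsilon>"
proof (rule solsI)
  show "L (s + t) = 0" if "eqn \<epsilon> F L" for F L
    using lin_linear[OF eqn_lin[OF that], of s t] sols_eqn[OF _ that] assms by simp
qed (intro base_fun_add assms[THEN sols_base_fun])

lemma sols_cst_mult:
  assumes "s \<in> sols \<epsilon>"
  shows "cst c * s \<in> sols \<epsilon>"
proof (rule solsI)
  show "L (cst c * s) = 0" if "eqn \<epsilon> F L" for F L
    using lin_linear[OF eqn_lin[OF that], of s 0 c] sols_eqn[OF assms that] by simp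
qed (intro base_fun_intros assms[THEN sols_base_fun])

lemma sols_inv_j:
  assumes "s \<in> sols \<epsilon>"
  shows "inv_j s \<in> sols \<epsilon>"
proof (rule solsI)
  show "L (inv_j s) = 0" if "eqn \<epsilon> F L" for F L
    using eqn_inv_j[OF that, of s] sols_eqn[OF assms that] by simp
qed (intro base_fun_intros assms[THEN sols_base_fun])

lemma sols_minus: "s \<in> sols \<epsilon> \<Longrightarrow> - s \<in> sols \<epsilon>"
  using sols_cst_mult[of s \<epsilon> "- 1"] by (simp add: cst_minus)

lemma sols_tw: "s \<in> sols \<epsilon> \<Longrightarrow> tw q s \<in> sols \<epsilon>"
  by (simp add: tw_def sols_inv_j)

lemma sols_part: "s \<in> sols \<epsilon> \<Longrightarrow> part q s \<in> sols \<epsilon>"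
  unfolding part_def sgn_j_def
  by (cases q) (auto intro!: sols_cst_mult sols_add sols_minus sols_inv_j simp del: add_uminus_conv_diff)

lemma ideal_j_0: "0 \<in> ideal_j \<epsilon>"
  unfolding ideal_j_def by (simp add: zero_jfun.rep_eq ideal_infty.zero)

lemma ideal_j_step:
  assumes "eqn \<epsilon> F L" "K \<in> ideal_j \<epsilon>"
  shows "G * (Dxj ^^ m) (Dxisj I F) + K \<in> ideal_j \<epsilon>"
  using ideal_infty.step[of "rep F" "system_E \<epsilon>" "rep G" "rep K" m I] assms rep_functions_J
  unfolding ideal_j_def system_E_eq
  by (auto simp: plus_jfun.rep_eq times_jfun.rep_eq rep_Dxj_pow rep_Dxisj)

text \<open>Members of the ideal are plain superfunctions; each is obtained together with a preimage
  in \<open>jfun\<close>, so that later inductions take place in the ring.\<close>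

lemma ideal_infty_induct:
  assumes "F \<in> ideal_infty (system_E \<epsilon>)" and "P 0"
    and "\<And>F L G K m I. eqn \<epsilon> F L \<Longrightarrow> K \<in> ideal_j \<epsilon> \<Longrightarrow> P K \<Longrightarrow> P (G * (Dxj ^^ m) (Dxisj I F) + K)"
  shows "\<exists>G. F = rep G \<and> G \<in> ideal_j \<epsilon> \<and> P G"
  using assms(1)
proof induction
  case zero
  then show ?case using ideal_j_0 assms(2) by (metis zero_jfun.rep_eq)
next
  case (step F G K m I)
  obtain F' L where F: "F = rep F'" "eqn \<epsilon> F' L" using step(1) unfolding system_E_eq by blast
  obtain K' where K: "K = rep K'" "K' \<in> ideal_j \<epsilon>" "P K'" using step by blast
  obtain G' where G: "G = rep G'" using step(2) abs_jfun_inverse by metis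
  show ?case
    using ideal_j_step[OF F(2) K(2), of G' m I] assms(3)[OF F(2) K(2,3), of G' m I]
    by (intro exI[of _ "G' * (Dxj ^^ m) (Dxisj I F') + K'"])
       (auto simp: F K G plus_jfun.rep_eq times_jfun.rep_eq rep_Dxj_pow rep_Dxisj)
qed

lemma ideal_j_induct [consumes 1, case_names zero step]:
  assumes "F \<in> ideal_j \<epsilon>" and "P 0"
    and "\<And>F L G K m I. eqn \<epsilon> F L \<Longrightarrow> K \<in> ideal_j \<epsilon> \<Longrightarrow> P K \<Longrightarrow> P (G * (Dxj ^^ m) (Dxisj I F) + K)"
  shows "P F"
proof -
  have "\<exists>G. rep F = rep G \<and> G \<in> ideal_j \<epsilon> \<and> P G"
  proof (rule ideal_infty_induct)
    show "rep F \<in> ideal_infty (system_E \<epsilon>)" using assms(1) unfolding ideal_j_def by simp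
  qed (use assms(2,3) in blast)+
  then show ?thesis unfolding rep_inject by blast
qed

lemma ideal_j_add: "F \<in> ideal_j \<epsilon> \<Longrightarrow> G \<in> ideal_j \<epsilon> \<Longrightarrow> F + G \<in> ideal_j \<epsilon>"
proof (induction rule: ideal_j_induct)
  case (step F L H K m I)
  then show ?case using ideal_j_step[OF step(1), of "K + G" H m I] by (simp add: add.assoc)
qed simp

lemma ideal_j_mult: "F \<in> ideal_j \<epsilon> \<Longrightarrow> G * F \<in> ideal_j \<epsilon>"
proof (induction rule: ideal_j_induct)
  case (step F L H K m I)
  then show ?case using ideal_j_step[OF step(1) step(3), of "G * H" m I] by (simp add: distrib_left mult.assoc)
qed (simp add: ideal_j_0)

lemma ideal_j_gen: "eqn \<epsilon> F L \<Longrightarrow> (Dxj ^^ m) (Dxisj I F) \<in> ideal_j \<epsilon>"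
  using ideal_j_step[OF _ ideal_j_0, of \<epsilon> F L 1 m I] by simp

lemma symmetries_eq:
  "symmetries (system_E \<epsilon>) = {\<lambda>u. rep (contact_pr f u) |f. f \<in> base_fun \<and>
     (\<forall>F\<in>ideal_j \<epsilon>. vap (contact_pr f) F \<in> ideal_j \<epsilon>)}"
proof -
  have 1: "cont_infty = {\<lambda>u. rep (contact_pr f u) |f. f \<in> base_fun}"
  proof -
    have "\<exists>g. f = rep g \<and> g \<in> base_fun" if "f \<in> functions_M" for f
      using abs_jfun_inverse[OF functions_M_subset_J[OF that]] that unfolding base_fun_def by (metis mem_Collect_eq)
    moreover have "rep g \<in> functions_M" if "g \<in> base_fun" for g using that unfolding base_fun_def by simp
    ultimately show ?thesis unfolding cont_infty_def prolong_lift0[symmetric] by blast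
  qed
  have 2: "(\<forall>F\<in>ideal_infty (system_E \<epsilon>). vapply (\<lambda>u. rep (contact_pr f u)) F \<in> ideal_infty (system_E \<epsilon>)) \<longleftrightarrow>
     (\<forall>F\<in>ideal_j \<epsilon>. vap (contact_pr f) F \<in> ideal_j \<epsilon>)" for f
  proof
    assume A: "\<forall>F\<in>ideal_infty (system_E \<epsilon>). vapply (\<lambda>u. rep (contact_pr f u)) F \<in> ideal_infty (system_E \<epsilon>)"
    show "\<forall>F\<in>ideal_j \<epsilon>. vap (contact_pr f) F \<in> ideal_j \<epsilon>"
      using A unfolding ideal_j_def by (simp add: rep_vap)
  next
    assume A: "\<forall>F\<in>ideal_j \<epsilon>. vap (contact_pr f) F \<in> ideal_j \<epsilon>"
    show "\<forall>F\<in>ideal_infty (system_E \<epsilon>). vapply (\<lambda>u. rep (contact_pr f u)) F \<in> ideal_infty (system_E \<epsilon>)"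
    proof
      fix F assume "F \<in> ideal_infty (system_E \<epsilon>)"
      then obtain G where "F = rep G" "G \<in> ideal_j \<epsilon>" using ideal_infty_induct[of F \<epsilon> "\<lambda>_. True"] by blast
      then show "vapply (\<lambda>u. rep (contact_pr f u)) F \<in> ideal_infty (system_E \<epsilon>)"
        using A unfolding ideal_j_def by (simp flip: rep_vap)
    qed
  qed
  show ?thesis unfolding symmetries_def 1 using 2 by blast
qed

section \<open>Symmetries map solutions to solutions\<close>

lemma base_fun_rep_cong: "c \<in> base_fun \<Longrightarrow> p Cx = q Cx \<Longrightarrow> rep c S p = rep c S q"
  unfolding base_fun_def functions_M_def
  by (rule entire_in_cong[OF superfuns_entire]) (auto simp: base_coords_def)

lemma base_fun_rep_outside: "c \<in> base_fun \<Longrightarrow> \<not> S \<subseteq> range Cxi \<Longrightarrow> rep c S = 0"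
  unfolding base_fun_def functions_M_def
  by (rule superfuns_zero) (auto simp: base_coords_def)

lemma base_fun_eqI:
  assumes "F \<in> base_fun" "G \<in> base_fun" "\<And>I z. rep F (Cxi ` I) (\<lambda>_. z) = rep G (Cxi ` I) (\<lambda>_. z)"
  shows "F = G"
proof -
  have "rep F S p = rep G S p" for S p
  proof (cases "S \<subseteq> range Cxi")
    case True
    then obtain I where I: "S = Cxi ` I" by (meson subset_imageE)
    show ?thesis
      using assms(3)[of I "p Cx"] base_fun_rep_cong[OF assms(1), of p "\<lambda>_. p Cx"]
        base_fun_rep_cong[OF assms(2), of p "\<lambda>_. p Cx"] unfolding I by simp
  qed (simp add: base_fun_rep_outside assms)
  then show ?thesis by (simp add: fun_eq_iff flip: rep_inject)
qed

text \<open>When all derivatives of an even function \<open>s\<close> have only a body, the values at \<open>x = z\<close> of the jet of \<open>s\<close> are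
  a point of \<open>J\<^sup>\<infinity>M\<close>, at which the equations can be evaluated. The solutions \<open>1\<close> and \<open>x\<close> are of this kind and suffice
  to detect symmetries.\<close>

definition jet_point :: "jfun \<Rightarrow> complex \<Rightarrow> coord \<Rightarrow> complex" where
  "jet_point s z u = (case u of Cx \<Rightarrow> z | Cxi i \<Rightarrow> 0 | Ch m I \<Rightarrow> rep (dbase m I s) {} (\<lambda>_. z))"

definition scalar_fun :: "jfun \<Rightarrow> bool" where
  "scalar_fun s \<longleftrightarrow> s \<in> base_fun \<and> inv_j s = s \<and> (\<forall>m I S. S \<noteq> {} \<longrightarrow> rep (dbase m I s) S = 0)"

text \<open>Keeping only monomials in the \<xi>_i sets the odd jet coordinates to 0, and the even
  ones take their values on the jet of \<open>s\<close>. This substitution turns a linear function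
  into its operator applied to \<open>s\<close>.\<close>

lemma lin_eval:
  assumes "scalar_fun s"
  shows "lin F L \<Longrightarrow> S \<subseteq> range Cxi \<Longrightarrow> rep F S (jet_point s z) = rep (L s) S (jet_point s z)"
proof (induction rule: lin.induct)
  case (step c F L m I)
  let ?p = "jet_point s z"
  note s = assms[unfolded scalar_fun_def]
  have base: "dbase m I s \<in> base_fun" using s base_fun_dbase by blast
  have hB: "rep (h m I) B ?p = rep (dbase m I s) B ?p" if "B \<subseteq> range Cxi" for B
  proof (cases "B = {}")
    case True
    have "rep (dbase m I s) {} ?p = rep (dbase m I s) {} (\<lambda>_. z)"
      by (rule base_fun_rep_cong[OF base]) (simp add: jet_point_def)
    \<comment> \<open>An odd jet coordinate has no value at a point; correspondingly, an odd
      derivative of the even function \<open>s\<close> has no body.\<close>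
    moreover have "rep (dbase m I s) {} = 0" if "odd (card I)"
    proof (rule homog_rep)
      show "homog True (dbase m I s)"
        unfolding homog_def using s that by (simp add: inv_j_dbase)
    qed simp
    ultimately show ?thesis
      using True by (auto simp: crdj.rep_eq crd_def jet_point_def)
  next
    case False
    then have "B \<noteq> {Ch m I}" using that by auto
    then show ?thesis using False s by (auto simp: crdj.rep_eq crd_def)
  qed
  have "rep (c * h m I) S ?p = rep (c * dbase m I s) S ?p"
    unfolding times_jfun.rep_eq sprod_def
  proof (intro sum.cong refl)
    fix A assume "A \<in> Pow S"
    then have "S - A \<subseteq> range Cxi" using step(4) by blast
    then show "(- 1) ^ inversions A (S - A) * rep c A ?p * rep (h m I) (S - A) ?p =
        (- 1) ^ inversions A (S - A) * rep c A ?p * rep (dbase m I s) (S - A) ?p"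
      by (simp add: hB)
  qed
  then show ?case using step by (simp add: plus_jfun.rep_eq)
qed simp

text \<open>The substitution is multiplicative, since subsets of \<open>S\<close> again consist of
  \<xi>_i only. As it kills the total derivatives of the equations, it kills the ideal.\<close>

lemma ideal_j_eval:
  assumes s: "scalar_fun s" "s \<in> sols \<epsilon>"
  shows "F \<in> ideal_j \<epsilon> \<Longrightarrow> S \<subseteq> range Cxi \<Longrightarrow> rep F S (jet_point s z) = 0"
proof (induction arbitrary: S rule: ideal_j_induct)
  case (step F L G K m I)
  have B: "rep ((Dxj ^^ m) (Dxisj I F)) B (jet_point s z) = 0" if "B \<subseteq> range Cxi" for B
    using lin_eval[OF s(1) lin_total[OF eqn_lin[OF step(1)], of m I] that, of z] sols_eqn[OF s(2) step(1)]
    by (simp add: dbase_0 zero_jfun.rep_eq)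
  have "rep (G * (Dxj ^^ m) (Dxisj I F)) S (jet_point s z) = 0"
    unfolding times_jfun.rep_eq sprod_def
  proof (intro sum.neutral ballI)
    fix A assume "A \<in> Pow S"
    then have "S - A \<subseteq> range Cxi" using step(4) by blast
    then show "(- 1) ^ inversions A (S - A) * rep G A (jet_point s z) *
        rep ((Dxj ^^ m) (Dxisj I F)) (S - A) (jet_point s z) = 0" by (simp add: B)
  qed
  then show ?case using step by (simp add: plus_jfun.rep_eq)
qed (simp add: zero_jfun.rep_eq)

lemma lin_ideal_j_imp_zero:
  assumes "lin F L" "F \<in> ideal_j \<epsilon>" and s: "scalar_fun s" "s \<in> sols \<epsilon>"
  shows "L s = 0"
proof (rule base_fun_eqI[OF _ base_fun_0])
  show Ls: "L s \<in> base_fun" using lin_base_fun[OF assms(1)] sols_base_fun[OF s(2)] by blast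
  fix I z
  have "rep (L s) (Cxi ` I) (\<lambda>_. z) = rep (L s) (Cxi ` I) (jet_point s z)"
    by (rule base_fun_rep_cong[OF Ls]) (simp add: jet_point_def)
  also have "\<dots> = 0"
    using lin_eval[OF s(1) assms(1), of "Cxi ` I" z] ideal_j_eval[OF s assms(2), of "Cxi ` I" z] by auto
  finally show "rep (L s) (Cxi ` I) (\<lambda>_. z) = rep 0 (Cxi ` I) (\<lambda>_. z)" by (simp add: zero_jfun.rep_eq)
qed

lemma tw_eqn: "eqn \<epsilon> F L \<Longrightarrow> tw q (L (tw q s)) = L s"
  using eqn_inv_j[of \<epsilon> F L "inv_j s"] by (auto simp: tw_def)

text \<open>At a solution \<open>s\<close> the term X_f (L s) vanishes and \<open>L\<close> is even,
  so the operator of the transformed equation takes the value \<open>- L (YF f s)\<close>. The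
  transformed equation lies in the ideal, and evaluation on the jet of the scalar \<open>s\<close>
  shows that this value is 0.\<close>

lemma symmetry_imp_YF_sols:
  assumes f: "f \<in> base_fun" and sym: "\<And>F. F \<in> ideal_j \<epsilon> \<Longrightarrow> vap (contact_pr f) F \<in> ideal_j \<epsilon>"
    and s: "scalar_fun s" "s \<in> sols \<epsilon>"
  shows "YF f s \<in> sols \<epsilon>"
  unfolding sols_def
proof (intro CollectI conjI allI impI)
  have sb: "s \<in> base_fun" using s(2) by (rule sols_base_fun)
  then show "YF f s \<in> base_fun" by (intro base_fun_YF f)
  fix F L assume e: "eqn \<epsilon> F L"
  have K: "\<exists>K. lin (vap (contact_pr (part q f)) F) K \<and> K s = - L (YF (part q f) s)" for q
  proof -
    obtain K where "lin (vap (contact_pr (part q f)) F) K"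
      "\<forall>s\<in>base_fun. K s = XF (part q f) (L s) - tw q (L (tw q (YF (part q f) s)))"
      using lin_vap_contact_pr[OF base_fun_part[OF f] homog_part eqn_lin[OF e]] by blast
    then show ?thesis using sb sols_eqn[OF s(2) e] tw_eqn[OF e]
      by (intro exI[of _ K]) (simp add: XF_def)
  qed
  obtain K0 K1 where K: "lin (vap (contact_pr (part False f)) F) K0" "K0 s = - L (YF (part False f) s)"
     "lin (vap (contact_pr (part True f)) F) K1" "K1 s = - L (YF (part True f) s)"
    using K[of False] K[of True] by blast
  have "contact_pr f = (\<lambda>u. contact_pr (part False f) u + contact_pr (part True f) u)"
    using contact_pr_add[of "part False f" "part True f"] unfolding part_sum by (rule ext)
  then have "lin (vap (contact_pr f) F) (\<lambda>s. K0 s + K1 s)"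
    using lin_add[OF K(1,3)] by (simp add: vap_add_field)
  moreover have "vap (contact_pr f) F \<in> ideal_j \<epsilon>"
    using ideal_j_gen[OF e, of 0 "{}"] by (intro sym) (simp add: Dxisj_def)
  ultimately have "K0 s + K1 s = 0" by (rule lin_ideal_j_imp_zero[OF _ _ s])
  moreover have "L (YF (part False f) s) + L (YF (part True f) s) = L (YF f s)"
    using lin_linear[OF eqn_lin[OF e], of "YF (part False f) s" "YF (part True f) s"]
    unfolding YF_add_left[symmetric] part_sum by simp
  moreover have "K0 s + K1 s = - (L (YF (part False f) s) + L (YF (part True f) s))"
    unfolding K(2,4) by simp
  ultimately show "L (YF f s) = 0" by simp
qed

section \<open>Linear functions that vanish on all solutions\<close>

text \<open>The condition on solutions is carried along, because evaluation at points derives it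
  from ideal membership for scalar solutions only.\<close>

definition rel :: "complex \<Rightarrow> jfun \<Rightarrow> (jfun \<Rightarrow> jfun) \<Rightarrow> bool" where
  "rel \<epsilon> F L \<longleftrightarrow> F \<in> ideal_j \<epsilon> \<and> lin F L \<and> (\<forall>s\<in>sols \<epsilon>. L s = 0)"

lemma rel_gen: "eqn \<epsilon> F L \<Longrightarrow> rel \<epsilon> ((Dxj ^^ m) (Dxisj I F)) (\<lambda>s. dbase m I (L s))"
proof -
  assume e: "eqn \<epsilon> F L"
  have "dbase m I (L s) = 0" if "s \<in> sols \<epsilon>" for s using sols_eqn[OF that e] by (simp add: dbase_0)
  then show ?thesis unfolding rel_def using ideal_j_gen[OF e] lin_total[OF eqn_lin[OF e]] by blast
qed

text \<open>By \<open>lin_unique\<close>, equality of operators on the base is equality of jet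
  functions, so ideal membership can be settled by computing with operators.\<close>

lemma rel_cong:
  assumes "rel \<epsilon> F L" "lin G K" "\<And>s. s \<in> base_fun \<Longrightarrow> K s = L s"
  shows "rel \<epsilon> G K"
proof -
  have "G = F" using assms unfolding rel_def by (intro lin_unique[of G K F L]) auto
  then show ?thesis using assms sols_base_fun unfolding rel_def by auto
qed

lemma rel_add: "rel \<epsilon> F L \<Longrightarrow> rel \<epsilon> G K \<Longrightarrow> rel \<epsilon> (F + G) (\<lambda>s. L s + K s)"
  unfolding rel_def by (auto intro: ideal_j_add lin_add)

lemma rel_mult: "rel \<epsilon> F L \<Longrightarrow> c \<in> base_fun \<Longrightarrow> rel \<epsilon> (c * F) (\<lambda>s. c * L s)"
  unfolding rel_def by (auto intro: ideal_j_mult lin_mult)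

lemma rel_0: "rel \<epsilon> 0 (\<lambda>s. 0)"
  unfolding rel_def by (auto intro: ideal_j_0 lin.zero)

section \<open>Reduction of jet coordinates modulo the ideal\<close>

lemma dxis_split:
  assumes "2 \<le> card I"
  shows "\<exists>i j. \<forall>s. dxis I s = dxis (I - {i, j}) (dxi i (dxi j s))"
proof -
  \<comment> \<open>The two largest indices of \<open>I\<close> are split off: their derivatives are
    innermost in \<open>dxis\<close>, so no sign arises.\<close>
  consider "I3 \<in> I" "I4 \<in> I" | "I2 \<in> I" "I4 \<in> I" "I3 \<notin> I" | "I1 \<in> I" "I4 \<in> I" "I2 \<notin> I" "I3 \<notin> I"
    | "I2 \<in> I" "I3 \<in> I" "I4 \<notin> I" | "I1 \<in> I" "I3 \<in> I" "I2 \<notin> I" "I4 \<notin> I" | "I1 \<in> I" "I2 \<in> I" "I3 \<notin> I" "I4 \<notin> I"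
    using assms unfolding card_idx by (cases "I1 \<in> I"; cases "I2 \<in> I"; cases "I3 \<in> I"; cases "I4 \<in> I") auto
  then show ?thesis
  proof cases
    case 1 then show ?thesis by (intro exI[of _ I3] exI[of _ I4]) (simp add: dxis_eq Let_def)
  next
    case 2 then show ?thesis by (intro exI[of _ I2] exI[of _ I4]) (simp add: dxis_eq Let_def)
  next
    case 3 then show ?thesis by (intro exI[of _ I1] exI[of _ I4]) (simp add: dxis_eq Let_def)
  next
    case 4 then show ?thesis by (intro exI[of _ I2] exI[of _ I3]) (simp add: dxis_eq Let_def)
  next
    case 5 then show ?thesis by (intro exI[of _ I1] exI[of _ I3]) (simp add: dxis_eq Let_def)
  next
    case 6 then show ?thesis by (intro exI[of _ I1] exI[of _ I2]) (simp add: dxis_eq Let_def)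
  qed
qed

lemma dbase_Suc: "dbase (Suc m) I s = dbase m I (dx s)"
proof -
  have "dxis I (dx s) = dx (dxis I s)" by (simp add: dxis_eq Let_def dx_dxi)
  then show ?thesis by (simp add: dbase_def funpow_swap1)
qed

lemma rel_h_Suc_2:
  assumes "2 \<le> card I"
  shows "rel \<epsilon> (h (Suc m) I) (dbase (Suc m) I)"
proof -
  obtain i j where ij: "\<And>s. dxis I s = dxis (I - {i, j}) (dxi i (dxi j s))"
    using dxis_split[OF assms] by blast
  have "dbase (Suc m) I s = dbase m (I - {i, j}) (dx (dxi i (dxi j s)))" for s
    unfolding dbase_Suc by (simp add: dbase_def ij dx_dxi)
  then show ?thesis
    by (intro rel_cong[OF rel_gen[OF eqn2] lin_h]) auto
qed

lemma dbase_0_UNIV: "dbase 0 UNIV s = dxi I1 (dxi I2 (dxi I3 (dxi I4 s)))"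
  by (simp add: dbase_def dxis_eq)

lemma rel_scale: "rel \<epsilon> (cst c * F) (\<lambda>s. cst c * L s) \<Longrightarrow> lin F L \<Longrightarrow> c \<noteq> 0 \<Longrightarrow> rel \<epsilon> F L"
  by (drule rel_mult[OF _ base_fun_cst[of "1/c"]], erule rel_cong) (simp_all flip: mult.assoc cst_mult)

text \<open>The \<xi>_i-derivative of the first equation: the fourfold \<xi>-derivative dies, and
  \<epsilon> times the wanted derivative remains.\<close>

lemma rel_h_2_single:
  assumes "\<epsilon> \<noteq> 0"
  shows "rel \<epsilon> (h (Suc (Suc m)) {i}) (dbase (Suc (Suc m)) {i})"
proof (rule rel_scale[OF _ lin_h assms], rule rel_cong[OF rel_gen[OF eqn0, of \<epsilon> m "{i}"]])
  have "dxi i (dbase 0 UNIV s) = 0" for s by (simp add: dxi_dbase)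
  then show "cst \<epsilon> * dbase (Suc (Suc m)) {i} s = dbase m {i} (cst \<epsilon> * dx (dx s) + dxi I1 (dxi I2 (dxi I3 (dxi I4 s))))" for s
    unfolding dbase_0_UNIV[symmetric] by (simp add: dbase_add dbase_cst_mult dbase_Suc) (simp add: dbase_def dxis_single)
qed (intro lin_mult lin_h base_fun_cst)

text \<open>The x-derivatives of the first equation: their fourfold \<xi>-term is already a relation
  by the third equation and is subtracted.\<close>

lemma rel_h_3:
  assumes "\<epsilon> \<noteq> 0"
  shows "rel \<epsilon> (h (Suc (Suc (Suc m))) {}) (dbase (Suc (Suc (Suc m))) {})"
proof -
  have "dbase (Suc m) {} (dbase 0 UNIV s) = dbase (Suc m) UNIV s" for s
    by (simp add: dbase_def dxis_empty)
  then have e: "dbase (Suc m) {} (cst \<epsilon> * dx (dx s) + dxi I1 (dxi I2 (dxi I3 (dxi I4 s)))) =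
      cst \<epsilon> * dbase (Suc (Suc (Suc m))) {} s + dbase (Suc m) UNIV s" for s
    unfolding dbase_0_UNIV[symmetric] by (simp add: dbase_add dbase_cst_mult dbase_Suc)
  have "card (UNIV :: idx set) = 4" by (simp add: card_idx)
  then have U: "rel \<epsilon> (- 1 * h (Suc m) UNIV) (\<lambda>s. - 1 * dbase (Suc m) UNIV s)"
    by (intro rel_mult rel_h_Suc_2 base_fun_intros) simp
  show ?thesis
  proof (rule rel_scale[OF _ lin_h assms], rule rel_cong[OF rel_add[OF rel_gen[OF eqn0, of \<epsilon> "Suc m" "{}"] U]])
    show "cst \<epsilon> * dbase (Suc (Suc (Suc m))) {} s = dbase (Suc m) {} (cst \<epsilon> * dx (dx s) + dxi I1 (dxi I2 (dxi I3 (dxi I4 s)))) + - 1 * dbase (Suc m) UNIV s" for s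
      unfolding e by simp
  qed (intro lin_mult lin_h base_fun_cst)
qed

text \<open>The parametric derivatives of the system. There are 1 + 6 + 1 + 1 even and 4 + 4 odd
  ones, which is the dimension of the solution space.\<close>

definition free_jets :: "(nat \<times> idx set) set" where
  "free_jets = {(m, I). m = 0 \<and> card I \<noteq> 3 \<or> m = 1 \<and> card I \<le> 1}"

lemma finite_free_jets: "finite free_jets"
  by (rule finite_subset[of _ "{0, 1} \<times> UNIV"]) (auto simp: free_jets_def)

definition nform :: "jfun \<Rightarrow> (jfun \<Rightarrow> jfun) \<Rightarrow> bool" where
  "nform N K \<longleftrightarrow> (\<exists>c. (\<forall>m I. c m I \<in> base_fun) \<and> N = (\<Sum>(m, I)\<in>free_jets. c m I * h m I) \<and>
     K = (\<lambda>s. \<Sum>(m, I)\<in>free_jets. c m I * dbase m I s))"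

lemma nform_0: "nform 0 (\<lambda>s. 0)"
  unfolding nform_def by (intro exI[of _ "\<lambda>m I. 0"]) (simp add: base_fun_0)

lemma nform_add: "nform N K \<Longrightarrow> nform M L \<Longrightarrow> nform (N + M) (\<lambda>s. K s + L s)"
  unfolding nform_def
proof (elim exE conjE, goal_cases)
  case (1 c d)
  then show ?case
    by (intro exI[of _ "\<lambda>m I. c m I + d m I"])
       (auto simp: distrib_right split_def sum.distrib intro: base_fun_add)
qed

lemma nform_mult: "nform N K \<Longrightarrow> e \<in> base_fun \<Longrightarrow> nform (e * N) (\<lambda>s. e * K s)"
  unfolding nform_def
proof (elim exE conjE, goal_cases)
  case (1 c)
  then show ?case
    by (intro exI[of _ "\<lambda>m I. e * c m I"])
       (auto simp: split_def sum_distrib_left mult.assoc intro: base_fun_mult)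
qed

lemma nform_h:
  assumes "(m, I) \<in> free_jets"
  shows "nform (h m I) (dbase m I)"
proof -
  let ?c = "\<lambda>n J. if (n, J) = (m, I) then 1 else 0 :: jfun"
  have "(\<Sum>(n, J)\<in>free_jets. ?c n J * k n J) = k m I" for k
  proof -
    have "(\<Sum>(n, J)\<in>free_jets. ?c n J * k n J) = (\<Sum>x\<in>free_jets. if x = (m, I) then k m I else 0)"
    proof (rule sum.cong[OF refl])
      fix x show "(case x of (n, J) \<Rightarrow> ?c n J * k n J) = (if x = (m, I) then k m I else 0)"
        by (cases "x = (m, I)"; cases x) auto
    qed
    then show ?thesis using assms finite_free_jets by simp
  qed
  from this[of "\<lambda>m I. h m I"] this[of "\<lambda>m I. dbase m I s" for s] show ?thesis
    unfolding nform_def by (intro exI[of _ ?c]) (auto simp: base_fun_0 base_fun_1)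
qed

definition reducible :: "complex \<Rightarrow> jfun \<Rightarrow> (jfun \<Rightarrow> jfun) \<Rightarrow> bool" where
  "reducible \<epsilon> F L \<longleftrightarrow> (\<exists>N K. nform N K \<and> rel \<epsilon> (F - N) (\<lambda>s. L s - K s))"

lemma reducible_rel: "rel \<epsilon> F L \<Longrightarrow> reducible \<epsilon> F L"
  unfolding reducible_def using nform_0 by (intro exI[of _ 0] exI[of _ "\<lambda>s. 0"]) simp

lemma reducible_nform: "nform F L \<Longrightarrow> reducible \<epsilon> F L"
  unfolding reducible_def using rel_0 by (intro exI[of _ F] exI[of _ L]) simp

lemma reducible_add:
  assumes "reducible \<epsilon> F L" "reducible \<epsilon> G K"
  shows "reducible \<epsilon> (F + G) (\<lambda>s. L s + K s)"
proof -
  obtain N A M B where 1: "nform N A" "rel \<epsilon> (F - N) (\<lambda>s. L s - A s)" "nform M B" "rel \<epsilon> (G - M) (\<lambda>s. K s - B s)"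
    using assms unfolding reducible_def by blast
  have "rel \<epsilon> (F + G - (N + M)) (\<lambda>s. L s + K s - (A s + B s))"
    using rel_add[OF 1(2,4)] by (simp add: algebra_simps)
  then show ?thesis unfolding reducible_def using nform_add[OF 1(1,3)] by blast
qed

lemma reducible_mult:
  assumes "reducible \<epsilon> F L" "c \<in> base_fun"
  shows "reducible \<epsilon> (c * F) (\<lambda>s. c * L s)"
proof -
  obtain N A where 1: "nform N A" "rel \<epsilon> (F - N) (\<lambda>s. L s - A s)"
    using assms unfolding reducible_def by blast
  have "rel \<epsilon> (c * F - c * N) (\<lambda>s. c * L s - c * A s)"
    using rel_mult[OF 1(2) assms(2)] by (simp add: right_diff_distrib)
  then show ?thesis unfolding reducible_def using nform_mult[OF 1(1) assms(2)] by blast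
qed

lemma si_si: "cst (si i) * (cst (si i) * F) = F"
  by (cases i) (simp_all add: si_def flip: mult.assoc cst_mult)

text \<open>The second equation has the form \<xi>_i W = 0, and its \<xi>_i-derivative says W =
  \<xi>_i W' with W' the \<xi>_i-derivative of W. In W' only the fourfold derivative survives, so
  the threefold derivative in W is expressed by parametric ones.\<close>

lemma reducible_triple: "reducible \<epsilon> (h 0 (- {i})) (dbase 0 (- {i}))"
proof -
  let ?c = "cst (- (si i * \<epsilon>))" and ?d = "cst (si i) * (xi i * cst (si i * sg i (- {i})))"
  let ?A = "?c * h 1 {i} + ?d * h 0 UNIV" and ?L = "\<lambda>s. ?c * dbase 1 {i} s + ?d * dbase 0 UNIV s"
  have A: "reducible \<epsilon> ?A ?L"
    by (intro reducible_add reducible_mult reducible_nform nform_h base_fun_intros)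
       (auto simp: free_jets_def card_idx)
  have linA: "lin (h 0 (- {i}) - ?A) (\<lambda>s. dbase 0 (- {i}) s - ?L s)"
    by (intro lin_diff lin_add lin_mult lin_h base_fun_intros)
  have "rel \<epsilon> (h 0 (- {i}) - ?A) (\<lambda>s. dbase 0 (- {i}) s - ?L s)"
  proof (rule rel_cong[OF rel_mult[OF rel_gen[OF eqn1, of \<epsilon> 0 "{i}" i] base_fun_cst[of "si i"]] linA])
    fix s
    have 1: "dxi i (dxis (- {i}) s) = cst (sg i (- {i})) * dbase 0 UNIV s"
    proof -
      have "insert i (- {i}) = UNIV" by auto
      then show ?thesis by (simp add: dxi_dxis dbase_def)
    qed
    have 2: "dxi i (dx (dxi i s)) = 0" by (simp add: dx_dxi dxi_dxis dxi_dxi)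
    have 3: "dbase 0 {i} (xi i * W) = W - xi i * dxi i W" for W
      by (simp add: dbase_def dxis_single pdj_mult dxi_xi tw_def)
    have 4: "dbase 1 {i} s = dx (dxi i s)" by (simp add: dbase_def dxis_single)
    have 5: "dbase 0 (- {i}) s = dxis (- {i}) s" by (simp add: dbase_def)
    show "dbase 0 (- {i}) s - ?L s = cst (si i) * dbase 0 {i} (xi i * (cst \<epsilon> * dx (dxi i s) + cst (si i) * dxis (- {i}) s))"
      unfolding 3 4 5
      by (simp add: 1 2 si_si right_diff_distrib distrib_left cst_minus cst_mult mult.assoc)
  qed
  from reducible_add[OF reducible_rel[OF this] A] show ?thesis by simp
qed

lemma reducible_h:
  assumes "\<epsilon> \<noteq> 0"
  shows "reducible \<epsilon> (h m I) (dbase m I)"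
proof -
  consider "(m, I) \<in> free_jets" | "m = 0" "card I = 3" | k where "m = Suc k" "2 \<le> card I"
    | k i where "m = Suc (Suc k)" "I = {i}" | k where "m = Suc (Suc (Suc k))" "I = {}" | "m = 2" "I = {}"
  proof (cases "card I \<le> 1")
    case True
    then have "I = {} \<or> (\<exists>i. I = {i})" by (metis One_nat_def card_0_eq card_1_singletonE finite le_Suc_eq le_zero_eq)
    moreover have "m = 0 \<or> m = 1 \<or> m = 2 \<or> (\<exists>k. m = Suc (Suc (Suc k)))" by arith
    ultimately show ?thesis
      using that(1,4,5,6) True unfolding free_jets_def numeral_2_eq_2 by fastforce
  next
    case False
    then show ?thesis using that(1,2,3) unfolding free_jets_def by (cases m) force+
  qed
  then show ?thesis
  proof cases
    case 1
    then show ?thesis by (intro reducible_nform nform_h)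
  next
    case 2
    have "card (- I) = card (UNIV :: idx set) - card I"
      unfolding Compl_eq_Diff_UNIV by (rule card_Diff_subset) auto
    also have "card (UNIV :: idx set) = 4" by (simp add: card_idx)
    finally have "card (- I) = 1" using 2 by simp
    then obtain i where "- I = {i}" by (auto simp: card_Suc_eq dest: card_1_singletonE)
    then have "I = - {i}" by auto
    then show ?thesis using reducible_triple 2 by simp
  next
    case 3
    then show ?thesis using rel_h_Suc_2 by (simp add: reducible_rel)
  next
    case 4
    then show ?thesis using rel_h_2_single[OF assms] by (simp add: reducible_rel)
  next
    case 5
    then show ?thesis using rel_h_3[OF assms] by (simp add: reducible_rel)
  next
    case 6
    \<comment> \<open>The first equation is solved for the second x-derivative.\<close>
    let ?c = "cst (- (1/\<epsilon>))"
    have A: "reducible \<epsilon> (?c * h 0 UNIV) (\<lambda>s. ?c * dbase 0 UNIV s)"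
      by (intro reducible_mult reducible_nform nform_h base_fun_intros) (auto simp: free_jets_def card_idx)
    have "rel \<epsilon> (h 2 {} - ?c * h 0 UNIV) (\<lambda>s. dbase 2 {} s - ?c * dbase 0 UNIV s)"
    proof (rule rel_cong[OF rel_mult[OF rel_gen[OF eqn0, of \<epsilon> 0 "{}"] base_fun_cst[of "1/\<epsilon>"]]])
      show "dbase 2 {} s - ?c * dbase 0 UNIV s =
          cst (1/\<epsilon>) * dbase 0 {} (cst \<epsilon> * dx (dx s) + dxi I1 (dxi I2 (dxi I3 (dxi I4 s))))" for s
        using assms unfolding dbase_0_UNIV[symmetric] dbase_0_empty
        by (simp add: distrib_left cst_minus numeral_2_eq_2 dbase_Suc dbase_0_empty flip: mult.assoc cst_mult)
    qed (intro lin_diff lin_mult lin_h base_fun_intros)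
    from reducible_add[OF reducible_rel[OF this] A] show ?thesis using 6 by simp
  qed
qed

lemma reducible_lin: "lin F L \<Longrightarrow> \<epsilon> \<noteq> 0 \<Longrightarrow> reducible \<epsilon> F L"
proof (induction rule: lin.induct)
  case zero
  show ?case by (rule reducible_rel[OF rel_0])
next
  case (step c F L m I)
  then show ?case by (intro reducible_add reducible_mult reducible_h)
qed

section \<open>Explicit solutions\<close>

lemma sols_iff': "s \<in> sols \<epsilon> \<longleftrightarrow> s \<in> base_fun \<and> cst \<epsilon> * dx (dx s) + dxis UNIV s = 0 \<and>
    (\<forall>i. xi i * (cst \<epsilon> * dxi i (dx s) + cst (si i) * dxis (- {i}) s) = 0) \<and>
    (\<forall>i j. dxi i (dxi j (dx s)) = 0)"
  unfolding sols_iff dx_dxi by (simp add: dxis_eq)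

lemma base_fun_xis: "xis I \<in> base_fun"
  using base_fun_X_xis[of 0 I] by simp

lemma dxis_xis_0: "i \<in> J \<Longrightarrow> i \<notin> I \<Longrightarrow> dxis J (xis I) = 0"
  by (rule dxis_eq_0[OF dxi_xis])

lemma xis_single: "xis {i} = xi i"
  by (cases i) (simp_all add: xis_eq)

lemma dxis_minus: "dxis I (- F) = - dxis I F" and dxis_cst_mult: "dxis I (cst c * F) = cst c * dxis I F"
  using dbase_minus[of 0 I F] dbase_cst_mult[of 0 I c F] by (simp_all add: dbase_def)

lemma dxis_diff: "dxis I (F - G) = dxis I F - dxis I G"
  using dxis_add[of I F "- G"] by (simp add: dxis_minus)

lemma xis_sols:
  assumes "I \<noteq> UNIV" "card I \<noteq> 3"
  shows "xis I \<in> sols \<epsilon>"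
proof -
  have "dxis (- {i}) (xis I) = 0" for i
  proof -
    have "\<not> - {i} \<subseteq> I"
    proof
      assume "- {i} \<subseteq> I"
      then have "I = - {i} \<or> I = UNIV" by (cases "i \<in> I") auto
      then show False using assms card_compl_idx[of i] by blast
    qed
    then obtain j where "j \<in> - {i}" "j \<notin> I" by blast
    then show ?thesis by (rule dxis_xis_0)
  qed
  moreover have "dxis UNIV (xis I) = 0"
  proof -
    obtain j where "j \<notin> I" using assms(1) by blast
    then show ?thesis by (intro dxis_xis_0[of j]) auto
  qed
  ultimately show ?thesis by (simp add: sols_iff' base_fun_xis dx_xis)
qed

text \<open>The solution that extends x^2: the coefficient of the top monomial makes its fourfold
  derivative cancel the value 2 \<epsilon> of the first term in the first equation.\<close>

definition quad :: "complex \<Rightarrow> jfun" where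
  "quad \<epsilon> = X * X - cst (2 * \<epsilon>) * xis UNIV"

text \<open>The solution that extends x \<xi>_i: the cubic correction cancels the \<epsilon> that
  the mixed derivative contributes to the second equation; the sign \<open>si i\<close> occurs there
  once more and squares to 1.\<close>

definition beta :: "complex \<Rightarrow> idx \<Rightarrow> jfun" where
  "beta \<epsilon> i = X * xi i - cst (si i * \<epsilon>) * xis (- {i})"

lemma X_sols: "X \<in> sols \<epsilon>"
proof -
  have "dxis I X = 0" if "I \<noteq> {}" for I
    using that dxis_eq_0[of _ X I] by (auto simp: pdj_crdj)
  moreover have "- {i} \<noteq> {}" for i :: idx by (cases i) auto
  ultimately show ?thesis by (simp add: sols_iff' base_fun_X pdj_crdj)
qed

lemma dxis_X_X: "I \<noteq> {} \<Longrightarrow> dxis I (X * X) = 0"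
  using dxis_eq_0[of _ "X * X" I] by (auto simp: pdj_crdj pdj_mult)

text \<open>Three derivatives of \<xi>_1 \<xi>_2 \<xi>_3 \<xi>_4 leave a multiple of \<xi>_i, which
  is killed by \<xi>_i. Thanks to this factor in the second equation, \<open>quad\<close> is a
  solution.\<close>

lemma xi_dxis_xis_UNIV: "xi i * dxis (- {i}) (xis UNIV) = 0"
proof -
  have l: "xi j * (xi i * F) = - (xi i * (xi j * F))" for i j F
    using xi_swap[of j i] by (simp flip: mult.assoc)
  show ?thesis
    by (cases i) (simp_all add: dxis_eq xis_eq pdj_mult dxi_xi tw_def xi_xi)
qed

lemma quad_sols: "quad \<epsilon> \<in> sols \<epsilon>"
proof -
  have ne: "- {i} \<noteq> {}" for i :: idx by (cases i) auto
  have "dx (dx (X * X)) = cst 2"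
    using cst_add[of 1 1] by (simp add: pdj_mult pdj_crdj tw_def)
  then have "cst \<epsilon> * dx (dx (quad \<epsilon>)) + dxis UNIV (quad \<epsilon>) = 0"
    by (simp add: quad_def dxis_diff dxis_cst_mult dxis_X_X dxis_xis dx_xis flip: cst_mult) (simp add: mult.commute)
  moreover have "dxi i (dx (quad \<epsilon>)) = 0" for i
    by (simp add: quad_def dx_xis pdj_mult pdj_crdj tw_def)
  moreover have "xi i * dxis (- {i}) (quad \<epsilon>) = 0" for i
    by (simp add: quad_def dxis_diff dxis_cst_mult dxis_X_X ne right_diff_distrib cst_left_commute xi_dxis_xis_UNIV)
  moreover have "quad \<epsilon> \<in> base_fun" unfolding quad_def by (intro base_fun_intros base_fun_xis)
  ultimately show ?thesis by (simp add: sols_iff' cst_left_commute)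
qed

lemma dx_beta: "dx (beta \<epsilon> i) = xi i"
  by (simp add: beta_def pdj_mult pdj_crdj tw_def dx_xis)

lemma dxis_X: "dxis I (X * t) = X * dxis I t"
  using dxis_X_pow[of I 1 t] by simp

lemma beta_sols: "beta \<epsilon> i \<in> sols \<epsilon>"
proof -
  have "dxis UNIV (xi i) = 0"
    using dxis_xis_0[of _ UNIV "{i}"] by (cases i) (auto simp: xis_single)
  moreover have "dxis UNIV (xis (- {i})) = 0" by (rule dxis_xis_0[of i]) auto
  ultimately have 1: "dxis UNIV (beta \<epsilon> i) = 0"
    by (simp add: beta_def dxis_diff dxis_cst_mult dxis_X)
  have 2: "cst \<epsilon> * dxi j (xi i) + cst (si j) * dxis (- {j}) (beta \<epsilon> i) = 0" for j
  proof -
    obtain k where "k \<noteq> i" "k \<noteq> j" by (cases i; cases j) (use idx.distinct in metis)+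
    then have 3: "dxis (- {j}) (xi i) = 0" using dxis_xis_0[of k "- {j}" "{i}"] by (simp add: xis_single)
    show ?thesis
    proof (cases "j = i")
      case True
      have "si i * (si i * \<epsilon>) = \<epsilon>" by (cases i) (simp_all add: si_def)
      then have "cst (si i) * cst (si i * \<epsilon>) = cst \<epsilon>" by (simp only: flip: cst_mult)
      then show ?thesis using 3 True
        by (simp add: beta_def dxis_diff dxis_cst_mult dxis_X dxis_xis dxi_xi)
    next
      case False
      then have "dxis (- {j}) (xis (- {i})) = 0" by (intro dxis_xis_0[of i]) auto
      then show ?thesis using 3 False by (simp add: beta_def dxis_diff dxis_cst_mult dxis_X dxi_xi)
    qed
  qed
  have "beta \<epsilon> i \<in> base_fun" unfolding beta_def by (intro base_fun_intros base_fun_xis)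
  then show ?thesis using 1 2 by (simp add: sols_iff' dx_beta dxi_xi pdj_crdj)
qed

text \<open>One solution for each parametric derivative, normalized so that this derivative is 1;
  the factor at \<open>quad\<close> compensates its fourfold derivative -2 \<epsilon>. The pairing
  is only triangular. For instance, the cubic part of \<open>beta\<close> has second
  \<xi>-derivatives, so the pairs (1, {i}) have to come after the pairs (0, I) with \<open>I\<close>
  of size at most 2.\<close>

definition test_fun :: "complex \<Rightarrow> nat \<Rightarrow> idx set \<Rightarrow> jfun" where
  "test_fun \<epsilon> m I = (if m = 0 then (if I = UNIV then cst (- 1 / (2 * \<epsilon>)) * quad \<epsilon> else xis I)
     else if I = {} then X else beta \<epsilon> (the_elem I))"

text \<open>The order in which the coefficients of a normal form are shown to vanish.\<close>

definition test_rank :: "nat \<Rightarrow> idx set \<Rightarrow> nat" where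
  "test_rank m I = (if m = 0 then (if I = {} then 0 else Suc (card I)) else if I = {} then 1 else 4)"

lemma free_jets_cases:
  assumes "(m, I) \<in> free_jets"
  obtains "m = 0" "I \<noteq> UNIV" "card I \<le> 2" | "m = 0" "I = UNIV" | "m = 1" "I = {}" | i where "m = 1" "I = {i}"
proof -
  have 4: "card (UNIV :: idx set) = 4" by (simp add: card_idx)
  have "card I \<le> 2" if "I \<noteq> UNIV" "card I \<noteq> 3"
  proof -
    have "card I < 4" unfolding 4[symmetric] using that(1) by (intro psubset_card_mono) auto
    then show ?thesis using that by simp
  qed
  moreover have "I = {} \<or> (\<exists>i. I = {i})" if "card I \<le> 1"
    using that by (metis One_nat_def card_0_eq card_1_singletonE finite le_Suc_eq le_zero_eq)
  ultimately show ?thesis using assms that unfolding free_jets_def by fastforce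
qed

lemma test_fun_sols: "(m, I) \<in> free_jets \<Longrightarrow> test_fun \<epsilon> m I \<in> sols \<epsilon>"
  by (erule free_jets_cases)
     (auto simp: test_fun_def intro: xis_sols quad_sols X_sols beta_sols sols_cst_mult)

lemma dbase_test_fun_self:
  assumes "\<epsilon> \<noteq> 0" "(m, I) \<in> free_jets"
  shows "dbase m I (test_fun \<epsilon> m I) = 1"
  using assms(2)
proof (cases rule: free_jets_cases)
  case 2
  then show ?thesis using assms(1)
    by (simp add: dbase_def test_fun_def quad_def dxis_diff dxis_cst_mult dxis_X_X dxis_xis flip: cst_mult cst_minus)
qed (simp_all add: dbase_def test_fun_def dxis_xis dxis_empty dxis_single pdj_crdj dx_dxi dx_beta)

lemma dbase_test_fun_later:
  assumes "(m, I) \<in> free_jets" "(n, J) \<in> free_jets" "(n, J) \<noteq> (m, I)" "test_rank m I \<le> test_rank n J"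
  shows "dbase n J (test_fun \<epsilon> m I) = 0"
  using assms(1)
proof (cases rule: free_jets_cases)
  case 1
  then have t: "test_fun \<epsilon> m I = xis I" by (simp add: test_fun_def)
  show ?thesis
  proof (cases n)
    case 0
    have "\<not> J \<subseteq> I"
    proof
      assume "J \<subseteq> I"
      then have "J \<subset> I" using 0 1 assms(3) by auto
      then have "card J < card I" by (rule psubset_card_mono[rotated]) simp
      then show False using 0 1 assms(4) unfolding test_rank_def by (auto split: if_splits)
    qed
    then obtain j where "j \<in> J" "j \<notin> I" by blast
    then show ?thesis unfolding t by (simp add: dbase_def 0 dxis_xis_0)
  next
    case (Suc k)
    then show ?thesis unfolding t Suc dbase_Suc by (simp add: dx_xis dbase_0)
  qed
next
  case 2
  have "test_rank n J \<le> 4" if "J \<noteq> UNIV \<or> n \<noteq> 0"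
    using assms(2) by (cases rule: free_jets_cases) (use that in \<open>auto simp: test_rank_def\<close>)
  then have False using 2 assms(3,4) by (auto simp: test_rank_def card_idx)
  then show ?thesis ..
next
  case 3
  then have t: "test_fun \<epsilon> m I = X" by (simp add: test_fun_def)
  have "J \<noteq> {}" using assms(3,4) 3 assms(2) unfolding test_rank_def free_jets_def by (auto split: if_splits)
  then obtain j where "j \<in> J" by blast
  then have "dxis J X = 0" by (intro dxis_eq_0[of j]) (auto simp: pdj_crdj)
  then show ?thesis unfolding t by (simp add: dbase_def)
next
  case (4 i)
  then have t: "test_fun \<epsilon> m I = beta \<epsilon> i" by (simp add: test_fun_def)
  have r: "4 \<le> test_rank n J" using assms(4) 4 by (simp add: test_rank_def)
  show ?thesis
    using assms(2)
  proof (cases rule: free_jets_cases)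
    case 1
    then show ?thesis using r by (auto simp: test_rank_def split: if_splits)
  next
    case 2
    have "dxis UNIV (xi i) = 0"
      using dxis_xis_0[of _ UNIV "{i}"] by (cases i) (auto simp: xis_single)
    moreover have "dxis UNIV (xis (- {i})) = 0" by (rule dxis_xis_0[of i]) auto
    ultimately show ?thesis using 2 unfolding t
      by (simp add: dbase_def beta_def dxis_diff dxis_cst_mult dxis_X)
  next
    case 3
    then show ?thesis using r by (simp add: test_rank_def)
  next
    case (4 j)
    then have "j \<noteq> i" using assms(3) \<open>m = 1\<close> \<open>I = {i}\<close> by auto
    then show ?thesis using 4 unfolding t
      by (simp add: dbase_def dxis_single dx_dxi dx_beta dxi_xi)
  qed
qed

text \<open>Modulo the ideal, \<open>F\<close> is a combination of parametric derivatives that still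
  vanishes on all solutions. Testing it on \<open>test_fun\<close> in the order of
  \<open>test_rank\<close> removes one coefficient after the other.\<close>

lemma vanishing_imp_ideal_j:
  assumes "\<epsilon> \<noteq> 0" "lin F L" "\<And>s. s \<in> sols \<epsilon> \<Longrightarrow> L s = 0"
  shows "F \<in> ideal_j \<epsilon>"
proof -
  obtain N K where N: "nform N K" "rel \<epsilon> (F - N) (\<lambda>s. L s - K s)"
    using reducible_lin[OF assms(2,1)] unfolding reducible_def by blast
  then have K0: "K s = 0" if "s \<in> sols \<epsilon>" for s
    using assms(3)[OF that] that unfolding rel_def by auto
  obtain c where c: "N = (\<Sum>(m, I)\<in>free_jets. c m I * h m I)"
     "\<And>s. K s = (\<Sum>(m, I)\<in>free_jets. c m I * dbase m I s)"
    using N(1) unfolding nform_def by (auto simp: fun_eq_iff)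
  have z: "(m, I) \<in> free_jets \<Longrightarrow> c m I = 0" for m I
  proof (induction "test_rank m I" arbitrary: m I rule: less_induct)
    case less
    have "0 = (\<Sum>(n, J)\<in>free_jets. c n J * dbase n J (test_fun \<epsilon> m I))"
      using c(2) K0[OF test_fun_sols[OF less(2)]] by simp
    also have "\<dots> = (\<Sum>(n, J)\<in>{(m, I)}. c n J * dbase n J (test_fun \<epsilon> m I))"
    proof (intro sum.mono_neutral_right finite_free_jets ballI)
      fix x assume x: "x \<in> free_jets - {(m, I)}"
      obtain n J where nJ: "x = (n, J)" by (cases x)
      show "(case x of (n, J) \<Rightarrow> c n J * dbase n J (test_fun \<epsilon> m I)) = 0"
      proof (cases "test_rank n J < test_rank m I")
        case True
        then show ?thesis using less(1)[of n J] x nJ by simp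
      next
        case False
        then show ?thesis using dbase_test_fun_later[OF less(2), of n J \<epsilon>] x nJ by simp
      qed
    qed (use less(2) in auto)
    also have "\<dots> = c m I" using dbase_test_fun_self[OF assms(1) less(2)] by simp
    finally show ?case by simp
  qed
  have "N = 0" unfolding c(1) using z by (intro sum.neutral) auto
  then show ?thesis using N(2) unfolding rel_def by simp
qed

text \<open>A transformed generator vanishes on all solutions and hence lies in the ideal by
  \<open>vanishing_imp_ideal_j\<close>. The product rule extends this to the whole ideal; it
  requires homogeneous fields, whence the parity components of \<open>f\<close>.\<close>

lemma YF_sols_imp_symmetry:
  assumes "\<epsilon> \<noteq> 0" and f: "f \<in> base_fun" and Y: "\<And>q s. s \<in> sols \<epsilon> \<Longrightarrow> YF (part q f) s \<in> sols \<epsilon>"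
  shows "F \<in> ideal_j \<epsilon> \<Longrightarrow> vap (contact_pr f) F \<in> ideal_j \<epsilon>"
proof -
  have P: "F \<in> ideal_j \<epsilon> \<Longrightarrow> vap (contact_pr (part q f)) F \<in> ideal_j \<epsilon>" for q F
  proof (induction rule: ideal_j_induct)
    case zero
    show ?case by (simp add: vap_0 ideal_j_0)
  next
    case (step F L G K m I)
    let ?T = "(Dxj ^^ m) (Dxisj I F)" and ?L = "\<lambda>s. dbase m I (L s)"
    obtain M where M: "lin (vap (contact_pr (part q f)) ?T) M"
      "\<forall>s\<in>base_fun. M s = XF (part q f) (?L s) - tw q (?L (tw q (YF (part q f) s)))"
      using lin_vap_contact_pr[OF base_fun_part[OF f] homog_part lin_total[OF eqn_lin[OF step(1)]]] by blast
    have "M s = 0" if s: "s \<in> sols \<epsilon>" for s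
      using M(2) sols_base_fun[OF s] sols_eqn[OF s step(1)] sols_eqn[OF sols_tw[OF Y[OF s]] step(1)]
      by (simp add: dbase_0 XF_def)
    then have "vap (contact_pr (part q f)) ?T \<in> ideal_j \<epsilon>"
      by (rule vanishing_imp_ideal_j[OF assms(1) M(1)])
    then show ?case
      unfolding vap_add vap_mult[OF homog_field_contact_pr[OF homog_part]]
      using step ideal_j_gen[OF step(1)] by (intro ideal_j_add ideal_j_mult) auto
  qed
  assume "F \<in> ideal_j \<epsilon>"
  have "contact_pr f = (\<lambda>u. contact_pr (part False f) u + contact_pr (part True f) u)"
    using contact_pr_add[of "part False f" "part True f"] unfolding part_sum by (rule ext)
  then have "vap (contact_pr f) F = vap (contact_pr (part False f)) F + vap (contact_pr (part True f)) F"
    using vap_add_field by simp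
  then show ?thesis using P[OF \<open>F \<in> ideal_j \<epsilon>\<close>] ideal_j_add by simp
qed

section \<open>Components of functions on the base\<close>

definition idxs :: "bool \<Rightarrow> bool \<Rightarrow> bool \<Rightarrow> bool \<Rightarrow> idx set" where
  "idxs b1 b2 b3 b4 = {i. case i of I1 \<Rightarrow> b1 | I2 \<Rightarrow> b2 | I3 \<Rightarrow> b3 | I4 \<Rightarrow> b4}"

text \<open>Four flags replace a set of indices, so that the 16 components are enumerated by case
  splits on booleans. A base function depends on the even coordinate x alone, so a constant
  assignment serves as the point.\<close>

definition cmp :: "jfun \<Rightarrow> bool \<Rightarrow> bool \<Rightarrow> bool \<Rightarrow> bool \<Rightarrow> complex \<Rightarrow> complex" where
  "cmp f b1 b2 b3 b4 z = rep f (Cxi ` idxs b1 b2 b3 b4) (\<lambda>_. z)"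

lemma mem_idxs [simp]:
  "I1 \<in> idxs b1 b2 b3 b4 \<longleftrightarrow> b1" "I2 \<in> idxs b1 b2 b3 b4 \<longleftrightarrow> b2"
  "I3 \<in> idxs b1 b2 b3 b4 \<longleftrightarrow> b3" "I4 \<in> idxs b1 b2 b3 b4 \<longleftrightarrow> b4"
  by (simp_all add: idxs_def)

lemma idxs_eq: "idxs (I1 \<in> I) (I2 \<in> I) (I3 \<in> I) (I4 \<in> I) = I"
proof (rule set_eqI)
  show "i \<in> idxs (I1 \<in> I) (I2 \<in> I) (I3 \<in> I) (I4 \<in> I) \<longleftrightarrow> i \<in> I" for i by (cases i) simp_all
qed

lemma idxs_eq_iff: "idxs b1 b2 b3 b4 = I \<longleftrightarrow> (b1 \<longleftrightarrow> I1 \<in> I) \<and> (b2 \<longleftrightarrow> I2 \<in> I) \<and> (b3 \<longleftrightarrow> I3 \<in> I) \<and> (b4 \<longleftrightarrow> I4 \<in> I)"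
proof
  show "idxs b1 b2 b3 b4 = I \<Longrightarrow> (b1 \<longleftrightarrow> I1 \<in> I) \<and> (b2 \<longleftrightarrow> I2 \<in> I) \<and> (b3 \<longleftrightarrow> I3 \<in> I) \<and> (b4 \<longleftrightarrow> I4 \<in> I)" by auto
  show "(b1 \<longleftrightarrow> I1 \<in> I) \<and> (b2 \<longleftrightarrow> I2 \<in> I) \<and> (b3 \<longleftrightarrow> I3 \<in> I) \<and> (b4 \<longleftrightarrow> I4 \<in> I) \<Longrightarrow> idxs b1 b2 b3 b4 = I"
    using idxs_eq[of I] by simp
qed

lemma insert_idxs:
  "insert I1 (idxs b1 b2 b3 b4) = idxs True b2 b3 b4" "insert I2 (idxs b1 b2 b3 b4) = idxs b1 True b3 b4"
  "insert I3 (idxs b1 b2 b3 b4) = idxs b1 b2 True b4" "insert I4 (idxs b1 b2 b3 b4) = idxs b1 b2 b3 True"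
  by (rule sym, simp add: idxs_eq_iff)+

lemma cmp_eqI:
  assumes "f \<in> base_fun" "g \<in> base_fun" "\<And>b1 b2 b3 b4 z. cmp f b1 b2 b3 b4 z = cmp g b1 b2 b3 b4 z"
  shows "f = g"
proof (rule base_fun_eqI[OF assms(1,2)])
  show "rep f (Cxi ` I) (\<lambda>_. z) = rep g (Cxi ` I) (\<lambda>_. z)" for I z
    using assms(3)[of "I1 \<in> I" "I2 \<in> I" "I3 \<in> I" "I4 \<in> I" z] unfolding cmp_def idxs_eq .
qed

lemma cmp_add [simp]: "cmp (f + g) b1 b2 b3 b4 z = cmp f b1 b2 b3 b4 z + cmp g b1 b2 b3 b4 z"
  by (simp add: cmp_def plus_jfun.rep_eq)

lemma cmp_diff [simp]: "cmp (f - g) b1 b2 b3 b4 z = cmp f b1 b2 b3 b4 z - cmp g b1 b2 b3 b4 z"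
  by (simp add: cmp_def minus_jfun.rep_eq)

lemma cmp_minus [simp]: "cmp (- f) b1 b2 b3 b4 z = - cmp f b1 b2 b3 b4 z"
  by (simp add: cmp_def uminus_jfun.rep_eq)

lemma cmp_0 [simp]: "cmp 0 b1 b2 b3 b4 z = 0"
  by (simp add: cmp_def zero_jfun.rep_eq)

lemma cmp_cst_mult [simp]: "cmp (cst c * f) b1 b2 b3 b4 z = c * cmp f b1 b2 b3 b4 z"
  by (simp add: cmp_def times_jfun.rep_eq cst.rep_eq sprod_const_functions_J rep_functions_J)

lemma cmp_cst: "cmp (cst c) b1 b2 b3 b4 z = (if b1 \<or> b2 \<or> b3 \<or> b4 then 0 else c)"
  by (auto simp: cmp_def cst.rep_eq const_def idxs_eq_iff)

lemma cmp_X: "cmp X b1 b2 b3 b4 z = (if b1 \<or> b2 \<or> b3 \<or> b4 then 0 else z)"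
  by (auto simp: cmp_def crdj.rep_eq crd_def idxs_eq_iff)

lemma cmp_dxi_sg:
  "cmp (dxi i f) b1 b2 b3 b4 z = (if i \<in> idxs b1 b2 b3 b4 then 0
     else sg i (idxs b1 b2 b3 b4) * rep f (Cxi ` insert i (idxs b1 b2 b3 b4)) (\<lambda>_. z))"
proof -
  have "{s \<in> Cxi ` I. rank s < num i} = Cxi ` {j \<in> I. num j < num i}" for I by auto
  then have "card {s \<in> Cxi ` I. rank s < num i} = card {j \<in> I. num j < num i}" for I
    by (simp add: card_image inj_on_def)
  then show ?thesis
    by (auto simp: cmp_def pdj.rep_eq pd_def sg_def)
qed

lemma cmp_dxi:
  "cmp (dxi I1 f) b1 b2 b3 b4 z = (if b1 then 0 else cmp f True b2 b3 b4 z)"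
  "cmp (dxi I2 f) b1 b2 b3 b4 z = (if b2 then 0 else (if b1 then -1 else 1) * cmp f b1 True b3 b4 z)"
  "cmp (dxi I3 f) b1 b2 b3 b4 z = (if b3 then 0 else (if b1 then -1 else 1) * (if b2 then -1 else 1) * cmp f b1 b2 True b4 z)"
  "cmp (dxi I4 f) b1 b2 b3 b4 z = (if b4 then 0 else (if b1 then -1 else 1) * (if b2 then -1 else 1) * (if b3 then -1 else 1) * cmp f b1 b2 b3 True z)"
  unfolding cmp_dxi_sg insert_idxs sg_eq by (simp_all add: cmp_def)

lemma cmp_inv_j: "cmp (inv_j f) b1 b2 b3 b4 z =
    (if b1 then -1 else 1) * (if b2 then -1 else 1) * (if b3 then -1 else 1) * (if b4 then -1 else 1) * cmp f b1 b2 b3 b4 z"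
proof -
  have "card (Cxi ` I) = card I" for I by (simp add: card_image inj_on_def)
  then show ?thesis
    by (simp add: cmp_def inv_j.rep_eq invol_def card_idx)
qed

lemma cmp_mult_empty: "cmp (f * g) False False False False z = cmp f False False False False z * cmp g False False False False z"
proof -
  have "idxs False False False False = {}" by (simp add: idxs_eq_iff)
  then show ?thesis by (simp add: cmp_def times_jfun.rep_eq sprod_def)
qed

text \<open>The component at a monomial with smallest index i is a component of the
  \<xi>_i-derivative, to which the product rule applies. As rewrite rules these equations expand
  every component of a product.\<close>

lemma cmp_mult:
  "cmp (f * g) True b2 b3 b4 z = cmp (dxi I1 f * g) False b2 b3 b4 z + cmp (inv_j f * dxi I1 g) False b2 b3 b4 z"
  "cmp (f * g) False True b3 b4 z = cmp (dxi I2 f * g) False False b3 b4 z + cmp (inv_j f * dxi I2 g) False False b3 b4 z"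
  "cmp (f * g) False False True b4 z = cmp (dxi I3 f * g) False False False b4 z + cmp (inv_j f * dxi I3 g) False False False b4 z"
  "cmp (f * g) False False False True z = cmp (dxi I4 f * g) False False False False z + cmp (inv_j f * dxi I4 g) False False False False z"
proof -
  have e: "dxi i (f * g) = dxi i f * g + inv_j f * dxi i g" for i by (simp add: pdj_mult tw_def)
  show "cmp (f * g) True b2 b3 b4 z = cmp (dxi I1 f * g) False b2 b3 b4 z + cmp (inv_j f * dxi I1 g) False b2 b3 b4 z"
    unfolding cmp_add[symmetric] e[symmetric] cmp_dxi by simp
  show "cmp (f * g) False True b3 b4 z = cmp (dxi I2 f * g) False False b3 b4 z + cmp (inv_j f * dxi I2 g) False False b3 b4 z"
    unfolding cmp_add[symmetric] e[symmetric] cmp_dxi by simp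
  show "cmp (f * g) False False True b4 z = cmp (dxi I3 f * g) False False False b4 z + cmp (inv_j f * dxi I3 g) False False False b4 z"
    unfolding cmp_add[symmetric] e[symmetric] cmp_dxi by simp
  show "cmp (f * g) False False False True z = cmp (dxi I4 f * g) False False False False z + cmp (inv_j f * dxi I4 g) False False False False z"
    unfolding cmp_add[symmetric] e[symmetric] cmp_dxi by simp
qed

lemma cmp_xi: "cmp (xi i) b1 b2 b3 b4 z = (if idxs b1 b2 b3 b4 = {i} then 1 else 0)"
  by (auto simp: cmp_def crdj.rep_eq crd_def dest: injD[OF _ sym, rotated])

lemma cmp_xi_mult:
  "cmp (xi I1 * f) b1 b2 b3 b4 z = (if b1 then cmp f False b2 b3 b4 z else 0)"
  "cmp (xi I2 * f) b1 b2 b3 b4 z = (if b2 then (if b1 then -1 else 1) * cmp f b1 False b3 b4 z else 0)"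
  "cmp (xi I3 * f) b1 b2 b3 b4 z = (if b3 then (if b1 then -1 else 1) * (if b2 then -1 else 1) * cmp f b1 b2 False b4 z else 0)"
  "cmp (xi I4 * f) b1 b2 b3 b4 z = (if b4 then (if b1 then -1 else 1) * (if b2 then -1 else 1) * (if b3 then -1 else 1) * cmp f b1 b2 b3 False z else 0)"
  by (cases b1; cases b2; cases b3; cases b4;
      simp add: cmp_mult cmp_mult_empty cmp_dxi cmp_inv_j cmp_xi idxs_eq_iff)+

lemma cmp_has_derivative:
  "f \<in> base_fun \<Longrightarrow> ((\<lambda>w. cmp f b1 b2 b3 b4 w) has_field_derivative cmp (dx f) b1 b2 b3 b4 z) (at z)"
proof -
  assume f: "f \<in> base_fun"
  let ?S = "Cxi ` idxs b1 b2 b3 b4"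
  have "rep f ?S (\<lambda>_. w) = rep f ?S ((\<lambda>_. z)(Cx := w))" for w
    by (rule base_fun_rep_cong[OF f]) simp
  moreover have "entire_in {u \<in> base_coords. \<not> odd_coord u} (rep f ?S)"
    using f unfolding base_fun_def functions_M_def by (auto intro: superfuns_entire)
  from entire_in_has_derivative[OF this, of "\<lambda>_. z" Cx]
  have "((\<lambda>w. rep f ?S ((\<lambda>_. z)(Cx := w))) has_field_derivative even_pd Cx (rep f ?S) (\<lambda>_. z)) (at z)" by simp
  ultimately show ?thesis by (simp add: cmp_def pdj.rep_eq pd_def)
qed

section \<open>The solution space\<close>

text \<open>The general solution, with 3 + 6 even and 4 + 4 odd parameters; of \<open>m\<close> only
  the entries above the diagonal enter.\<close>

definition sol :: "complex \<Rightarrow> complex \<Rightarrow> complex \<Rightarrow> complex \<Rightarrow> (idx \<Rightarrow> complex) \<Rightarrow> (idx \<Rightarrow> complex) \<Rightarrow>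
    (idx \<Rightarrow> idx \<Rightarrow> complex) \<Rightarrow> jfun" where
  "sol \<epsilon> c0 c1 c2 a b m = cst c0 + cst c1 * X + cst c2 * quad \<epsilon> +
    (\<Sum>i\<in>UNIV. cst (a i) * xi i) + (\<Sum>i\<in>UNIV. cst (b i) * beta \<epsilon> i) +
    cst (m I1 I2) * (xi I1 * xi I2) + cst (m I1 I3) * (xi I1 * xi I3) + cst (m I1 I4) * (xi I1 * xi I4) +
    cst (m I2 I3) * (xi I2 * xi I3) + cst (m I2 I4) * (xi I2 * xi I4) + cst (m I3 I4) * (xi I3 * xi I4)"

lemma cmp_X_mult: "cmp (X * f) b1 b2 b3 b4 z = z * cmp f b1 b2 b3 b4 z"
  by (cases b1; cases b2; cases b3; cases b4)
     (simp_all add: cmp_mult cmp_mult_empty cmp_dxi cmp_inv_j cmp_X)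

lemma cmp_sol:
  "cmp (sol \<epsilon> c0 c1 c2 a b m) False False False False z = c0 + c1 * z + c2 * z^2"
  "cmp (sol \<epsilon> c0 c1 c2 a b m) True False False False z = a I1 + b I1 * z"
  "cmp (sol \<epsilon> c0 c1 c2 a b m) False True False False z = a I2 + b I2 * z"
  "cmp (sol \<epsilon> c0 c1 c2 a b m) False False True False z = a I3 + b I3 * z"
  "cmp (sol \<epsilon> c0 c1 c2 a b m) False False False True z = a I4 + b I4 * z"
  "cmp (sol \<epsilon> c0 c1 c2 a b m) True True False False z = m I1 I2"
  "cmp (sol \<epsilon> c0 c1 c2 a b m) True False True False z = m I1 I3"
  "cmp (sol \<epsilon> c0 c1 c2 a b m) True False False True z = m I1 I4"
  "cmp (sol \<epsilon> c0 c1 c2 a b m) False True True False z = m I2 I3"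
  "cmp (sol \<epsilon> c0 c1 c2 a b m) False True False True z = m I2 I4"
  "cmp (sol \<epsilon> c0 c1 c2 a b m) False False True True z = m I3 I4"
  "cmp (sol \<epsilon> c0 c1 c2 a b m) False True True True z = \<epsilon> * b I1"
  "cmp (sol \<epsilon> c0 c1 c2 a b m) True False True True z = - \<epsilon> * b I2"
  "cmp (sol \<epsilon> c0 c1 c2 a b m) True True False True z = \<epsilon> * b I3"
  "cmp (sol \<epsilon> c0 c1 c2 a b m) True True True False z = - \<epsilon> * b I4"
  "cmp (sol \<epsilon> c0 c1 c2 a b m) True True True True z = - 2 * \<epsilon> * c2"
  by (simp_all add: sol_def quad_def beta_def sum_idx xis_eq si_def cmp_cst cmp_X cmp_X_mult cmp_xi_mult cmp_xi
      idxs_eq_iff power2_eq_square algebra_simps)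

lemma dx_quad: "dx (quad \<epsilon>) = X + X"
  by (simp add: quad_def dx_xis pdj_mult pdj_crdj tw_def)

lemma cmp_dx_sol: "cmp (dx (sol \<epsilon> c0 c1 c2 a b m)) b1 b2 b3 b4 z =
    (if idxs b1 b2 b3 b4 = {} then c1 + 2 * c2 * z else 0) + (\<Sum>i\<in>UNIV. if idxs b1 b2 b3 b4 = {i} then b i else 0)"
  by (simp add: sol_def sum_idx dx_quad dx_beta pdj_mult pdj_crdj cmp_xi cmp_X cmp_cst idxs_eq_iff tw_def algebra_simps)

lemma sol_sols: "sol \<epsilon> c0 c1 c2 a b m \<in> sols \<epsilon>"
proof -
  have 1: "1 \<in> sols \<epsilon>" using xis_sols[of "{}" \<epsilon>] by (simp add: xis_eq UNIV_idx)
  have xi: "xi i \<in> sols \<epsilon>" for i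
    using xis_sols[of "{i}" \<epsilon>] unfolding xis_single by (simp add: UNIV_idx card_idx)
  have xx: "xi i * xi j \<in> sols \<epsilon>" if "num i < num j" for i j
  proof -
    have "xis {i, j} = xi j * xi i" using that by (cases i; cases j) (simp_all add: xis_eq)
    moreover have "xis {i, j} \<in> sols \<epsilon>"
      by (rule xis_sols) (cases i; cases j; use that in \<open>auto simp: UNIV_idx\<close>)+
    ultimately show ?thesis using sols_minus[of "xi j * xi i" \<epsilon>] xi_swap[of i j] by simp
  qed
  have "cst c0 \<in> sols \<epsilon>" using sols_cst_mult[OF 1, of c0] by simp
  then show ?thesis
    unfolding sol_def sum_idx
    by (intro sols_add sols_cst_mult X_sols quad_sols beta_sols xi xx) simp_all
qed

section \<open>The contact bracket of two solutions\<close>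

lemma cmp_prod:
  "cmp (f * g) False False False False z = cmp f False False False False z * cmp g False False False False z"
  "cmp (f * g) True False False False z = cmp f False False False False z * cmp g True False False False z +
     cmp f True False False False z * cmp g False False False False z"
  "cmp (f * g) False True False False z = cmp f False False False False z * cmp g False True False False z +
     cmp f False True False False z * cmp g False False False False z"
  "cmp (f * g) False False True False z = cmp f False False False False z * cmp g False False True False z +
     cmp f False False True False z * cmp g False False False False z"
  "cmp (f * g) False False False True z = cmp f False False False False z * cmp g False False False True z +
     cmp f False False False True z * cmp g False False False False z"
  "cmp (f * g) True True False False z = cmp f False False False False z * cmp g True True False False z + cmp
     f True False False False z * cmp g False True False False z - cmp f False True False False z * cmp g
     True False False False z + cmp f True True False False z * cmp g False False False False z"
  "cmp (f * g) True False True False z = cmp f False False False False z * cmp g True False True False z + cmp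
     f True False False False z * cmp g False False True False z - cmp f False False True False z * cmp g
     True False False False z + cmp f True False True False z * cmp g False False False False z"
  "cmp (f * g) True False False True z = cmp f False False False False z * cmp g True False False True z + cmp
     f True False False False z * cmp g False False False True z - cmp f False False False True z * cmp g
     True False False False z + cmp f True False False True z * cmp g False False False False z"
  "cmp (f * g) False True True False z = cmp f False False False False z * cmp g False True True False z + cmp
     f False True False False z * cmp g False False True False z - cmp f False False True False z * cmp g
     False True False False z + cmp f False True True False z * cmp g False False False False z"
  "cmp (f * g) False True False True z = cmp f False False False False z * cmp g False True False True z + cmp
     f False True False False z * cmp g False False False True z - cmp f False False False True z * cmp g
     False True False False z + cmp f False True False True z * cmp g False False False False z"
  "cmp (f * g) False False True True z = cmp f False False False False z * cmp g False False True True z + cmp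
     f False False True False z * cmp g False False False True z - cmp f False False False True z * cmp g
     False False True False z + cmp f False False True True z * cmp g False False False False z"
  "cmp (f * g) True True True False z = cmp f False False False False z * cmp g True True True False z + cmp f
     True False False False z * cmp g False True True False z - cmp f False True False False z * cmp g True
     False True False z + cmp f False False True False z * cmp g True True False False z + cmp f True True
     False False z * cmp g False False True False z - cmp f True False True False z * cmp g False True False
     False z + cmp f False True True False z * cmp g True False False False z + cmp f True True True False z
     * cmp g False False False False z"
  "cmp (f * g) True True False True z = cmp f False False False False z * cmp g True True False True z + cmp f
     True False False False z * cmp g False True False True z - cmp f False True False False z * cmp g True
     False False True z + cmp f False False False True z * cmp g True True False False z + cmp f True True
     False False z * cmp g False False False True z - cmp f True False False True z * cmp g False True False
     False z + cmp f False True False True z * cmp g True False False False z + cmp f True True False True z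
     * cmp g False False False False z"
  "cmp (f * g) True False True True z = cmp f False False False False z * cmp g True False True True z + cmp f
     True False False False z * cmp g False False True True z - cmp f False False True False z * cmp g True
     False False True z + cmp f False False False True z * cmp g True False True False z + cmp f True False
     True False z * cmp g False False False True z - cmp f True False False True z * cmp g False False True
     False z + cmp f False False True True z * cmp g True False False False z + cmp f True False True True z
     * cmp g False False False False z"
  "cmp (f * g) False True True True z = cmp f False False False False z * cmp g False True True True z + cmp f
     False True False False z * cmp g False False True True z - cmp f False False True False z * cmp g False
     True False True z + cmp f False False False True z * cmp g False True True False z + cmp f False True
     True False z * cmp g False False False True z - cmp f False True False True z * cmp g False False True
     False z + cmp f False False True True z * cmp g False True False False z + cmp f False True True True z
     * cmp g False False False False z"
  "cmp (f * g) True True True True z = cmp f False False False False z * cmp g True True True True z + cmp f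
     True False False False z * cmp g False True True True z - cmp f False True False False z * cmp g True
     False True True z + cmp f False False True False z * cmp g True True False True z - cmp f False False
     False True z * cmp g True True True False z + cmp f True True False False z * cmp g False False True
     True z - cmp f True False True False z * cmp g False True False True z + cmp f True False False True z
     * cmp g False True True False z + cmp f False True True False z * cmp g True False False True z - cmp f
     False True False True z * cmp g True False True False z + cmp f False False True True z * cmp g True
     True False False z + cmp f True True True False z * cmp g False False False True z - cmp f True True
     False True z * cmp g False False True False z + cmp f True False True True z * cmp g False True False
     False z - cmp f False True True True z * cmp g True False False False z + cmp f True True True True z *
     cmp g False False False False z"
  by (simp_all add: cmp_mult cmp_mult_empty cmp_dxi cmp_inv_j algebra_simps)

lemma cmp_Dc:
  "cmp (Dc I1 f) b1 b2 b3 b4 z = (if b1 then cmp (dx f) False b2 b3 b4 z else cmp f True b2 b3 b4 z)"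
  "cmp (Dc I2 f) b1 b2 b3 b4 z = (if b1 then -1 else 1) * (if b2 then cmp (dx f) b1 False b3 b4 z else cmp f b1 True b3 b4 z)"
  "cmp (Dc I3 f) b1 b2 b3 b4 z = (if b1 then -1 else 1) * (if b2 then -1 else 1) *
     (if b3 then cmp (dx f) b1 b2 False b4 z else cmp f b1 b2 True b4 z)"
  "cmp (Dc I4 f) b1 b2 b3 b4 z = (if b1 then -1 else 1) * (if b2 then -1 else 1) * (if b3 then -1 else 1) *
     (if b4 then cmp (dx f) b1 b2 b3 False z else cmp f b1 b2 b3 True z)"
  by (simp_all add: Dc_def cmp_dxi cmp_xi_mult)

lemma Dc_inv_j: "Dc j (inv_j f) = - inv_j (Dc j f)"
  by (simp add: Dc_def inv_j_pdj)

lemma cmp_YF: "2 * cmp (YF f g) b1 b2 b3 b4 z = 2 * cmp (f * dx g) b1 b2 b3 b4 z - 2 * cmp (dx f * g) b1 b2 b3 b4 z -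
    (cmp (inv_j (Dc I1 f) * Dc I1 g) b1 b2 b3 b4 z + cmp (inv_j (Dc I2 f) * Dc I2 g) b1 b2 b3 b4 z +
     cmp (inv_j (Dc I3 f) * Dc I3 g) b1 b2 b3 b4 z + cmp (inv_j (Dc I4 f) * Dc I4 g) b1 b2 b3 b4 z)"
  by (simp add: YF_def XF_def Dc_inv_j sum_idx)

lemma cmp_dx_sol_table:
  "cmp (dx (sol \<epsilon> c0 c1 c2 a b m)) False False False False z = c1 + 2 * c2 * z"
  "cmp (dx (sol \<epsilon> c0 c1 c2 a b m)) True False False False z = b I1"
  "cmp (dx (sol \<epsilon> c0 c1 c2 a b m)) False True False False z = b I2"
  "cmp (dx (sol \<epsilon> c0 c1 c2 a b m)) False False True False z = b I3"
  "cmp (dx (sol \<epsilon> c0 c1 c2 a b m)) False False False True z = b I4"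
  "cmp (dx (sol \<epsilon> c0 c1 c2 a b m)) True True b3 b4 z = 0"
  "cmp (dx (sol \<epsilon> c0 c1 c2 a b m)) True b2 True b4 z = 0"
  "cmp (dx (sol \<epsilon> c0 c1 c2 a b m)) True b2 b3 True z = 0"
  "cmp (dx (sol \<epsilon> c0 c1 c2 a b m)) b1 True True b4 z = 0"
  "cmp (dx (sol \<epsilon> c0 c1 c2 a b m)) b1 True b3 True z = 0"
  "cmp (dx (sol \<epsilon> c0 c1 c2 a b m)) b1 b2 True True z = 0"
  by (simp_all add: cmp_dx_sol sum_idx idxs_eq_iff)

text \<open>The antisymmetric matrix determined by the entries of \<open>m\<close> above the
  diagonal, that is, an element of so_4.\<close>

definition asym :: "(idx \<Rightarrow> idx \<Rightarrow> complex) \<Rightarrow> idx \<Rightarrow> idx \<Rightarrow> complex" where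
  "asym m i j = (if num i < num j then m i j else if num j < num i then - m j i else 0)"

text \<open>The Hodge star on antisymmetric matrices of size 4, given above the diagonal
  only.\<close>

definition dual :: "(idx \<Rightarrow> idx \<Rightarrow> complex) \<Rightarrow> idx \<Rightarrow> idx \<Rightarrow> complex" where
  "dual w i j = (case (i, j) of (I1, I2) \<Rightarrow> w I3 I4 | (I1, I3) \<Rightarrow> - w I2 I4 | (I1, I4) \<Rightarrow> w I2 I3
     | (I2, I3) \<Rightarrow> w I1 I4 | (I2, I4) \<Rightarrow> - w I1 I3 | (I3, I4) \<Rightarrow> w I1 I2 | _ \<Rightarrow> 0)"

text \<open>The structure constants of the symmetry algebra. The right side is again of the form
  \<open>sol\<close>, so the solutions are closed under the contact bracket. The Hodge dual with
  factor \<epsilon> stems from the cubic parts of \<open>beta\<close>.\<close>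

lemma YF_sol:
  "YF (sol \<epsilon> c0 c1 c2 a b m) (sol \<epsilon> d0 d1 d2 e f n) = sol \<epsilon>
    (c0 * d1 - c1 * d0 - (\<Sum>i\<in>UNIV. a i * e i) / 2)
    (2 * c0 * d2 - 2 * c2 * d0 - (\<Sum>i\<in>UNIV. a i * f i + b i * e i) / 2)
    (c1 * d2 - c2 * d1 - (\<Sum>i\<in>UNIV. b i * f i) / 2)
    (\<lambda>i. c0 * f i - c1 * e i / 2 + a i * d1 / 2 - b i * d0 + (\<Sum>j\<in>UNIV. a j * asym n i j - asym m i j * e j) / 2)
    (\<lambda>i. c1 * f i / 2 - c2 * e i + a i * d2 - b i * d1 / 2 + (\<Sum>j\<in>UNIV. b j * asym n i j - asym m i j * f j) / 2)
    (\<lambda>i j. (a i * f j - a j * f i - b i * e j + b j * e i + \<epsilon> * dual (\<lambda>i j. a i * f j - a j * f i - b i * e j + b j * e i) i j +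
       (\<Sum>k\<in>UNIV. asym m i k * asym n j k - asym m j k * asym n i k)) / 2)"
  (is "YF ?f ?g = ?h")
proof (rule cmp_eqI)
  show "YF ?f ?g \<in> base_fun" "?h \<in> base_fun"
    by (intro base_fun_YF sols_base_fun[OF sol_sols])+
  note s = cmp_YF cmp_prod cmp_Dc cmp_inv_j cmp_dx_sol_table cmp_sol if_True if_False simp_thms
    mult_1_left mult_1_right mult_zero_left mult_zero_right add_0_left add_0_right diff_zero
    mult_minus1 mult_minus_left mult_minus_right minus_zero minus_minus diff_0 diff_0_right
  fix b1 b2 b3 b4 z
  have "2 * cmp (YF ?f ?g) b1 b2 b3 b4 z = 2 * cmp ?h b1 b2 b3 b4 z"
    by (cases b1; cases b2; cases b3; cases b4;
        simp only: s; simp add: asym_def dual_def sum_idx power2_eq_square; (simp add: field_simps)?)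
  then show "cmp (YF ?f ?g) b1 b2 b3 b4 z = cmp ?h b1 b2 b3 b4 z" by simp
qed

section \<open>Every solution has the explicit form\<close>

lemma const_if_derivative_0:
  fixes \<phi> :: "complex \<Rightarrow> complex"
  assumes "\<And>z. (\<phi> has_field_derivative 0) (at z)"
  shows "\<phi> z = \<phi> 0"
  using has_field_derivative_zero_constant[of UNIV \<phi>] assms by auto

lemma quadratic_if_derivative:
  fixes \<phi> :: "complex \<Rightarrow> complex"
  assumes "\<And>z. (\<phi> has_field_derivative p + q * z) (at z)"
  shows "\<phi> z = \<phi> 0 + p * z + q / 2 * z^2"
proof -
  have "((\<lambda>z. \<phi> z - (p * z + q / 2 * z^2)) has_field_derivative 0) (at z)" for z
    by (rule derivative_eq_intros assms refl | simp)+
  from const_if_derivative_0[OF this, of z] show ?thesis by (simp add: algebra_simps)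
qed

lemma quadratic_eq_0:
  fixes p q r :: complex
  assumes "\<And>z. p + q * z + r * z^2 = 0"
  shows "p = 0" "q = 0" "r = 0"
proof -
  show p: "p = 0" using assms[of 0] by simp
  have "q + r = 0" "- q + r = 0" using assms[of 1] assms[of "- 1"] p by simp_all
  then have "r + r = 0" "q = - r" by (simp_all add: algebra_simps eq_neg_iff_add_eq_0)
  then show "q = 0" "r = 0" by simp_all
qed

text \<open>The third equation makes all components of \<xi>-degree at least 2 constant. Then the
  first equation makes the body quadratic with leading coefficient fixed by the top component, and
  the second makes the components of degree 1 affine with slopes fixed by those of degree 3.\<close>

lemma sols_imp_sol:
  assumes "\<epsilon> \<noteq> 0" and f: "f \<in> sols \<epsilon>"
  shows "\<exists>c0 c1 c2 a b m. f = sol \<epsilon> c0 c1 c2 a b m"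
proof -
  have fb: "f \<in> base_fun" "dx f \<in> base_fun" "dx (dx f) \<in> base_fun"
    using sols_base_fun[OF f] by (auto intro: base_fun_pdj)
  have e0: "cst \<epsilon> * dx (dx f) + dxis UNIV f = 0"
    and e1: "\<And>i. xi i * (cst \<epsilon> * dxi i (dx f) + cst (si i) * dxis (- {i}) f) = 0"
    and e2: "\<And>i j. dxi i (dxi j (dx f)) = 0"
    using f unfolding sols_iff' by blast+
  note D = cmp_has_derivative[OF fb(1)] and DD = cmp_has_derivative[OF fb(2)]
  have c0: "cmp (cst \<epsilon> * dx (dx f) + dxis UNIV f) b1 b2 b3 b4 z = 0" for b1 b2 b3 b4 z unfolding e0 by simp
  have c1: "cmp (xi i * (cst \<epsilon> * dxi i (dx f) + cst (si i) * dxis (- {i}) f)) b1 b2 b3 b4 z = 0" for i b1 b2 b3 b4 z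
    unfolding e1 by simp
  have c2: "cmp (dxi i (dxi j (dx f))) b1 b2 b3 b4 z = 0" for i j b1 b2 b3 b4 z unfolding e2 by simp
  have nz: "(if b then - 1 else 1 :: complex) \<noteq> 0" for b by simp
  \<comment> \<open>A component with two or more \<xi>_i is also a component, up to sign, of a
    second \<xi>-derivative, and these vanish for f_x.\<close>
  have z: "cmp (dx f) True True b3 b4 z = 0" "cmp (dx f) True b2 True b4 z = 0" "cmp (dx f) True b2 b3 True z = 0"
    "cmp (dx f) b1 True True b4 z = 0" "cmp (dx f) b1 True b3 True z = 0" "cmp (dx f) b1 b2 True True z = 0" for b1 b2 b3 b4 z
    using c2[of I2 I1 False False b3 b4] c2[of I3 I1 False b2 False b4] c2[of I4 I1 False b2 b3 False]
      c2[of I3 I2 b1 False False b4] c2[of I4 I2 b1 False b3 False] c2[of I4 I3 b1 b2 False False]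
    by (auto simp: cmp_dxi nz)
  have const: "cmp f True True b3 b4 z = cmp f True True b3 b4 0" "cmp f True b2 True b4 z = cmp f True b2 True b4 0"
    "cmp f True b2 b3 True z = cmp f True b2 b3 True 0" "cmp f b1 True True b4 z = cmp f b1 True True b4 0"
    "cmp f b1 True b3 True z = cmp f b1 True b3 True 0" "cmp f b1 b2 True True z = cmp f b1 b2 True True 0" for b1 b2 b3 b4 z
    by (rule const_if_derivative_0, metis D z)+
  note s = cmp_dxi cmp_xi_mult si_def dxis_eq
  define \<nu> where "\<nu> = cmp f True True True True 0"
  have q0: "cmp (dx (dx f)) False False False False z = - \<nu> / \<epsilon>" for z
    using c0[of False False False False z] const(1)[of True True z] assms(1)
    by (simp add: s \<nu>_def field_simps eq_neg_iff_add_eq_0)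
  define \<kappa> where "\<kappa> = cmp (dx f) False False False False 0"
  have 1: "cmp f False False False False z = cmp f False False False False 0 + \<kappa> * z
      + (- \<nu> / \<epsilon>) / 2 * z^2" for z
  proof (rule quadratic_if_derivative[of "cmp f False False False False"])
    have "cmp (dx f) False False False False z = \<kappa> + (- \<nu> / \<epsilon>) * z + 0 / 2 * z^2" for z
      unfolding \<kappa>_def by (rule quadratic_if_derivative[of "cmp (dx f) False False False False"]) (use DD[of False False False False] q0 in simp)
    then show "(cmp f False False False False has_field_derivative \<kappa> + - \<nu> / \<epsilon> * z) (at z)" for z
      using D[of False False False False z] by simp
  qed
  have lin: "cmp f b1 b2 b3 b4 z = cmp f b1 b2 b3 b4 0 + b * z"
    if "\<And>z. \<epsilon> * cmp (dx f) b1 b2 b3 b4 z = \<epsilon> * b" for b1 b2 b3 b4 b z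
  proof -
    have "cmp f b1 b2 b3 b4 z = cmp f b1 b2 b3 b4 0 + b * z + 0 / 2 * z^2"
      by (rule quadratic_if_derivative[of "cmp f b1 b2 b3 b4"]) (use D[of b1 b2 b3 b4] that assms(1) in simp)
    then show ?thesis by simp
  qed
  define b where "b i = (case i of I1 \<Rightarrow> cmp f False True True True 0 / \<epsilon> | I2 \<Rightarrow> - cmp f True False True True 0 / \<epsilon>
     | I3 \<Rightarrow> cmp f True True False True 0 / \<epsilon> | I4 \<Rightarrow> - cmp f True True True False 0 / \<epsilon>)" for i
  have t: "cmp f False True True True z = \<epsilon> * b I1" "cmp f True False True True z = - \<epsilon> * b I2"
    "cmp f True True False True z = \<epsilon> * b I3" "cmp f True True True False z = - \<epsilon> * b I4" for z
    using const(4)[of False True z] const(2)[of False True z] const(1)[of False True z] const(1)[of True False z] assms(1)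
    by (simp_all add: b_def)
  have l: "cmp f True False False False z = cmp f True False False False 0 + b I1 * z"
    "cmp f False True False False z = cmp f False True False False 0 + b I2 * z"
    "cmp f False False True False z = cmp f False False True False 0 + b I3 * z"
    "cmp f False False False True z = cmp f False False False True 0 + b I4 * z" for z
    by (rule lin, use c1[of I1 True False False False] c1[of I2 False True False False]
          c1[of I3 False False True False] c1[of I4 False False False True] t in \<open>simp add: s\<close>)+
  define a where "a i = (case i of I1 \<Rightarrow> cmp f True False False False 0 | I2 \<Rightarrow> cmp f False True False False 0
     | I3 \<Rightarrow> cmp f False False True False 0 | I4 \<Rightarrow> cmp f False False False True 0)" for i
  define m where "m i j = (let I = {i, j} in cmp f (I1 \<in> I) (I2 \<in> I) (I3 \<in> I) (I4 \<in> I) 0)" for i j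
  have "f = sol \<epsilon> (cmp f False False False False 0) \<kappa> (- \<nu> / \<epsilon> / 2) a b m"
  proof (rule cmp_eqI[OF fb(1) sols_base_fun[OF sol_sols]])
    fix b1 b2 b3 b4 z
    note const' = const(1)[of False False z] const(2)[of False False z] const(3)[of False False z]
      const(4)[of False False z] const(5)[of False False z] const(6)[of False False z] const(1)[of True True z]
    show "cmp f b1 b2 b3 b4 z = cmp (sol \<epsilon> (cmp f False False False False 0) \<kappa> (- \<nu> / \<epsilon> / 2) a b m) b1 b2 b3 b4 z"
      using const' 1[of z] l[of z] t[of z] assms(1)
      by (cases b1; cases b2; cases b3; cases b4) (simp_all add: cmp_sol a_def m_def \<nu>_def Let_def)
  qed
  then show ?thesis by blast
qed

section \<open>Recovering the generating function from its brackets with 1 and x\<close>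

lemma YF_1: "YF f 1 = - dx f"
  by (simp add: YF_def XF_def Dc_def)

text \<open>X_x is the Euler field in which x has weight 1 and each \<xi>_i has weight 1/2; up to
  sign the bracket with x subtracts \<open>f\<close> from its image under this field.\<close>

lemma cmp_YF_X: "cmp (YF f X) b1 b2 b3 b4 z =
    (1 - (of_bool b1 + of_bool b2 + of_bool b3 + of_bool b4) / 2) * cmp f b1 b2 b3 b4 z - z * cmp (dx f) b1 b2 b3 b4 z"
proof -
  have "Dc j X = xi j" for j by (simp add: Dc_def pdj_crdj)
  then show ?thesis
    by (cases b1; cases b2; cases b3; cases b4)
       (simp_all add: YF_def XF_def sum_idx Dc_def[of _ "inv_j f"] cmp_mult cmp_mult_empty cmp_dxi cmp_inv_j cmp_xi_mult
          cmp_xi cmp_X cmp_cst pdj_crdj idxs_eq_iff algebra_simps)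
qed

text \<open>The first hypothesis makes f_x a solution, so each component of \<open>f\<close> is
  known up to an integration constant. The second one is an Euler relation that expresses the
  components by another solution. Comparing powers of z removes the surplus parameters of f_x and
  fixes the coefficients that a solution ties together.\<close>

lemma sols_if_YF_sols:
  assumes "\<epsilon> \<noteq> 0" and f: "f \<in> base_fun" and 1: "YF f 1 \<in> sols \<epsilon>" and X: "YF f X \<in> sols \<epsilon>"
  shows "f \<in> sols \<epsilon>"
proof -
  have "dx f \<in> sols \<epsilon>" using sols_minus[OF 1] by (simp add: YF_1)
  then obtain c0 c1 c2 a b m where dxf: "dx f = sol \<epsilon> c0 c1 c2 a b m" using sols_imp_sol[OF assms(1)] by blast
  obtain d0 d1 d2 e g n where YfX: "YF f X = sol \<epsilon> d0 d1 d2 e g n" using sols_imp_sol[OF assms(1) X] by blast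
  note D = cmp_has_derivative[OF f, unfolded dxf]
  note R = cmp_YF_X[of f, unfolded dxf YfX]
  \<comment> \<open>In \<xi>-degree 2 the Euler weight 1 - 2/2 vanishes, so the relation reads
    \<open>n i j = - z * m i j\<close> for every z.\<close>
  have pair: "m i j = 0 \<and> (\<forall>z. cmp f b1 b2 b3 b4 z = cmp f b1 b2 b3 b4 0)"
    if "\<And>z. cmp (sol \<epsilon> c0 c1 c2 a b m) b1 b2 b3 b4 z = m i j" "\<And>z. n i j = - z * m i j" for b1 b2 b3 b4 i j
  proof
    show m: "m i j = 0" using that(2)[of 0] that(2)[of 1] by simp
    show "\<forall>z. cmp f b1 b2 b3 b4 z = cmp f b1 b2 b3 b4 0"
      using D[of b1 b2 b3 b4] unfolding that(1) m by (intro allI const_if_derivative_0)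
  qed
  note p = R[of True True False False] R[of True False True False] R[of True False False True]
    R[of False True True False] R[of False True False True] R[of False False True True]
  have p12: "\<And>z. cmp f True True False False z = cmp f True True False False 0"
    using pair[of True True False False I1 I2] p(1) by (simp add: cmp_sol)
  have p13: "\<And>z. cmp f True False True False z = cmp f True False True False 0"
    using pair[of True False True False I1 I3] p(2) by (simp add: cmp_sol)
  have p14: "\<And>z. cmp f True False False True z = cmp f True False False True 0"
    using pair[of True False False True I1 I4] p(3) by (simp add: cmp_sol)
  have p23: "\<And>z. cmp f False True True False z = cmp f False True True False 0"
    using pair[of False True True False I2 I3] p(4) by (simp add: cmp_sol)
  have p24: "\<And>z. cmp f False True False True z = cmp f False True False True 0"
    using pair[of False True False True I2 I4] p(5) by (simp add: cmp_sol)
  have p34: "\<And>z. cmp f False False True True z = cmp f False False True True 0"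
    using pair[of False False True True I3 I4] p(6) by (simp add: cmp_sol)
  have U: "cmp f True True True True z = 2 * \<epsilon> * d2 + 2 * \<epsilon> * c2 * z" for z
    using R[of True True True True z] by (simp add: cmp_sol algebra_simps)
  \<comment> \<open>The top component has slope \<open>2 * \<epsilon> * c2\<close> by the Euler
    relation and \<open>- 2 * \<epsilon> * c2\<close> by the form of f_x.\<close>
  have c2: "c2 = 0"
  proof -
    have "((\<lambda>z. 2 * \<epsilon> * d2 + 2 * \<epsilon> * c2 * z) has_field_derivative 2 * \<epsilon> * c2) (at 0)"
      by (rule derivative_eq_intros refl | simp)+
    moreover have "((\<lambda>z. 2 * \<epsilon> * d2 + 2 * \<epsilon> * c2 * z) has_field_derivative - 2 * \<epsilon> * c2) (at 0)"
      using D[of True True True True 0] unfolding cmp_sol U .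
    ultimately have "2 * \<epsilon> * c2 = - 2 * \<epsilon> * c2" by (rule DERIV_unique)
    then show ?thesis using assms(1) by simp
  qed
  have q: "cmp f False False False False z = cmp f False False False False 0 + c0 * z + c1 / 2 * z^2" for z
    by (rule quadratic_if_derivative[of "cmp f False False False False"]) (use D[of False False False False] c2 in \<open>simp add: cmp_sol\<close>)
  have "(cmp f False False False False 0 - d0) + (- d1) * z + (- c1 / 2 - d2) * z^2 = 0" for z
    using R[of False False False False z] q[of z] c2 by (simp add: cmp_sol power2_eq_square algebra_simps)
  \<comment> \<open>This ties the top component to the quadratic coefficient c1/2 of the body, as
    \<open>quad\<close> demands.\<close>
  from quadratic_eq_0(3)[OF this] have d2: "2 * d2 = - c1" by (simp add: field_simps)
  \<comment> \<open>In \<xi>-degree 1 the coefficient of z^2 is \<open>2 * b i\<close> by the Euler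
    relation but \<open>b i / 2\<close> by integration of f_x.\<close>
  have single: "b i = 0 \<and> 2 * g i = - a i \<and> (\<forall>z. cmp f b1 b2 b3 b4 z = 2 * e i + a i * z)"
    if "\<And>z. cmp (sol \<epsilon> c0 c1 c2 a b m) b1 b2 b3 b4 z = a i + b i * z"
      "\<And>z. e i + g i * z = cmp f b1 b2 b3 b4 z / 2 - z * (a i + b i * z)" for b1 b2 b3 b4 i
  proof -
    have v: "cmp f b1 b2 b3 b4 z = 2 * e i + 2 * (g i + a i) * z + 2 * b i * z^2" for z
      using that(2)[of z] by (simp add: field_simps power2_eq_square)
    have w: "cmp f b1 b2 b3 b4 z = cmp f b1 b2 b3 b4 0 + a i * z + b i / 2 * z^2" for z
      by (rule quadratic_if_derivative[of "cmp f b1 b2 b3 b4"]) (use D[of b1 b2 b3 b4] that(1) in simp)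
    have "0 + (2 * g i + a i) * z + (3 / 2 * b i) * z^2 = 0" for z
      using v[of z] w[of z] v[of 0] by (simp add: field_simps)
    note quadratic_eq_0[OF this]
    then have "b i = 0" "2 * g i = - a i" by (simp_all add: eq_neg_iff_add_eq_0)
    then show ?thesis using w v[of 0] by simp
  qed
  note s = single[of True False False False I1] single[of False True False False I2]
    single[of False False True False I3] single[of False False False True I4]
  have s1: "b I1 = 0" "2 * g I1 = - a I1" "\<And>z. cmp f True False False False z = 2 * e I1 + a I1 * z"
    using s(1) R[of True False False False] by (simp_all add: cmp_sol)
  have s2: "b I2 = 0" "2 * g I2 = - a I2" "\<And>z. cmp f False True False False z = 2 * e I2 + a I2 * z"
    using s(2) R[of False True False False] by (simp_all add: cmp_sol)
  have s3: "b I3 = 0" "2 * g I3 = - a I3" "\<And>z. cmp f False False True False z = 2 * e I3 + a I3 * z"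
    using s(3) R[of False False True False] by (simp_all add: cmp_sol)
  have s4: "b I4 = 0" "2 * g I4 = - a I4" "\<And>z. cmp f False False False True z = 2 * e I4 + a I4 * z"
    using s(4) R[of False False False True] by (simp_all add: cmp_sol)
  have t1: "cmp f False True True True z = \<epsilon> * a I1" for z
    using R[of False True True True z] s1(1,2) by (simp add: cmp_sol field_simps)
  have t2: "cmp f True False True True z = - \<epsilon> * a I2" for z
    using R[of True False True True z] s2(1,2) by (simp add: cmp_sol field_simps)
  have t3: "cmp f True True False True z = \<epsilon> * a I3" for z
    using R[of True True False True z] s3(1,2) by (simp add: cmp_sol field_simps)
  have t4: "cmp f True True True False z = - \<epsilon> * a I4" for z
    using R[of True True True False z] s4(1,2) by (simp add: cmp_sol field_simps)
  define k where "k i j = (let I = {i, j} in cmp f (I1 \<in> I) (I2 \<in> I) (I3 \<in> I) (I4 \<in> I) 0)" for i j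
  have "f = sol \<epsilon> (cmp f False False False False 0) c0 (c1 / 2) (\<lambda>i. 2 * e i) a k"
  proof (rule cmp_eqI[OF f sols_base_fun[OF sol_sols]])
    fix b1 b2 b3 b4 z
    have "2 * \<epsilon> * d2 = \<epsilon> * (2 * d2)" by simp
    then have U': "cmp f True True True True z = - (\<epsilon> * c1)" using U[of z] c2 unfolding d2 by simp
    show "cmp f b1 b2 b3 b4 z = cmp (sol \<epsilon> (cmp f False False False False 0) c0 (c1 / 2) (\<lambda>i. 2 * e i) a k) b1 b2 b3 b4 z"
      using p12[of z] p13[of z] p14[of z] p23[of z] p24[of z] p34[of z] U' q[of z]
        s1(3)[of z] s2(3)[of z] s3(3)[of z] s4(3)[of z] t1[of z] t2[of z] t3[of z] t4[of z]
      by (cases b1; cases b2; cases b3; cases b4) (simp_all add: cmp_sol k_def Let_def)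
  qed
  then obtain x0 x1 x2 x3 x4 x5 where "f = sol \<epsilon> x0 x1 x2 x3 x4 x5" by blast
  then show ?thesis by (simp add: sol_sols)
qed

section \<open>The symmetries are generated exactly by the solutions\<close>

lemma scalar_fun_1: "scalar_fun 1"
proof -
  have "rep (dbase m I 1) S = 0" if "S \<noteq> {}" for m I S
  proof (cases "I = {} \<and> m = 0")
    case True
    then show ?thesis using that by (simp add: dbase_def dxis_empty one_jfun.rep_eq const_def fun_eq_iff)
  next
    case False
    then have "dbase m I 1 = 0"
    proof (cases "I = {}")
      case True
      then obtain k where "m = Suc k" using False by (cases m) auto
      then show ?thesis by (simp add: dbase_Suc dbase_0)
    next
      case False
      then obtain i where "i \<in> I" by blast
      then have "dxis I 1 = 0" by (intro dxis_eq_0[of i]) auto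
      then show ?thesis by (simp add: dbase_def)
    qed
    then show ?thesis by (simp add: zero_jfun.rep_eq)
  qed
  then show ?thesis by (simp add: scalar_fun_def base_fun_1)
qed

lemma scalar_fun_X: "scalar_fun X"
proof -
  have "rep (dbase m I X) S = 0" if "S \<noteq> {}" for m I S
  proof (cases m)
    case 0
    show ?thesis
    proof (cases "I = {}")
      case True
      then show ?thesis using that by (simp add: 0 dbase_def dxis_empty crdj.rep_eq crd_def fun_eq_iff)
    next
      case False
      then obtain i where "i \<in> I" by blast
      then have "dxis I X = 0" by (intro dxis_eq_0[of i]) (auto simp: pdj_crdj)
      then show ?thesis by (simp add: 0 dbase_def zero_jfun.rep_eq)
    qed
  next
    case (Suc k)
    then have "dbase m I X = dbase k I 1" by (simp add: dbase_Suc pdj_crdj)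
    then show ?thesis using scalar_fun_1 that by (simp add: scalar_fun_def)
  qed
  then show ?thesis by (simp add: scalar_fun_def base_fun_X)
qed

lemma symmetries_system_E:
  assumes "\<epsilon> \<noteq> 0"
  shows "symmetries (system_E \<epsilon>) = (\<lambda>f u. rep (contact_pr f u)) ` sols \<epsilon>"
proof -
  have "f \<in> base_fun \<and> (\<forall>F\<in>ideal_j \<epsilon>. vap (contact_pr f) F \<in> ideal_j \<epsilon>) \<longleftrightarrow> f \<in> sols \<epsilon>" for f
  proof
    assume A: "f \<in> base_fun \<and> (\<forall>F\<in>ideal_j \<epsilon>. vap (contact_pr f) F \<in> ideal_j \<epsilon>)"
    then have f: "f \<in> base_fun" and sym: "F \<in> ideal_j \<epsilon> \<Longrightarrow> vap (contact_pr f) F \<in> ideal_j \<epsilon>" for F by blast+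
    have 1: "1 \<in> sols \<epsilon>" using xis_sols[of "{}" \<epsilon>] by (simp add: xis_eq UNIV_idx)
    show "f \<in> sols \<epsilon>"
      by (rule sols_if_YF_sols[OF assms f symmetry_imp_YF_sols[OF f sym scalar_fun_1 1]
            symmetry_imp_YF_sols[OF f sym scalar_fun_X X_sols]])
  next
    assume f: "f \<in> sols \<epsilon>"
    have "YF (part q f) s \<in> sols \<epsilon>" if s: "s \<in> sols \<epsilon>" for q s
    proof -
      obtain c0 c1 c2 a b m where 1: "part q f = sol \<epsilon> c0 c1 c2 a b m"
        using sols_imp_sol[OF assms sols_part[OF f]] by blast
      obtain d0 d1 d2 e g n where 2: "s = sol \<epsilon> d0 d1 d2 e g n"
        using sols_imp_sol[OF assms s] by blast
      show ?thesis unfolding 1 2 YF_sol by (rule sol_sols)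
    qed
    then show "f \<in> base_fun \<and> (\<forall>F\<in>ideal_j \<epsilon>. vap (contact_pr f) F \<in> ideal_j \<epsilon>)"
      using YF_sols_imp_symmetry[OF assms sols_base_fun[OF f]] sols_base_fun[OF f] by blast
  qed
  then show ?thesis unfolding symmetries_eq by auto
qed

section \<open>The isomorphism with \<open>D(2,1;a)\<close>\<close>

lemma sol_add: "sol \<epsilon> (c0 + d0) (c1 + d1) (c2 + d2) (\<lambda>i. a i + e i) (\<lambda>i. b i + f i) (\<lambda>i j. m i j + n i j) =
    sol \<epsilon> c0 c1 c2 a b m + sol \<epsilon> d0 d1 d2 e f n"
  unfolding sol_def by (simp add: cst_add sum_idx algebra_simps)

lemma sol_scale: "sol \<epsilon> (k * c0) (k * c1) (k * c2) (\<lambda>i. k * a i) (\<lambda>i. k * b i) (\<lambda>i j. k * m i j) =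
    cst k * sol \<epsilon> c0 c1 c2 a b m"
  unfolding sol_def by (simp add: cst_mult sum_idx distrib_left mult.assoc)

lemma sol_cong:
  assumes "c0 = d0" "c1 = d1" "c2 = d2" "\<And>i. a i = e i" "\<And>i. b i = f i"
    "m I1 I2 = n I1 I2" "m I1 I3 = n I1 I3" "m I1 I4 = n I1 I4"
    "m I2 I3 = n I2 I3" "m I2 I4 = n I2 I4" "m I3 I4 = n I3 I4"
  shows "sol \<epsilon> c0 c1 c2 a b m = sol \<epsilon> d0 d1 d2 e f n"
  unfolding sol_def using assms by simp

lemma sol_inject:
  assumes "sol \<epsilon> c0 c1 c2 a b m = sol \<epsilon> d0 d1 d2 e f n"
  shows "c0 = d0 \<and> c1 = d1 \<and> c2 = d2 \<and> a = e \<and> b = f \<and> m I1 I2 = n I1 I2 \<and> m I1 I3 = n I1 I3 \<and>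
    m I1 I4 = n I1 I4 \<and> m I2 I3 = n I2 I3 \<and> m I2 I4 = n I2 I4 \<and> m I3 I4 = n I3 I4"
proof -
  have e: "cmp (sol \<epsilon> c0 c1 c2 a b m) b1 b2 b3 b4 z = cmp (sol \<epsilon> d0 d1 d2 e f n) b1 b2 b3 b4 z" for b1 b2 b3 b4 z
    unfolding assms ..
  have "(c0 - d0) + (c1 - d1) * z + (c2 - d2) * z^2 = 0" for z
    using e[of False False False False z] by (simp add: cmp_sol algebra_simps)
  from quadratic_eq_0[OF this] have "c0 = d0" "c1 = d1" "c2 = d2" by simp_all
  moreover have "a i = e i" for i
    using e[of True False False False 0] e[of False True False False 0] e[of False False True False 0]
      e[of False False False True 0] by (cases i) (simp_all add: cmp_sol)
  moreover have "b i = f i" for i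
    using e[of True False False False 1] e[of False True False False 1] e[of False False True False 1]
      e[of False False False True 1] \<open>\<And>i. a i = e i\<close> by (cases i) (simp_all add: cmp_sol)
  ultimately show ?thesis
    using e[of True True False False 0] e[of True False True False 0] e[of True False False True 0]
      e[of False True True False 0] e[of False True False True 0] e[of False False True True 0]
    by (simp add: cmp_sol fun_eq_iff)
qed

text \<open>The first \<open>sl\<^sub>2\<close> is spanned by \<open>1, x, x\<^sup>2 - 2\<epsilon>\<xi>\<^sub>1\<xi>\<^sub>2\<xi>\<^sub>3\<xi>\<^sub>4\<close>. The other two are the self-dual and the
  anti-self-dual part of \<open>so\<^sub>4\<close>, spanned by the \<open>\<xi>\<^sub>i\<xi>\<^sub>j\<close>, and \<open>\<langle>\<xi>\<^sub>1, \<dots>, \<xi>\<^sub>4\<rangle>\<close> is identified with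
  \<open>\<complex>\<^sup>2 \<otimes> \<complex>\<^sup>2\<close> through the isotropic basis \<open>\<xi>\<^sub>1 \<plusminus> i\<xi>\<^sub>2, \<xi>\<^sub>3 \<plusminus> i\<xi>\<^sub>4\<close>. The scaling \<open>c = 2 / (1 + \<epsilon>)\<close> makes the
  bracket of the \<open>\<xi>\<^sub>i\<close> the pairing \<open>s\<^sub>1 \<eta> \<otimes> \<eta>\<close>.\<close>

definition iso_vec :: "complex \<Rightarrow> complex ^ 2 ^ 2 \<Rightarrow> idx \<Rightarrow> complex" where
  "iso_vec c v i = (case i of I1 \<Rightarrow> v $ 1 $ 1 + c * v $ 2 $ 2 | I2 \<Rightarrow> \<i> * (v $ 1 $ 1 - c * v $ 2 $ 2)
     | I3 \<Rightarrow> v $ 1 $ 2 - c * v $ 2 $ 1 | I4 \<Rightarrow> \<i> * (v $ 1 $ 2 + c * v $ 2 $ 1))"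

text \<open>As an antisymmetric matrix this is -2 times the action of \<open>B\<close> and
  \<open>C\<close> on the two factors, in the coordinates of \<open>iso_vec\<close>; the bracket in
  \<open>YF_sol\<close> acts by \<open>- asym m i j * e j / 2\<close>. The off-diagonal entries of
  \<open>B\<close> carry powers of \<open>c\<close> because they connect the two rows, of which
  \<open>iso_vec\<close> scales the second by \<open>c\<close>.\<close>

definition iso_mat :: "complex \<Rightarrow> mat2 \<Rightarrow> mat2 \<Rightarrow> idx \<Rightarrow> idx \<Rightarrow> complex" where
  "iso_mat c B C i j = (case (i, j) of
       (I1, I2) \<Rightarrow> 2 * \<i> * (B $ 1 $ 1 + C $ 1 $ 1)
     | (I3, I4) \<Rightarrow> 2 * \<i> * (B $ 1 $ 1 - C $ 1 $ 1)
     | (I1, I3) \<Rightarrow> B $ 1 $ 2 / c - c * B $ 2 $ 1 - C $ 1 $ 2 + C $ 2 $ 1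
     | (I1, I4) \<Rightarrow> \<i> * (B $ 1 $ 2 / c + c * B $ 2 $ 1 + C $ 1 $ 2 + C $ 2 $ 1)
     | (I2, I3) \<Rightarrow> \<i> * (B $ 1 $ 2 / c + c * B $ 2 $ 1 - C $ 1 $ 2 - C $ 2 $ 1)
     | (I2, I4) \<Rightarrow> - B $ 1 $ 2 / c + c * B $ 2 $ 1 - C $ 1 $ 2 + C $ 2 $ 1
     | _ \<Rightarrow> 0)"

text \<open>The triple X, H, Y of the first sl_2 goes to \<open>quad\<close>, 2x, -1. Of the first
  tensor factor, y gives the \<xi>_i and x the \<open>beta\<close>; the minus sign there matches the
  term \<open>- c2 * e i\<close> in \<open>YF_sol\<close>.\<close>

fun gam_sol :: "complex \<Rightarrow> gam \<Rightarrow> jfun" where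
  "gam_sol \<epsilon> (A, B, C, t) = sol \<epsilon> (- A $ 2 $ 1) (2 * A $ 1 $ 1) (A $ 1 $ 2)
     (iso_vec (2 / (1 + \<epsilon>)) (t $ 2)) (\<lambda>i. - iso_vec (2 / (1 + \<epsilon>)) (t $ 1) i) (iso_mat (2 / (1 + \<epsilon>)) B C)"

section \<open>Comparison of the structure constants\<close>

lemma sl2_iff: "A \<in> sl2 \<longleftrightarrow> A $ 2 $ 2 = - A $ 1 $ 1"
  by (simp add: sl2_def trace_def sum_2 eq_neg_iff_add_eq_0 add.commute)

lemma phi_entries:
  "phi 1 1 $ 1 $ 1 = 0" "phi 1 1 $ 1 $ 2 = 1" "phi 1 1 $ 2 $ 1 = 0" "phi 1 1 $ 2 $ 2 = 0"
  "phi 2 2 $ 1 $ 1 = 0" "phi 2 2 $ 1 $ 2 = 0" "phi 2 2 $ 2 $ 1 = - 1" "phi 2 2 $ 2 $ 2 = 0"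
  "phi 1 2 $ 1 $ 1 = - 1/2" "phi 1 2 $ 1 $ 2 = 0" "phi 1 2 $ 2 $ 1 = 0" "phi 1 2 $ 2 $ 2 = 1/2"
  "phi 2 1 $ 1 $ 1 = - 1/2" "phi 2 1 $ 1 $ 2 = 0" "phi 2 1 $ 2 $ 1 = 0" "phi 2 1 $ 2 $ 2 = 1/2"
  by (simp_all add: phi_def slX_def slY_def slH_def mscale_def vector_2)

lemma eta_values: "eta 1 1 = 0" "eta 2 2 = 0" "eta 1 2 = 1" "eta 2 1 = - 1"
  by (simp_all add: eta_def)

lemma mscale_entry: "mscale c A $ i $ j = c * A $ i $ j"
  by (simp add: mscale_def)

text \<open>\<open>pair1\<close>, \<open>pair2\<close> and \<open>pair3\<close> contract two tensors
  with \<eta> \<otimes> \<eta> in the two slots other than the named one.\<close>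

definition pair1 :: "tens \<Rightarrow> tens \<Rightarrow> 2 \<Rightarrow> 2 \<Rightarrow> complex" where
  "pair1 t u i l = t $ i $ 1 $ 1 * u $ l $ 2 $ 2 - t $ i $ 1 $ 2 * u $ l $ 2 $ 1 - t $ i $ 2 $ 1 * u $ l $ 1 $ 2 + t $ i $ 2 $ 2 * u $ l $ 1 $ 1"

definition pair2 :: "tens \<Rightarrow> tens \<Rightarrow> 2 \<Rightarrow> 2 \<Rightarrow> complex" where
  "pair2 t u j m = t $ 1 $ j $ 1 * u $ 2 $ m $ 2 - t $ 1 $ j $ 2 * u $ 2 $ m $ 1 - t $ 2 $ j $ 1 * u $ 1 $ m $ 2 + t $ 2 $ j $ 2 * u $ 1 $ m $ 1"

definition pair3 :: "tens \<Rightarrow> tens \<Rightarrow> 2 \<Rightarrow> 2 \<Rightarrow> complex" where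
  "pair3 t u k n = t $ 1 $ 1 $ k * u $ 2 $ 2 $ n - t $ 1 $ 2 $ k * u $ 2 $ 1 $ n - t $ 2 $ 1 $ k * u $ 1 $ 2 $ n + t $ 2 $ 2 $ k * u $ 1 $ 1 $ n"

lemma odd_bracket_entries:
  "odd_bracket1 t u $ 1 $ 1 = - (pair1 t u 1 2 + pair1 t u 2 1) / 2" "odd_bracket1 t u $ 1 $ 2 = pair1 t u 1 1"
  "odd_bracket1 t u $ 2 $ 1 = - pair1 t u 2 2"
  "odd_bracket2 t u $ 1 $ 1 = - (pair2 t u 1 2 + pair2 t u 2 1) / 2" "odd_bracket2 t u $ 1 $ 2 = pair2 t u 1 1"
  "odd_bracket2 t u $ 2 $ 1 = - pair2 t u 2 2"
  "odd_bracket3 t u $ 1 $ 1 = - (pair3 t u 1 2 + pair3 t u 2 1) / 2" "odd_bracket3 t u $ 1 $ 2 = pair3 t u 1 1"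
  "odd_bracket3 t u $ 2 $ 1 = - pair3 t u 2 2"
  by (simp_all add: odd_bracket1_def odd_bracket2_def odd_bracket3_def pair1_def pair2_def pair3_def
      sum_2 eta_values mscale_entry phi_entries)

lemma commutator_entries:
  "commutator A B $ i $ j = (A $ i $ 1 * B $ 1 $ j + A $ i $ 2 * B $ 2 $ j) - (B $ i $ 1 * A $ 1 $ j + B $ i $ 2 * A $ 2 $ j)"
  by (simp add: commutator_def matrix_matrix_mult_def sum_2)

lemma act_entries:
  "act A B C t $ i $ j $ k = (A $ i $ 1 * t $ 1 $ j $ k + A $ i $ 2 * t $ 2 $ j $ k) +
     (B $ j $ 1 * t $ i $ 1 $ k + B $ j $ 2 * t $ i $ 2 $ k) + (C $ k $ 1 * t $ i $ j $ 1 + C $ k $ 2 * t $ i $ j $ 2)"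
  by (simp add: act_def sum_2)

lemma gam_sol_bracket:
  assumes "\<epsilon> \<noteq> - 1" "a = (1 - \<epsilon>) / (1 + \<epsilon>)" and u: "u \<in> sl2 \<times> sl2 \<times> sl2 \<times> UNIV" and v: "v \<in> sl2 \<times> sl2 \<times> sl2 \<times> UNIV"
  shows "gam_sol \<epsilon> (gam_bracket (- 1 - a) 1 a u v) = YF (gam_sol \<epsilon> u) (gam_sol \<epsilon> v)"
proof -
  define c where "c = 2 / (1 + \<epsilon>)"
  have "1 + \<epsilon> \<noteq> 0" using assms(1) by (metis add_eq_0_iff)
  \<comment> \<open>Expressed by \<open>c\<close>, which is -s_1, all constants become \<epsilon> =
    2/c - 1, a = c - 1 and s_1 = -c, so the comparison is a rational identity whose only
    denominators are powers of \<open>c\<close> and numbers.\<close>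
  then have c: "c \<noteq> 0" "\<epsilon> = 2 / c - 1" "a = c - 1" "- 1 - a = - c"
    unfolding assms(2) c_def by (simp_all add: field_simps)
  obtain A B C t where u': "u = (A, B, C, t)" by (metis prod_cases4)
  obtain A' B' C' t' where v': "v = (A', B', C', t')" by (metis prod_cases4)
  have tr: "A $ 2 $ 2 = - A $ 1 $ 1" "B $ 2 $ 2 = - B $ 1 $ 1" "C $ 2 $ 2 = - C $ 1 $ 1"
    "A' $ 2 $ 2 = - A' $ 1 $ 1" "B' $ 2 $ 2 = - B' $ 1 $ 1" "C' $ 2 $ 2 = - C' $ 1 $ 1"
    using u v unfolding u' v' by (simp_all add: sl2_iff)
  note entries = commutator_entries mscale_entry odd_bracket_entries act_entries pair1_def pair2_def pair3_def tr
  show ?thesis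
    unfolding u' v' gam_bracket.simps gam_sol.simps YF_sol c_def[symmetric] c(4) c(3)
  proof (rule sol_cong, goal_cases)
    case (4 i)
    show ?case using c(1)
      by (cases i) (simp_all add: iso_vec_def iso_mat_def asym_def entries sum_idx, simp_all add: field_simps)
  next
    case (5 i)
    show ?case using c(1)
      by (cases i) (simp_all add: iso_vec_def iso_mat_def asym_def entries sum_idx, simp_all add: field_simps)
  qed (use c(1) in \<open>simp_all add: iso_vec_def iso_mat_def asym_def dual_def entries sum_idx c(2)\<close>,
       use c(1) in \<open>simp_all add: field_simps\<close>)
qed

section \<open>Linearity and bijectivity of the identification\<close>

lemma coef_cst_mult: "coef_x (cst k * f) = cst k * coef_x f" "coef_xi (cst k * f) i = cst k * coef_xi f i"
  by (simp_all add: coef_x_def coef_xi_def distrib_left sum_idx mult.assoc cst_left_commute[of "cst (1/2)" k])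

lemma charact_cst_mult: "charact (cst k * f) = cst k * charact f"
  by (simp add: charact_def coef_cst_mult right_diff_distrib sum_idx distrib_left mult.assoc)

lemma contact_pr_cst_mult: "contact_pr (cst k * f) u = cst k * contact_pr f u"
proof -
  have 1: "(inv_j ^^ n) (cst k * g) = cst k * (inv_j ^^ n) g" for n g by (induction n) auto
  have 2: "(Dxj ^^ n) (cst k * g) = cst k * (Dxj ^^ n) g" for n g
    by (induction n) (auto simp: Dxj_def vap_cst_mult)
  have "foldr Dxij is (cst k * g) = cst k * foldr Dxij is g" for "is" g
    by (induction "is") (auto simp: Dxij_def vap_cst_mult)
  then have 3: "Dxisj I (cst k * g) = cst k * Dxisj I g" for I g unfolding Dxisj_def .
  show ?thesis
    by (cases u) (simp_all add: coef_cst_mult charact_cst_mult 1 2 3 distrib_left sum_idx mult.assoc)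
qed

lemma coef_x_eq: "coef_x f = f + (\<Sum>i\<in>UNIV. coef_xi f i * xi i)"
  by (simp only: coef_x_def coef_xi_def sum_idx distrib_left mult.assoc)

text \<open>The generating function is recovered from the base coefficients of its field by
  \<open>coef_x_eq\<close>; geometrically it is the contact form evaluated on X_f.\<close>

lemma contact_pr_inject:
  assumes "(\<lambda>u. rep (contact_pr f u)) = (\<lambda>u. rep (contact_pr g u))"
  shows "f = g"
proof -
  have e: "contact_pr f u = contact_pr g u" for u
    using fun_cong[OF assms, of u] unfolding rep_inject .
  have "coef_xi f i = coef_xi g i" for i using e[of "Cxi i"] by simp
  moreover have "coef_x f = coef_x g" using e[of Cx] by simp
  ultimately show ?thesis unfolding coef_x_eq by simp
qed

lemma part_sol:
  "part False (sol \<epsilon> c0 c1 c2 a b m) = sol \<epsilon> c0 c1 c2 (\<lambda>_. 0) (\<lambda>_. 0) m" (is "?e = _")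
  "part True (sol \<epsilon> c0 c1 c2 a b m) = sol \<epsilon> 0 0 0 a b (\<lambda>_ _. 0)" (is "?o = _")
proof -
  note base = base_fun_part[OF sols_base_fun[OF sol_sols]] sols_base_fun[OF sol_sols]
  have "cmp ?e b1 b2 b3 b4 z = cmp (sol \<epsilon> c0 c1 c2 (\<lambda>_. 0) (\<lambda>_. 0) m) b1 b2 b3 b4 z" for b1 b2 b3 b4 z
    unfolding part_def cmp_cst_mult
    by (cases b1; cases b2; cases b3; cases b4) (simp_all add: cmp_sol cmp_inv_j sgn_j_def)
  then show "?e = sol \<epsilon> c0 c1 c2 (\<lambda>_. 0) (\<lambda>_. 0) m" by (intro cmp_eqI base)
  have "cmp ?o b1 b2 b3 b4 z = cmp (sol \<epsilon> 0 0 0 a b (\<lambda>_ _. 0)) b1 b2 b3 b4 z" for b1 b2 b3 b4 z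
    unfolding part_def cmp_cst_mult
    by (cases b1; cases b2; cases b3; cases b4) (simp_all add: cmp_sol cmp_inv_j sgn_j_def)
  then show "?o = sol \<epsilon> 0 0 0 a b (\<lambda>_ _. 0)" by (intro cmp_eqI base)
qed

lemma iso_vec_add: "iso_vec c (v + w) i = iso_vec c v i + iso_vec c w i"
  by (simp add: iso_vec_def algebra_simps split: idx.split)

lemma iso_mat_add: "iso_mat c (B + B') (C + C') i j = iso_mat c B C i j + iso_mat c B' C' i j"
  by (simp add: iso_mat_def algebra_simps add_divide_distrib diff_divide_distrib split: idx.split)

lemma gam_sol_add: "gam_sol \<epsilon> (u + v) = gam_sol \<epsilon> u + gam_sol \<epsilon> v"
proof -
  obtain A B C t A' B' C' t' where uv: "u = (A, B, C, t)" "v = (A', B', C', t')" by (metis prod_cases4)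
  show ?thesis unfolding uv gam_sol.simps sol_add[symmetric] plus_prod_def fst_conv snd_conv
    by (rule sol_cong) (simp_all add: iso_vec_add iso_mat_add)
qed

lemma iso_mat_scale: "iso_mat c (mscale k B) (mscale k C) i j = k * iso_mat c B C i j"
  by (simp add: iso_mat_def mscale_def algebra_simps split: idx.split)

lemma gam_sol_scale: "gam_sol \<epsilon> (gam_scale k u) = cst k * gam_sol \<epsilon> u"
proof -
  obtain A B C t where u: "u = (A, B, C, t)" by (metis prod_cases4)
  have "iso_vec c (tscale k t $ l) i = k * iso_vec c (t $ l) i" for c l i
    by (simp add: iso_vec_def tscale_def algebra_simps split: idx.split)
  then show ?thesis unfolding u gam_scale.simps gam_sol.simps sol_scale[symmetric]
    by (intro sol_cong) (simp_all add: iso_mat_scale mscale_entry)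
qed

lemma part_gam_sol:
  "part False (gam_sol \<epsilon> (A, B, C, t)) = gam_sol \<epsilon> (A, B, C, 0)"
  "part True (gam_sol \<epsilon> (A, B, C, t)) = gam_sol \<epsilon> (0, 0, 0, t)"
  unfolding gam_sol.simps part_sol
  by (rule sol_cong; simp add: iso_vec_def iso_mat_def split: idx.split)+

lemma iso_vec_inject:
  assumes "c \<noteq> 0" "iso_vec c v = iso_vec c w"
  shows "v = w"
proof -
  have "iso_vec c v i = iso_vec c w i" for i using assms(2) by simp
  from this[of I1] this[of I2] this[of I3] this[of I4] show ?thesis
    using assms(1) by (simp add: iso_vec_def vec_eq_iff forall_2) (auto simp: algebra_simps, algebra+)
qed

lemma gam_sol_inject:
  assumes "\<epsilon> \<noteq> - 1" "u \<in> sl2 \<times> sl2 \<times> sl2 \<times> UNIV" "v \<in> sl2 \<times> sl2 \<times> sl2 \<times> UNIV" "gam_sol \<epsilon> u = gam_sol \<epsilon> v"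
  shows "u = v"
proof -
  define c where "c = 2 / (1 + \<epsilon>)"
  have "1 + \<epsilon> \<noteq> 0" using assms(1) by (metis add_eq_0_iff)
  then have c: "c \<noteq> 0" by (simp add: c_def)
  obtain A B C t A' B' C' t' where uv: "u = (A, B, C, t)" "v = (A', B', C', t')" by (metis prod_cases4)
  have tr: "A $ 2 $ 2 = - A $ 1 $ 1" "B $ 2 $ 2 = - B $ 1 $ 1" "C $ 2 $ 2 = - C $ 1 $ 1"
    "A' $ 2 $ 2 = - A' $ 1 $ 1" "B' $ 2 $ 2 = - B' $ 1 $ 1" "C' $ 2 $ 2 = - C' $ 1 $ 1"
    using assms(2,3) unfolding uv by (simp_all add: sl2_iff)
  note s = sol_inject[OF assms(4)[unfolded uv gam_sol.simps c_def[symmetric]]]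
  have A: "A = A'" using s tr by (simp add: vec_eq_iff forall_2)
  have "t $ 2 = t' $ 2" using s iso_vec_inject[OF c, of "t $ 2" "t' $ 2"] by blast
  moreover have "t $ 1 = t' $ 1" using s iso_vec_inject[OF c, of "t $ 1" "t' $ 1"] by (simp add: fun_eq_iff)
  ultimately have t: "t = t'" by (simp add: vec_eq_iff forall_2)
  have m: "iso_mat c B C i j = iso_mat c B' C' i j" if "(i, j) \<in> {(I1,I2),(I1,I3),(I1,I4),(I2,I3),(I2,I4),(I3,I4)}" for i j
    using s that by auto
  have "B $ 1 $ 1 + C $ 1 $ 1 = B' $ 1 $ 1 + C' $ 1 $ 1" "B $ 1 $ 1 - C $ 1 $ 1 = B' $ 1 $ 1 - C' $ 1 $ 1"
    using m[of I1 I2] m[of I3 I4] by (simp_all add: iso_mat_def)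
  then have 1: "B $ 1 $ 1 = B' $ 1 $ 1" "C $ 1 $ 1 = C' $ 1 $ 1" by algebra+
  \<comment> \<open>In these differences, and with \<i> cancelled, the four remaining equations form
    a system with a Hadamard matrix, which is invertible.\<close>
  define P Q R S where "P = B $ 1 $ 2 / c - B' $ 1 $ 2 / c" and "Q = c * B $ 2 $ 1 - c * B' $ 2 $ 1"
    and "R = C $ 1 $ 2 - C' $ 1 $ 2" and "S = C $ 2 $ 1 - C' $ 2 $ 1"
  have "P - Q - R + S = iso_mat c B C I1 I3 - iso_mat c B' C' I1 I3"
    "\<i> * (P + Q + R + S) = iso_mat c B C I1 I4 - iso_mat c B' C' I1 I4"
    "\<i> * (P + Q - R - S) = iso_mat c B C I2 I3 - iso_mat c B' C' I2 I3"
    "- P + Q - R + S = iso_mat c B C I2 I4 - iso_mat c B' C' I2 I4"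
    by (simp_all add: iso_mat_def P_def Q_def R_def S_def algebra_simps)
  then have "P - Q - R + S = 0" "P + Q + R + S = 0" "P + Q - R - S = 0" "- P + Q - R + S = 0"
    using m[of I1 I3] m[of I1 I4] m[of I2 I3] m[of I2 I4] by simp_all
  then have "P = 0" "Q = 0" "R = 0" "S = 0" by algebra+
  with c 1 tr have "B = B'" "C = C'" by (simp_all add: vec_eq_iff forall_2 P_def Q_def R_def S_def)
  with A t show ?thesis unfolding uv by simp
qed

text \<open>The witness inverts the passage to the isotropic basis of \<open>iso_vec\<close>, by
  sums and differences of the pairs (a_1, a_2) and (a_3, a_4).\<close>

lemma iso_vec_surj:
  assumes "c \<noteq> 0"
  shows "iso_vec c (vector [vector [(a I1 - \<i> * a I2) / 2, (a I3 - \<i> * a I4) / 2],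
    vector [- (a I3 + \<i> * a I4) / (2 * c), (a I1 + \<i> * a I2) / (2 * c)]]) = a"
proof
  fix i
  show "iso_vec c (vector [vector [(a I1 - \<i> * a I2) / 2, (a I3 - \<i> * a I4) / 2],
    vector [- (a I3 + \<i> * a I4) / (2 * c), (a I1 + \<i> * a I2) / (2 * c)]]) i = a i"
    using assms by (cases i) (simp_all add: iso_vec_def vector_2 field_simps)
qed

lemma gam_sol_surj:
  assumes "\<epsilon> \<noteq> 0" "\<epsilon> \<noteq> - 1" "f \<in> sols \<epsilon>"
  shows "f \<in> gam_sol \<epsilon> ` (sl2 \<times> sl2 \<times> sl2 \<times> UNIV)"
proof -
  define c where "c = 2 / (1 + \<epsilon>)"
  have "1 + \<epsilon> \<noteq> 0" using assms(2) by (metis add_eq_0_iff)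
  then have c: "c \<noteq> 0" by (simp add: c_def)
  obtain c0 c1 c2 a b m where f: "f = sol \<epsilon> c0 c1 c2 a b m"
    using sols_imp_sol[OF assms(1,3)] by blast
  obtain v w where v: "iso_vec c v = a" and w: "iso_vec c w = (\<lambda>i. - b i)" using iso_vec_surj[OF c] by metis
  \<comment> \<open>The four entries of \<open>m\<close> outside (1,2) and (3,4), freed from \<i>.
    The inverse of the Hadamard matrix in the injectivity argument is a quarter of its transpose,
    whence the denominators 4 in \<open>B\<close> and \<open>C\<close>.\<close>
  define p q r s where "p = m I1 I3" and "q = - \<i> * m I1 I4" and "r = - \<i> * m I2 I3" and "s = m I2 I4"
  define A :: mat2 where "A = vector [vector [c1 / 2, c2], vector [- c0, - c1 / 2]]"
  define B :: mat2 where "B = vector [vector [(m I1 I2 + m I3 I4) / (4 * \<i>), c * (p + q + r - s) / 4],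
    vector [(q + r - p + s) / (4 * c), - (m I1 I2 + m I3 I4) / (4 * \<i>)]]"
  define C :: mat2 where "C = vector [vector [(m I1 I2 - m I3 I4) / (4 * \<i>), (q - p - r - s) / 4],
    vector [(p + q - r + s) / 4, - (m I1 I2 - m I3 I4) / (4 * \<i>)]]"
  have "gam_sol \<epsilon> (A, B, C, vector [w, v]) = f"
    unfolding f gam_sol.simps c_def[symmetric]
    by (rule sol_cong) (use c in \<open>simp_all add: v w A_def vector_2 iso_mat_def B_def C_def p_def q_def r_def s_def field_simps\<close>)
  moreover have "(A, B, C, vector [w, v]) \<in> sl2 \<times> sl2 \<times> sl2 \<times> (UNIV :: tens set)"
    by (simp add: sl2_iff A_def B_def C_def vector_2) (simp add: algebra_simps)
  ultimately show ?thesis by blast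
qed

theorem theorem4p6:
  fixes \<epsilon> a :: complex
  assumes "\<epsilon> \<noteq> 1" and "\<epsilon> \<noteq> - 1" and "\<epsilon> \<noteq> 0"
    and "a = (1 - \<epsilon>) / (1 + \<epsilon>)"
  shows "superalg_isomorphic (D21 a) (vfield_superalg (symmetries (system_E \<epsilon>)))"
proof -
  define \<Psi> where "\<Psi> f = (\<lambda>u. rep (contact_pr f u))" for f
  define \<phi> where "\<phi> u = \<Psi> (gam_sol \<epsilon> u)" for u
  let ?G = "sl2 \<times> sl2 \<times> sl2 \<times> (UNIV :: tens set)"
  have \<Psi>: "\<Psi> f = \<Psi> g \<longleftrightarrow> f = g" for f g unfolding \<Psi>_def using contact_pr_inject by blast
  have sols: "gam_sol \<epsilon> u \<in> sols \<epsilon>" for u by (metis prod_cases4 gam_sol.simps sol_sols)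
  then have base: "gam_sol \<epsilon> u \<in> base_fun" for u by (rule sols_base_fun)
  have sym: "symmetries (system_E \<epsilon>) = \<phi> ` ?G"
  proof -
    have "sols \<epsilon> = gam_sol \<epsilon> ` ?G" using gam_sol_surj[OF assms(3,2)] sols by blast
    then have "\<Psi> ` sols \<epsilon> = \<phi> ` ?G" by (simp add: \<phi>_def[abs_def] image_image)
    then show ?thesis unfolding symmetries_system_E[OF assms(3)] \<Psi>_def[abs_def] .
  qed
  have inj: "\<phi> u = \<phi> v \<longleftrightarrow> u = v" if "u \<in> ?G" "v \<in> ?G" for u v
    unfolding \<phi>_def \<Psi> using gam_sol_inject[OF assms(2) that] by blast
  have vpart: "vpart False (\<phi> (A, B, C, t)) = \<phi> (A, B, C, 0)" "vpart True (\<phi> (A, B, C, t)) = \<phi> (0, 0, 0, t)"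
    for A B C t unfolding \<phi>_def \<Psi>_def vpart_contact_pr part_gam_sol by (rule refl)+
  have 0: "0 \<in> sl2" by (simp add: sl2_iff)
  \<comment> \<open>Parity projection corresponds to deleting components of the quadruple, so by
    injectivity the homogeneous symmetries are the images of the homogeneous elements.\<close>
  have even: "vpart False (\<phi> (A, B, C, t)) = \<phi> (A, B, C, t) \<longleftrightarrow> t = 0" if "(A, B, C, t) \<in> ?G" for A B C t
  proof -
    have "(A, B, C, 0) \<in> ?G" using that by simp
    from inj[OF this that] show ?thesis unfolding vpart prod.inject by metis
  qed
  have odd: "vpart True (\<phi> (A, B, C, t)) = \<phi> (A, B, C, t) \<longleftrightarrow> A = 0 \<and> B = 0 \<and> C = 0" if "(A, B, C, t) \<in> ?G" for A B C t
  proof -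
    have "(0, 0, 0, t) \<in> ?G" using 0 by simp
    from inj[OF this that] show ?thesis unfolding vpart prod.inject by metis
  qed
  have "bij_betw \<phi> ?G (symmetries (system_E \<epsilon>))"
    unfolding sym by (rule inj_on_imp_bij_betw, rule inj_onI) (rule inj[THEN iffD1])
  moreover have "\<phi> ` (sl2 \<times> sl2 \<times> sl2 \<times> {0}) = {V \<in> symmetries (system_E \<epsilon>). vpart False V = V}"
  proof (intro subset_antisym subsetI)
    fix V
    assume "V \<in> \<phi> ` (sl2 \<times> sl2 \<times> sl2 \<times> {0})"
    then obtain A B C where V: "V = \<phi> (A, B, C, 0)" and *: "(A, B, C, 0) \<in> ?G" by blast
    show "V \<in> {V \<in> symmetries (system_E \<epsilon>). vpart False V = V}"
      unfolding sym V using even[OF *] * by blast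
  next
    fix V
    assume *: "V \<in> {V \<in> symmetries (system_E \<epsilon>). vpart False V = V}"
    then obtain A B C t where V: "V = \<phi> (A, B, C, t)" and G: "(A, B, C, t) \<in> ?G" unfolding sym by blast
    then have "t = 0" using * even[OF G] by blast
    then show "V \<in> \<phi> ` (sl2 \<times> sl2 \<times> sl2 \<times> {0})" unfolding V using G by blast
  qed
  moreover have "\<phi> ` ({0} \<times> {0} \<times> {0} \<times> UNIV) = {V \<in> symmetries (system_E \<epsilon>). vpart True V = V}"
  proof (intro subset_antisym subsetI)
    fix V
    assume "V \<in> \<phi> ` ({0} \<times> {0} \<times> {0} \<times> UNIV)"
    then obtain t where V: "V = \<phi> (0, 0, 0, t)" by blast
    have *: "(0, 0, 0, t) \<in> ?G" using 0 by simp
    show "V \<in> {V \<in> symmetries (system_E \<epsilon>). vpart True V = V}"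
      unfolding sym V using odd[OF *] * by blast
  next
    fix V
    assume *: "V \<in> {V \<in> symmetries (system_E \<epsilon>). vpart True V = V}"
    then obtain A B C t where V: "V = \<phi> (A, B, C, t)" and G: "(A, B, C, t) \<in> ?G" unfolding sym by blast
    then have "A = 0 \<and> B = 0 \<and> C = 0" using * odd[OF G] by blast
    then show "V \<in> \<phi> ` ({0} \<times> {0} \<times> {0} \<times> UNIV)" unfolding V by blast
  qed
  moreover have "\<phi> (gam_scale c u) = vscale c (\<phi> u)" for c u
    by (simp add: \<phi>_def \<Psi>_def gam_sol_scale contact_pr_cst_mult vscale_def times_jfun.rep_eq cst.rep_eq)
  moreover have "\<phi> (u + v) = \<phi> u + \<phi> v" for u v
    by (simp add: \<phi>_def \<Psi>_def gam_sol_add contact_pr_add plus_jfun.rep_eq fun_eq_iff)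
  moreover have "\<phi> (gam_bracket (- 1 - a) 1 a u v) = vbracket (\<phi> u) (\<phi> v)" if "u \<in> ?G" "v \<in> ?G" for u v
    unfolding \<phi>_def \<Psi>_def vbracket_contact_pr[OF base base] gam_sol_bracket[OF assms(2,4) that] ..
  ultimately have "superalg_iso (D21 a) (vfield_superalg (symmetries (system_E \<epsilon>))) \<phi>"
    unfolding superalg_iso_def D21_def Gamma_superalg_def vfield_superalg_def by simp
  then show ?thesis unfolding superalg_isomorphic_def by blast
qed

end
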